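(* Let $k\ge s\ge 1$ and let $u,v,\lambda_1,\dots,\lambda_s$ be given by the discretized approximation procedure described in the context (with $\hat\psi_j$ in place of $\psi_j$), and set $q_1:=u(h)$, $p_1:=v(h)$. Assume that $$\nabla g(u(c_ih))^\top M^{-1}v(c_ih)=0\in\mathbb{R}^\nu,\qquad i=1,\dots,s.$$ Then, for all $k\ge s$: $$H(q_1,p_1)=\begin{cases}H(q_0,p_0),&\text{if }U\text{ is a polynomial of degree at most }\mu,\text{ with }\mu\le 2k/s,\\ H(q_0,p_0)+O(h^{2k+1}),&\text{otherwise},\end{cases}\qquad g(q_1)=0.$$ Moreover, if $r$ denotes the convergence order of the procedure, then the hidden constraints satisfy $$\nabla g(u(h))^\top M^{-1}v(h)=O(h^{r+1})$$ at the first step, and, at the generic $n$-th step, $\nabla g(u_n(h))^\top M^{-1}v_n(h)=O(h^r)$.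
   Context: Problem. Let $1\le\nu\le m$, let $M\in\mathbb{R}^{m\times m}$ be symmetric positive definite, let $U$ be a real-valued function analytic on an open set $D\subseteq\mathbb{R}^m$ (the domain of interest, in which all position values considered lie), and let $g:\mathbb{R}^m\to\mathbb{R}^\nu$ have quadratic polynomial entries. $\nabla g(q)\in\mathbb{R}^{m\times\nu}$ is the matrix whose columns are the gradients of the entries of $g$. It is assumed that $\nabla g(q)^\top M^{-1}\nabla g(q)$ is symmetric positive definite for $q\in D$, with smallest eigenvalue bounded away from $0$. The Hamiltonian is $H(q,p)=\frac12p^\top M^{-1}p-U(q)$, and the constrained Hamiltonian problem is $\dot q=M^{-1}p$, $\dot p=\nabla U(q)-\nabla g(q)\lambda$, $g(q)=0$, $t\in[0,T]$, with consistent initial values $q(0)=q_0$, $p(0)=p_0$: $g(q_0)=0$ and $\nabla g(q_0)^\top M^{-1}p_0=0$. Its solution is $(q(t),p(t))$ with multiplier $\lambda(t)$. Notation. $P_j$, $j\ge0$, is the Legendre polynomial of degree $j$ shifted to $[0,1]$ and scaled so that $\int_0^1P_iP_j\,dx=\delta_{ij}$; $0<c_1<\dots<c_s<1$ are the zeros of $P_s$; $\ell_1,\dots,\ell_s$ are the Lagrange basis polynomials (degree $s-1$) on these nodes; $\hat c_1,\dots,\hat c_k$ and $\hat b_1,\dots,\hat b_k$ are the nodes and weights of the $k$-point Gauss–Legendre quadrature (order $2k$) on $[0,1]$. For functions on $[0,h]$, $\gamma_j(v)=\int_0^1P_j(\zeta)v(\zeta h)\,d\zeta$ and $\hat\psi_j(u)=\sum_{i=1}^k\hat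 b_iP_j(\hat c_i)\nabla U(u(\hat c_ih))$, the latter replacing $\psi_j(u)=\int_0^1P_j(\zeta)\nabla U(u(\zeta h))\,d\zeta$. Discretized procedure. The polynomials $u,v$ of degree at most $s$ and the vectors $\lambda_1,\dots,\lambda_s\in\mathbb{R}^\nu$ satisfy $$\dot u(ch)=M^{-1}\sum_{j=0}^{s-1}P_j(c)\gamma_j(v),\quad u(0)=q_0,\qquad \dot v(ch)=\sum_{j=0}^{s-1}P_j(c)\hat\psi_j(u)-\sum_{j=1}^{s}\ell_j(c)\nabla g(u(c_jh))\lambda_j,\quad v(0)=p_0,\qquad c\in[0,1]$$ (the dot is the time derivative), and the $\lambda_j$ are determined by $\nabla g(u(c_ih))^\top M^{-1}v(c_ih)=0$, $i=1,\dots,s$. Multi-step use: with $t_n=nh$, $(u_0,v_0):=(u,v)$, and $(u_n,v_n)$ is obtained on $[t_n,t_{n+1}]\subseteq[0,T]$ (in the local variable $ch\in[0,h]$) by the same procedure with initial values $u_n(0)=u_{n-1}(h)$, $v_n(0)=v_{n-1}(h)$. The solution considered is the one approximating the exact one: $u_n(ch)\approx q(t_n+ch)$, $v_n(ch)\approx p(t_n+ch)$, $\lambda_i^n\approx\lambda(t_n+c_ih)$ (differences tending to $0$ uniformly as $h\to0$), where $\lambda^n_i$ are the multipliers at step $n$. Convergence order $r$ means $u(h)-q(h)=O(h^{r+1})$, $v(h)-p(h)=O(h^{r+1})$ for the first step, and $u_n(h)-q(t_{n+1})=O(h^r)$, $v_n(h)-p(t_{n+1})=O(h^r)$ at the generic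 step with $t_{n+1}\le T$; here $r=s$ if $s$ is even and $r=s+1$ if $s$ is odd. All $O(\cdot)$ are for $h\to0^+$, with the problem, the initial data, $s$ and $k$ fixed. *)

theory Defs
  imports
    "HOL-Analysis.Analysis"
    "HOL-Library.Landau_Symbols"
    "HOL-Computational_Algebra.Polynomial"
begin

definition monomial_at :: "('m::finite \<Rightarrow> nat) \<Rightarrow> real^'m \<Rightarrow> real" where
  "monomial_at \<alpha> x = (\<Prod>i\<in>UNIV. (x $ i) ^ \<alpha> i)"

definition polynomial_degree_le_on :: "(real^'m::finite) set \<Rightarrow> nat \<Rightarrow> (real^'m \<Rightarrow> real) \<Rightarrow> bool" where
  "polynomial_degree_le_on D d f \<longleftrightarrow>
     (\<exists>a. \<forall>x\<in>D. f x = (\<Sum>\<alpha> | sum \<alpha> UNIV \<le> d. a \<alpha> * monomial_at \<alpha> x))"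

definition real_analytic_on :: "(real^'m::finite \<Rightarrow> real) \<Rightarrow> (real^'m) set \<Rightarrow> bool" where
  "real_analytic_on f D \<longleftrightarrow>
     (\<forall>x0\<in>D. \<exists>\<rho>>0. \<exists>a. \<forall>x\<in>ball x0 \<rho>.
        ((\<lambda>\<alpha>. a \<alpha> * monomial_at \<alpha> (x - x0)) has_sum f x) UNIV)"

definition polynomial_curve :: "nat \<Rightarrow> (real \<Rightarrow> real^'m::finite) \<Rightarrow> bool" where
  "polynomial_curve s w \<longleftrightarrow> (\<exists>a. \<forall>t. w t = (\<Sum>i\<le>s. t ^ i *\<^sub>R a i))"

definition grad :: "(real^'m::finite \<Rightarrow> real) \<Rightarrow> real^'m \<Rightarrow> real^'m" where
  "grad f x = (THE y. GDERIV f x :> y)"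

text \<open>The columns are the gradients of the entries (the transpose of the Jacobian matrix).\<close>

definition grad_matrix :: "(real^'m::finite \<Rightarrow> real^'n::finite) \<Rightarrow> real^'m \<Rightarrow> real^'n^'m" where
  "grad_matrix g x = (\<chi> i j. grad (\<lambda>y. g y $ j) x $ i)"

definition sym_pos_def :: "real^'n^'n::finite \<Rightarrow> bool" where
  "sym_pos_def A \<longleftrightarrow> transpose A = A \<and> (\<forall>x. x \<noteq> 0 \<longrightarrow> 0 < x \<bullet> (A *v x))"

definition eigenvals :: "real^'n^'n::finite \<Rightarrow> real set" where
  "eigenvals A = {l. \<exists>x. x \<noteq> 0 \<and> A *v x = l *\<^sub>R x}"

text \<open>Rodrigues' formula for the classical Legendre polynomials on the interval from -1 to 1.\<close>

definition legendre :: "nat \<Rightarrow> real poly" where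
  "legendre j = smult (1 / (2 ^ j * fact j)) ((pderiv ^^ j) ([:-1, 0, 1:] ^ j))"

definition shifted_legendre :: "nat \<Rightarrow> real poly" where
  "shifted_legendre j = pcompose (legendre j) [:-1, 2:]"

definition legendre01 :: "nat \<Rightarrow> real poly" where
  "legendre01 j =
     smult (1 / sqrt (integral {0..1} (\<lambda>x. (poly (shifted_legendre j) x)\<^sup>2))) (shifted_legendre j)"

text \<open>The zeros of \<open>legendre01 s\<close> in increasing order; the index runs from 1 to \<open>s\<close>.\<close>

definition gauss_node :: "nat \<Rightarrow> nat \<Rightarrow> real" where
  "gauss_node s i = sorted_list_of_set {x. poly (legendre01 s) x = 0} ! (i - 1)"

definition gauss_lagrange :: "nat \<Rightarrow> nat \<Rightarrow> real \<Rightarrow> real" where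
  "gauss_lagrange s j x =
     (\<Prod>i\<in>{1..s} - {j}. (x - gauss_node s i) / (gauss_node s j - gauss_node s i))"

definition gauss_weight :: "nat \<Rightarrow> nat \<Rightarrow> real" where
  "gauss_weight k i = integral {0..1} (gauss_lagrange k i)"

definition hamiltonian :: "real^'m^'m \<Rightarrow> (real^'m::finite \<Rightarrow> real) \<Rightarrow> real^'m \<Rightarrow> real^'m \<Rightarrow> real" where
  "hamiltonian M U q p = 1 / 2 * (p \<bullet> (matrix_inv M *v p)) - U q"

definition hidden_constraint ::
  "real^'m^'m \<Rightarrow> (real^'m::finite \<Rightarrow> real^'n::finite) \<Rightarrow> real^'m \<Rightarrow> real^'m \<Rightarrow> real^'n" where
  "hidden_constraint M g q p = transpose (grad_matrix g q) *v (matrix_inv M *v p)"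

definition exact_solution ::
  "real^'m^'m \<Rightarrow> (real^'m::finite \<Rightarrow> real) \<Rightarrow> (real^'m) set \<Rightarrow> (real^'m \<Rightarrow> real^'n::finite) \<Rightarrow> real \<Rightarrow>
   real^'m \<Rightarrow> real^'m \<Rightarrow> (real \<Rightarrow> real^'m) \<Rightarrow> (real \<Rightarrow> real^'m) \<Rightarrow> (real \<Rightarrow> real^'n) \<Rightarrow> bool" where
  "exact_solution M U D g T q0 p0 q p lam \<longleftrightarrow>
     q 0 = q0 \<and> p 0 = p0 \<and>
     (\<forall>t\<in>{0..T}.
        q t \<in> D \<and> g (q t) = 0 \<and>
        (q has_vector_derivative (matrix_inv M *v p t)) (at t within {0..T}) \<and>
        (p has_vector_derivative (grad U (q t) - grad_matrix g (q t) *v lam t)) (at t within {0..T}))"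

definition gamma_coeff :: "real \<Rightarrow> nat \<Rightarrow> (real \<Rightarrow> real^'m::finite) \<Rightarrow> real^'m" where
  "gamma_coeff h j v = integral {0..1} (\<lambda>z. poly (legendre01 j) z *\<^sub>R v (z * h))"

definition psi_hat ::
  "(real^'m::finite \<Rightarrow> real) \<Rightarrow> nat \<Rightarrow> real \<Rightarrow> nat \<Rightarrow> (real \<Rightarrow> real^'m) \<Rightarrow> real^'m" where
  "psi_hat U k h j u =
     (\<Sum>i=1..k. (gauss_weight k i * poly (legendre01 j) (gauss_node k i))
                  *\<^sub>R grad U (u (gauss_node k i * h)))"

text \<open>
  The values of the position polynomial are required to lie in the domain \<open>D\<close> on
  which \<open>U\<close> is analytic; outside \<open>D\<close> the gradient of \<open>U\<close> need not exist.
  The last conjunct determines the multipliers.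
  One step of size \<open>h\<close> starts from \<open>(q0, p0)\<close> and uses the local time variable \<open>c * h\<close>.
\<close>

definition procedure_step ::
  "real^'m^'m \<Rightarrow> (real^'m::finite \<Rightarrow> real) \<Rightarrow> (real^'m) set \<Rightarrow> (real^'m \<Rightarrow> real^'n::finite) \<Rightarrow>
   nat \<Rightarrow> nat \<Rightarrow> real \<Rightarrow> real^'m \<Rightarrow> real^'m \<Rightarrow>
   (real \<Rightarrow> real^'m) \<Rightarrow> (real \<Rightarrow> real^'m) \<Rightarrow> (nat \<Rightarrow> real^'n) \<Rightarrow> bool" where
  "procedure_step M U D g s k h q0 p0 u v l \<longleftrightarrow>
     polynomial_curve s u \<and> polynomial_curve s v \<and> u 0 = q0 \<and> v 0 = p0 \<and>
     (\<forall>c\<in>{0..1}.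
        u (c * h) \<in> D \<and>
        (u has_vector_derivative
           (matrix_inv M *v (\<Sum>j<s. poly (legendre01 j) c *\<^sub>R gamma_coeff h j v))) (at (c * h)) \<and>
        (v has_vector_derivative
           ((\<Sum>j<s. poly (legendre01 j) c *\<^sub>R psi_hat U k h j u) -
            (\<Sum>j=1..s. gauss_lagrange s j c
                         *\<^sub>R (grad_matrix g (u (gauss_node s j * h)) *v l j)))) (at (c * h))) \<and>
     (\<forall>i\<in>{1..s}.
        hidden_constraint M g (u (gauss_node s i * h)) (v (gauss_node s i * h)) = 0)"

text \<open>
  Families of numerical steps are indexed by \<open>x\<close>, with step size \<open>h x\<close> and initial time
  \<open>t x\<close>: for the first step \<open>x\<close> is the step size itself, for all steps it is a pair of
  step size and step number.
\<close>

definition approximates ::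
  "'x filter \<Rightarrow> ('x \<Rightarrow> real) \<Rightarrow> ('x \<Rightarrow> real) \<Rightarrow> nat \<Rightarrow>
   (real \<Rightarrow> real^'m::finite) \<Rightarrow> (real \<Rightarrow> real^'m) \<Rightarrow> (real \<Rightarrow> real^'n::finite) \<Rightarrow>
   ('x \<Rightarrow> real \<Rightarrow> real^'m) \<Rightarrow> ('x \<Rightarrow> real \<Rightarrow> real^'m) \<Rightarrow> ('x \<Rightarrow> nat \<Rightarrow> real^'n) \<Rightarrow> bool" where
  "approximates F h t s q p lam u v l \<longleftrightarrow>
     uniform_limit {0..1} (\<lambda>x c. u x (c * h x) - q (t x + c * h x)) (\<lambda>c. 0) F \<and>
     uniform_limit {0..1} (\<lambda>x c. v x (c * h x) - p (t x + c * h x)) (\<lambda>c. 0) F \<and>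
     (\<forall>i\<in>{1..s}. ((\<lambda>x. l x i - lam (t x + gauss_node s i * h x)) \<longlongrightarrow> 0) F)"

text \<open>
  Pairs of step size \<open>h\<close> and step number \<open>n\<close> with \<open>h\<close> tending to 0 from above, and the
  \<open>n\<close>-th step contained in the time interval.  Limits and Landau estimates along this filter
  are uniform in \<open>n\<close>.
\<close>

definition steps_filter :: "real \<Rightarrow> (real \<times> nat) filter" where
  "steps_filter T =
     inf (filtercomap fst (at_right 0)) (principal {(h, n). real (n + 1) * h \<le> T})"

definition multi_step ::
  "real^'m^'m \<Rightarrow> (real^'m::finite \<Rightarrow> real) \<Rightarrow> (real^'m) set \<Rightarrow> (real^'m \<Rightarrow> real^'n::finite) \<Rightarrow>
   nat \<Rightarrow> nat \<Rightarrow> real \<Rightarrow> real \<Rightarrow> real^'m \<Rightarrow> real^'m \<Rightarrow>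
   (nat \<Rightarrow> real \<Rightarrow> real^'m) \<Rightarrow> (nat \<Rightarrow> real \<Rightarrow> real^'m) \<Rightarrow> (nat \<Rightarrow> nat \<Rightarrow> real^'n) \<Rightarrow> bool" where
  "multi_step M U D g s k T h q0 p0 u v l \<longleftrightarrow>
     (\<forall>n. real (n + 1) * h \<le> T \<longrightarrow>
        procedure_step M U D g s k h
          (if n = 0 then q0 else u (n - 1) h) (if n = 0 then p0 else v (n - 1) h)
          (u n) (v n) (l n))"

definition convergence_order ::
  "real \<Rightarrow> (real \<Rightarrow> real^'m::finite) \<Rightarrow> (real \<Rightarrow> real^'m) \<Rightarrow>
   (real \<Rightarrow> nat \<Rightarrow> real \<Rightarrow> real^'m) \<Rightarrow> (real \<Rightarrow> nat \<Rightarrow> real \<Rightarrow> real^'m) \<Rightarrow> nat \<Rightarrow> bool" where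
  "convergence_order T q p u v r \<longleftrightarrow>
     (\<lambda>h. norm (u h 0 h - q h)) \<in> O[at_right 0](\<lambda>h. h ^ (r + 1)) \<and>
     (\<lambda>h. norm (v h 0 h - p h)) \<in> O[at_right 0](\<lambda>h. h ^ (r + 1)) \<and>
     (\<lambda>(h, n). norm (u h n h - q (real (n + 1) * h))) \<in> O[steps_filter T](\<lambda>(h, n). h ^ r) \<and>
     (\<lambda>(h, n). norm (v h n h - p (real (n + 1) * h))) \<in> O[steps_filter T](\<lambda>(h, n). h ^ r)"

end

theory Submission
  imports Defs
begin

text \<open>
  The conservation statements are statements about Gauss quadrature. Rescale a step to
  \<open>c \<in> [0, 1]\<close>. The momentum polynomial has degree at most \<open>s\<close>; its Legendre series, cut off before
  \<open>P\<^sub>s\<close>, is its interpolation polynomial at the Gauss nodes \<open>c\<^sub>1, \<dots>, c\<^sub>s\<close>, because the part cut off is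
  a multiple of \<open>P\<^sub>s\<close> (\<open>legendre_projection_eq_gauss_interp\<close>). The rate of change of each constraint
  along the position polynomial is then a polynomial of degree at most \<open>2 s - 1\<close> that vanishes
  at the Gauss nodes, so its integral is zero (\<open>constraint_preserved\<close>). In the same way the
  multipliers do no work over a step, and the energy error is exactly the error of the \<open>k\<close>-point
  Gauss rule for the power \<open>\<nabla>U(q) \<bullet> q'\<close> (\<open>energy_change\<close>). If \<open>U\<close> is a polynomial of degree at most
  \<open>\<mu> \<le> 2 k / s\<close>, then \<open>U(q)\<close> is a polynomial of degree at most \<open>2 k\<close> in \<open>c\<close>, the rule is exact, and the energy is
  conserved (\<open>energy_preserved\<close>).

  For general \<open>U\<close> the quadrature error is \<open>O(h\<^bsup>2 k + 1\<^esup>)\<close> provided that the numerical solution is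
  smooth in the local time \<open>t = h c\<close> uniformly in \<open>h\<close>. This has to be derived from the equations,
  since the multipliers are only known implicitly; convergence of the multipliers alone bounds
  no higher derivative. Smoothness to order \<open>r\<close> is expressed by \<open>h_jet r\<close>: up to an error
  \<open>O(h\<^sup>r)\<close>, a quantity is a polynomial in \<open>h c\<close> with bounded coefficients. The order is raised step
  by step (\<open>h_jet_p_Suc\<close>), starting from the boundedness of the momenta. If the momenta
  are smooth to order \<open>r \<le> s\<close>, then the hidden constraint \<open>\<nabla>g(q)\<^sup>T M\<^sup>-\<^sup>1 p\<close> is a polynomial of degree
  at most \<open>s\<close> in \<open>c\<close> up to \<open>O(h\<^bsup>r + 1\<^esup>)\<close>; as it vanishes at the \<open>s + 1\<close> points \<open>0, c\<^sub>1, \<dots>, c\<^sub>s\<close>, it is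
  \<open>O(h\<^bsup>r + 1\<^esup>)\<close> throughout (\<open>hidden_residual_order\<close>). Differentiating it yields a linear system for
  the multipliers whose matrix is a perturbation of \<open>\<nabla>g(q\<^sub>0)\<^sup>T M\<^sup>-\<^sup>1 \<nabla>g(q\<^sub>0)\<close>, so the multipliers
  are smooth to order \<open>r\<close> (\<open>h_jet_multiplier\<close>), and integrating the momentum equation gains one
  power of \<open>h\<close>. At order \<open>s\<close>, all coefficients of the polynomials in \<open>c\<close> have the size of Taylor
  coefficients, so that smoothness of every order follows (\<open>h_jet_work_rate\<close>).

  The hidden constraint vanishes along the exact solution, and it is affine in \<open>q\<close> and linear in
  \<open>p\<close>. Its value at the end of a step is therefore bounded by the global error
  (\<open>hidden_constraint_order\<close>).
\<close>

section \<open>Legendre polynomials and Gauss quadrature\<close>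

lemma higher_pderiv_root:
  fixes f :: "real poly"
  assumes "[:-a, 1:] ^ n dvd f" "i < n"
  shows "poly ((pderiv ^^ i) f) a = 0"
proof -
  have "[:-a, 1:] ^ (n - i) dvd (pderiv ^^ i) f"
    using assms(2)
  proof (induction i)
    case 0
    then show ?case using assms(1) by simp
  next
    case (Suc i)
    define m where "m = n - Suc i"
    have "n - i = Suc m" using Suc.prems by (simp add: m_def)
    with Suc obtain q where q: "(pderiv ^^ i) f = [:-a, 1:] ^ Suc m * q"
      by (metis Suc_lessD dvdE)
    have "(pderiv ^^ Suc i) f = [:-a, 1:] ^ m * (smult (of_nat (Suc m)) q + [:-a, 1:] * pderiv q)"
      by (simp add: q pderiv_mult pderiv_power_Suc pderiv_pCons algebra_simps del: power_Suc)
         (simp add: algebra_simps)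
    then show ?case by (simp add: m_def)
  qed
  then have "[:-a, 1:] dvd (pderiv ^^ i) f"
    using assms(2) by (metis dvd_power dvd_trans zero_less_diff)
  then show ?thesis by (simp add: poly_eq_0_iff_dvd)
qed

lemma integral_poly_pderiv:
  fixes p :: "real poly"
  shows "((\<lambda>x. poly (pderiv p) x) has_integral (poly p 1 - poly p 0)) {0..1}"
  by (rule fundamental_theorem_of_calculus)
     (simp_all add: has_real_derivative_iff_has_vector_derivative[symmetric]
        has_field_derivative_at_within poly_DERIV)

lemma poly_integrable [simp]: "(\<lambda>x. poly p (x::real)) integrable_on {a..b}"
  by (intro integrable_continuous_interval continuous_intros)

lemma poly_add_fun: "poly (p + q) = (\<lambda>x. poly p x + poly (q :: real poly) x)"
  by (simp add: fun_eq_iff)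

lemma poly_smult_fun: "poly (smult c p) = (\<lambda>x. c * poly (p :: real poly) x)"
  by (simp add: fun_eq_iff)

lemma integral_by_parts_poly:
  fixes f q :: "real poly"
  assumes "poly f 0 = 0" "poly f 1 = 0"
  shows "integral {0..1} (poly (pderiv f * q)) = - integral {0..1} (poly (f * pderiv q))"
proof -
  have "integral {0..1} (poly (pderiv (f * q))) = 0"
    using integral_poly_pderiv[of "f*q"] assms by (simp add: integral_unique)
  moreover have "integral {0..1} (poly (pderiv (f * q)))
      = integral {0..1} (poly (pderiv f * q)) + integral {0..1} (poly (f * pderiv q))"
    by (simp add: pderiv_mult add.commute mult.commute integral_add[symmetric] poly_add_fun del: poly_mult)
  ultimately show ?thesis by simp
qed

lemma integral_poly_0 [simp]: "integral S (poly (0::real poly)) = 0"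
proof -
  have "poly (0::real poly) = (\<lambda>x. 0)" by auto
  then show ?thesis by simp
qed

lemma higher_pderiv_eq_0: "degree (q::real poly) < j \<Longrightarrow> (pderiv ^^ j) q = 0"
proof (induction j arbitrary: q)
  case (Suc j)
  show ?case
  proof (cases "degree q = 0")
    case True
    then have "pderiv q = 0" by (simp add: pderiv_eq_0_iff)
    moreover have "(pderiv ^^ j) (0 :: real poly) = 0" by (induction j) auto
    ultimately show ?thesis by (simp add: funpow_swap1)
  next
    case False
    then show ?thesis using Suc by (simp add: funpow_swap1 degree_pderiv)
  qed
qed simp

text \<open>
  The boundary terms vanish for all derivatives of order below \<open>n\<close>, so each integration by parts
  moves one derivative to the other factor.
\<close>

lemma integral_by_parts_poly_higher:
  fixes f q :: "real poly"
  assumes "\<And>i. i < n \<Longrightarrow> poly ((pderiv ^^ i) f) 0 = 0" "\<And>i. i < n \<Longrightarrow> poly ((pderiv ^^ i) f) 1 = 0"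
  shows "integral {0..1} (poly ((pderiv ^^ n) f * q)) = (-1) ^ n * integral {0..1} (poly (f * (pderiv ^^ n) q))"
  using assms
proof (induction n arbitrary: q)
  case (Suc n)
  have "integral {0..1} (poly ((pderiv ^^ Suc n) f * q)) = - integral {0..1} (poly ((pderiv ^^ n) f * pderiv q))"
    using integral_by_parts_poly[of "(pderiv ^^ n) f" q] Suc.prems by simp
  also have "\<dots> = - ((-1) ^ n * integral {0..1} (poly (f * (pderiv ^^ n) (pderiv q))))"
    using Suc by (subst Suc.IH) auto
  finally show ?case by (simp add: funpow_swap1 del: poly_mult)
qed simp

text \<open>
  The polynomial \<open>(4 x (x - 1))\<^sup>j\<close> that takes the place of \<open>(x\<^sup>2 - 1)\<^sup>j\<close> in Rodrigues' formula after
  the substitution \<open>x \<mapsto> 2 x - 1\<close>.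
\<close>

definition rodrigues_base :: "nat \<Rightarrow> real poly" where
  "rodrigues_base j = [:0, -4, 4:] ^ j"

lemma rodrigues_base_root:
  assumes "i < j"
  shows "poly ((pderiv ^^ i) (rodrigues_base j)) 0 = 0" "poly ((pderiv ^^ i) (rodrigues_base j)) 1 = 0"
proof -
  have eq: "[:0, -4, 4:] = [:- 0, 1:] * [:-4, 4::real:]" "[:0, -4, 4:] = [:- 1, 1:] * [:0, 4::real:]"
    by simp_all
  have "[:- 0, 1:] ^ j dvd rodrigues_base j"
    unfolding rodrigues_base_def eq(1) power_mult_distrib by (rule dvd_triv_left)
  moreover have "[:- 1, 1:] ^ j dvd rodrigues_base j"
    unfolding rodrigues_base_def eq(2) power_mult_distrib by (rule dvd_triv_left)
  ultimately show "poly ((pderiv ^^ i) (rodrigues_base j)) 0 = 0" "poly ((pderiv ^^ i) (rodrigues_base j)) 1 = 0"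
    using higher_pderiv_root assms by blast+
qed

lemma shifted_legendre_rodrigues:
  obtains c where "c \<noteq> 0" "shifted_legendre j = smult c ((pderiv ^^ j) (rodrigues_base j))"
proof -
  have *: "(pderiv ^^ i) (pcompose f [:-1, 2:]) = smult (2 ^ i) (pcompose ((pderiv ^^ i) f) [:-1, 2:])"
    for i and f :: "real poly"
    by (induction i) (auto simp: pderiv_smult pderiv_pcompose pderiv_pCons mult.commute)
  have b: "rodrigues_base j = pcompose ([:-1, 0, 1:] ^ j) [:-1, 2:]"
  proof -
    have "[:0, -4, 4:] = pcompose [:-1, 0, 1:] [:-1, 2::real:]" by (simp add: pcompose_pCons)
    then show ?thesis unfolding rodrigues_base_def
      by (induction j) (simp_all only: power_Suc power_0 pcompose_mult pcompose_1)
  qed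
  have "shifted_legendre j = smult (1 / (2 ^ j * fact j)) (pcompose ((pderiv ^^ j) ([:-1, 0, 1:] ^ j)) [:-1, 2:])"
    by (simp add: shifted_legendre_def legendre_def pcompose_smult)
  also have "\<dots> = smult (1 / (2 ^ j * 2 ^ j * fact j)) ((pderiv ^^ j) (rodrigues_base j))"
    unfolding b * by simp
  finally show ?thesis using that by (metis divide_eq_0_iff fact_nonzero mult_eq_0_iff power_not_zero zero_neq_numeral zero_neq_one)
qed

lemma degree_rodrigues: "degree ((pderiv ^^ i) (rodrigues_base j)) = 2 * j - i"
proof (induction i)
  case 0
  then show ?case by (simp add: rodrigues_base_def degree_power_eq)
next
  case (Suc i)
  then show ?case by (simp add: degree_pderiv)
qed

text \<open>
  Induction by Rolle's theorem. As long as fewer than \<open>j\<close> derivatives have been taken, the end points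
  \<open>0\<close> and \<open>1\<close> are zeros too; together with the \<open>i\<close> interior zeros they bound \<open>i + 1\<close> gaps, each of
  which contains a zero of the next derivative. The end points are stored as the first and the last
  member of the increasing sequence, although they need not be zeros for \<open>i = j\<close>.
\<close>

lemma rodrigues_zeros:
  assumes "i \<le> j"
  shows "\<exists>z. z 0 = 0 \<and> z (Suc i) = 1 \<and> (\<forall>n\<le>i. z n < z (Suc n)) \<and>
    (\<forall>n. 1 \<le> n \<and> n \<le> i \<longrightarrow> poly ((pderiv ^^ i) (rodrigues_base j)) (z n) = (0::real))"
  using assms
proof (induction i)
  case 0
  show ?case by (rule exI[of _ "\<lambda>n. real n"]) auto
next
  case (Suc i)
  let ?f = "(pderiv ^^ i) (rodrigues_base j)"
  obtain z where z: "z 0 = 0" "z (Suc i) = 1" "\<And>n. n \<le> i \<Longrightarrow> z n < z (Suc n)"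
    "\<And>n. 1 \<le> n \<Longrightarrow> n \<le> i \<Longrightarrow> poly ?f (z n) = (0::real)"
    using Suc by auto
  have zero: "poly ?f (z n) = 0" if "n \<le> Suc i" for n
  proof -
    have "n = 0 \<or> (1 \<le> n \<and> n \<le> i) \<or> n = Suc i" using that by linarith
    then show ?thesis using z rodrigues_base_root[of i j] Suc.prems by auto
  qed
  have "\<exists>x. z n < x \<and> x < z (Suc n) \<and> poly (pderiv ?f) x = 0" if "n \<le> i" for n
    using poly_MVT[OF z(3)[OF that], of ?f] zero[of n] zero[of "Suc n"] z(3)[OF that] that
    by auto
  then obtain w where w: "\<And>n. n \<le> i \<Longrightarrow> z n < w n \<and> w n < z (Suc n) \<and> poly (pderiv ?f) (w n) = 0"
    by metis
  define y where "y n = (if n = 0 then 0 else if n = Suc (Suc i) then 1 else w (n - 1))" for n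
  have "y n < y (Suc n)" if n: "n \<le> Suc i" for n
  proof (cases n)
    case 0
    then show ?thesis using w[of 0] z by (auto simp: y_def)
  next
    case (Suc m)
    show ?thesis
    proof (cases "n = Suc i")
      case True
      then show ?thesis using w[of i] z Suc by (auto simp: y_def)
    next
      case False
      then have "m < i" using Suc n by simp
      then have "w m < z (Suc m)" "z (Suc m) < w (Suc m)" using w by auto
      then show ?thesis using Suc False n by (auto simp: y_def)
    qed
  qed
  moreover have "poly ((pderiv ^^ Suc i) (rodrigues_base j)) (y n) = 0" if "1 \<le> n" "n \<le> Suc i" for n
    using w[of "n-1"] that by (auto simp: y_def)
  ultimately show ?case by (intro exI[of _ y]) (auto simp: y_def)
qed

text \<open>
  The normalization is legitimate since the integral of the square of a nonzero polynomial is
  positive.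
\<close>

lemma legendre01_rodrigues:
  obtains c where "c \<noteq> 0" "legendre01 j = smult c ((pderiv ^^ j) (rodrigues_base j))"
    "integral {0..1} (\<lambda>x. (poly (legendre01 j) x)\<^sup>2) = 1"
proof -
  obtain c where c: "c \<noteq> 0" "shifted_legendre j = smult c ((pderiv ^^ j) (rodrigues_base j))"
    by (rule shifted_legendre_rodrigues)
  let ?I = "integral {0..1} (\<lambda>x. (poly (shifted_legendre j) x)\<^sup>2)"
  have nz: "shifted_legendre j \<noteq> 0"
  proof (cases j)
    case 0
    then show ?thesis using c by (simp add: rodrigues_base_def)
  next
    case (Suc i)
    then show ?thesis using c degree_rodrigues[of j j] by (metis add_diff_cancel_left' degree_0 mult_2 nat.distinct(1) smult_eq_0_iff)
  qed
  have "?I \<ge> 0" by (intro integral_nonneg integrable_continuous_interval continuous_intros) auto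
  moreover have "?I \<noteq> 0"
  proof
    assume "?I = 0"
    then have "\<And>x. x \<in> {0..1} \<Longrightarrow> (poly (shifted_legendre j) x)\<^sup>2 = 0"
      by (subst (asm) integral_eq_0_iff) (auto intro!: continuous_intros)
    then have "{0..1} \<subseteq> {x. poly (shifted_legendre j) x = 0}" by auto
    moreover have "finite {x. poly (shifted_legendre j) x = 0}" using nz by (rule poly_roots_finite)
    ultimately show False by (meson finite_subset infinite_Icc zero_less_one)
  qed
  ultimately have "?I > 0" by simp
  show ?thesis
  proof (rule that[of "c / sqrt ?I"])
    show "c / sqrt ?I \<noteq> 0" using c \<open>?I > 0\<close> by simp
    show "legendre01 j = smult (c / sqrt ?I) ((pderiv ^^ j) (rodrigues_base j))"
      unfolding legendre01_def by (subst (2) c) simp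
    have "integral {0..1} (\<lambda>x. (poly (legendre01 j) x)\<^sup>2) = integral {0..1} (\<lambda>x. (1 / ?I) * (poly (shifted_legendre j) x)\<^sup>2)"
      unfolding legendre01_def using \<open>?I > 0\<close> by (simp add: power_mult_distrib power_divide)
    also have "\<dots> = (1 / ?I) * ?I" by (rule integral_mult_right)
    also have "\<dots> = 1" using \<open>?I > 0\<close> by simp
    finally show "integral {0..1} (\<lambda>x. (poly (legendre01 j) x)\<^sup>2) = 1" .
  qed
qed

lemma degree_legendre01 [simp]: "degree (legendre01 j) = j"
proof -
  obtain c where "c \<noteq> 0" "legendre01 j = smult c ((pderiv ^^ j) (rodrigues_base j))"
    by (rule legendre01_rodrigues)
  then show ?thesis by (simp add: degree_rodrigues)
qed

lemma legendre01_nonzero [simp]: "legendre01 j \<noteq> 0"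
proof -
  have "integral {0..1} (\<lambda>x. (poly (legendre01 j) x)\<^sup>2) = 1"
    by (rule legendre01_rodrigues)
  then show ?thesis by auto
qed

lemma legendre01_orthogonal:
  assumes "degree q < j"
  shows "integral {0..1} (poly (legendre01 j * q)) = 0"
proof -
  obtain c where c: "legendre01 j = smult c ((pderiv ^^ j) (rodrigues_base j))"
    by (rule legendre01_rodrigues)
  have "integral {0..1} (poly ((pderiv ^^ j) (rodrigues_base j) * q)) = 0"
    using integral_by_parts_poly_higher[OF rodrigues_base_root, of j j q] higher_pderiv_eq_0[OF assms]
    by (simp del: poly_mult)
  then show ?thesis using integral_mult_right[of "{0..1}" c "poly ((pderiv ^^ j) (rodrigues_base j) * q)"]
    by (simp add: c poly_smult_fun del: poly_mult)
qed

lemma legendre01_orthonormal: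
  "integral {0..1} (poly (legendre01 i * legendre01 j)) = (if i = j then 1 else 0)"
proof -
  have "integral {0..1} (poly (legendre01 i * legendre01 i)) = 1"
  proof -
    have "integral {0..1} (\<lambda>x. (poly (legendre01 i) x)\<^sup>2) = 1"
      by (rule legendre01_rodrigues)
    moreover have "poly (legendre01 i * legendre01 i) = (\<lambda>x. (poly (legendre01 i) x)\<^sup>2)"
      by (simp add: fun_eq_iff power2_eq_square)
    ultimately show ?thesis by metis
  qed
  moreover have "integral {0..1} (poly (legendre01 i * legendre01 j)) = 0" if "i < j"
    using legendre01_orthogonal[of "legendre01 i" j] that by (metis degree_legendre01 mult.commute)
  moreover have "integral {0..1} (poly (legendre01 i * legendre01 j)) = 0" if "j < i"
    using legendre01_orthogonal[of "legendre01 j" i] that by (metis degree_legendre01)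
  ultimately show ?thesis by (cases i j rule: linorder_cases) auto
qed

text \<open>
  Rolle's theorem provides \<open>s\<close> zeros inside the interval, and the degree excludes any others. This
  is what makes the enumeration of the nodes by a sorted list meaningful.
\<close>

lemma legendre01_roots:
  shows "card {x. poly (legendre01 s) x = 0} = s" "{x. poly (legendre01 s) x = 0} \<subseteq> {0<..<1}"
    "finite {x. poly (legendre01 s) x = 0}"
proof -
  let ?R = "{x. poly (legendre01 s) x = 0}"
  show fin: "finite ?R" by (rule poly_roots_finite) simp
  obtain c where c: "legendre01 s = smult c ((pderiv ^^ s) (rodrigues_base s))"
    by (rule legendre01_rodrigues)
  obtain z where z: "z 0 = 0" "z (Suc s) = 1" "\<And>n. n \<le> s \<Longrightarrow> z n < z (Suc n)"
    "\<And>n. 1 \<le> n \<Longrightarrow> n \<le> s \<Longrightarrow> poly ((pderiv ^^ s) (rodrigues_base s)) (z n) = (0::real)"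
    using rodrigues_zeros[of s s] by auto
  have mono: "z m < z n" if "m < n" "n \<le> Suc s" for m n
    using that by (induction n) (auto simp: less_Suc_eq intro: less_trans z(3))
  have inj: "inj_on z {1..s}"
    by (rule inj_onI) (metis atLeastAtMost_iff le_SucI less_irrefl linorder_neqE_nat mono)
  have sub: "z ` {1..s} \<subseteq> ?R" using z(4) by (auto simp: c)
  have "card ?R \<le> s" using card_poly_roots_bound[of "legendre01 s"] by simp
  moreover have "card (z ` {1..s}) = s" using inj by (simp add: card_image)
  moreover have "card (z ` {1..s}) \<le> card ?R" using sub fin by (rule card_mono[rotated])
  ultimately have "z ` {1..s} = ?R" "card ?R = s"
    using card_subset_eq[OF fin sub] by auto
  then show "card ?R = s" by simp
  have "z ` {1..s} \<subseteq> {0<..<1}"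
  proof (rule image_subsetI)
    fix n assume "n \<in> {1..s}"
    then show "z n \<in> {0<..<1}" using mono[of 0 n] mono[of n "Suc s"] z by auto
  qed
  then show "?R \<subseteq> {0<..<1}" using \<open>z ` {1..s} = ?R\<close> by simp
qed

lemma gauss_node_bij: "bij_betw (gauss_node s) {1..s} {x. poly (legendre01 s) x = 0}"
proof -
  let ?R = "{x. poly (legendre01 s) x = 0}"
  let ?l = "sorted_list_of_set ?R"
  have len: "length ?l = s" using legendre01_roots(1)[of s] by simp
  have "bij_betw (\<lambda>i. ?l ! i) {..<s} ?R"
    using len legendre01_roots(3)[of s] by (intro bij_betw_nth) auto
  moreover have "bij_betw (\<lambda>i. i - 1) {1..s} {..<s}"
    by (rule bij_betwI[of _ _ _ Suc]) auto
  ultimately have "bij_betw ((\<lambda>i. ?l ! i) \<circ> (\<lambda>i. i - 1)) {1..s} ?R" by (rule bij_betw_trans[rotated])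
  then show ?thesis by (simp add: comp_def gauss_node_def[abs_def])
qed

lemma gauss_node_inj: "inj_on (gauss_node s) {1..s}"
  using gauss_node_bij bij_betw_imp_inj_on by blast

lemma gauss_node_root: "i \<in> {1..s} \<Longrightarrow> poly (legendre01 s) (gauss_node s i) = 0"
  using bij_betwE[OF gauss_node_bij[of s]] by blast

lemma gauss_node_in: "i \<in> {1..s} \<Longrightarrow> gauss_node s i \<in> {0<..<1}"
  using gauss_node_root legendre01_roots(2)[of s] by blast

lemma gauss_node_in_closed: "i \<in> {1..s} \<Longrightarrow> gauss_node s i \<in> {0..1}"
  using gauss_node_in by (meson greaterThanLessThan_subseteq_atLeastAtMost_iff order.refl subsetD)

definition lagrange_poly :: "nat \<Rightarrow> nat \<Rightarrow> real poly" where
  "lagrange_poly s j = (\<Prod>i\<in>{1..s} - {j}.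
      smult (1 / (gauss_node s j - gauss_node s i)) [:- gauss_node s i, 1:])"

lemma gauss_lagrange_eq_poly: "gauss_lagrange s j x = poly (lagrange_poly s j) x"
  by (simp add: gauss_lagrange_def lagrange_poly_def poly_prod diff_divide_distrib)

lemma degree_lagrange_poly: "j \<in> {1..s} \<Longrightarrow> degree (lagrange_poly s j) \<le> s - 1"
proof -
  assume j: "j \<in> {1..s}"
  have "degree (lagrange_poly s j) \<le> sum (degree \<circ> (\<lambda>i. smult (1 / (gauss_node s j - gauss_node s i)) [:- gauss_node s i, 1:])) ({1..s} - {j})"
    unfolding lagrange_poly_def by (rule degree_prod_sum_le) simp
  also have "\<dots> \<le> (\<Sum>i\<in>{1..s} - {j}. 1)" by (rule sum_mono) auto
  also have "\<dots> = s - 1" using j by simp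
  finally show ?thesis .
qed

lemma gauss_lagrange_node:
  assumes "i \<in> {1..s}" "j \<in> {1..s}"
  shows "gauss_lagrange s j (gauss_node s i) = (if i = j then 1 else 0)"
proof (cases "i = j")
  case True
  have "gauss_node s j - gauss_node s i \<noteq> 0" if "i \<in> {1..s} - {j}" for i
    using inj_onD[OF gauss_node_inj[of s], of j i] assms that by auto
  then show ?thesis using True unfolding gauss_lagrange_def by (simp add: prod.neutral)
next
  case False
  then show ?thesis using assms unfolding gauss_lagrange_def
    by (auto simp: prod_zero_iff intro!: bexI[of _ i])
qed

lemma poly_zero_at_nodes:
  fixes q :: "real poly"
  assumes "degree q < s" "\<And>i. i \<in> {1..s} \<Longrightarrow> poly q (gauss_node s i) = 0"
  shows "q = 0"
proof (rule ccontr)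
  assume "q \<noteq> 0"
  have "gauss_node s ` {1..s} \<subseteq> {x. poly q x = 0}" using assms by auto
  then have "card (gauss_node s ` {1..s}) \<le> card {x. poly q x = 0}"
    using poly_roots_finite[OF \<open>q \<noteq> 0\<close>] by (rule card_mono[rotated])
  also have "\<dots> \<le> degree q" by (rule card_poly_roots_bound[OF \<open>q \<noteq> 0\<close>])
  finally show False using assms(1) gauss_node_inj[of s] by (simp add: card_image)
qed

lemma lagrange_interpolation_poly:
  assumes "degree q < s"
  shows "(\<Sum>j=1..s. smult (poly q (gauss_node s j)) (lagrange_poly s j)) = q"
proof -
  let ?p = "(\<Sum>j=1..s. smult (poly q (gauss_node s j)) (lagrange_poly s j))"
  have "degree ?p \<le> s - 1"
    using degree_lagrange_poly by (intro degree_sum_le) (auto intro: order_trans[OF degree_smult_le])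
  then have "degree (?p - q) < s" using assms by (intro degree_diff_less) auto
  moreover have "poly (?p - q) (gauss_node s i) = 0" if "i \<in> {1..s}" for i
  proof -
    have "poly ?p (gauss_node s i) = (\<Sum>j=1..s. if i = j then poly q (gauss_node s j) else 0)"
      unfolding poly_sum poly_smult gauss_lagrange_eq_poly[symmetric]
      using that by (intro sum.cong) (auto simp: gauss_lagrange_node)
    then show ?thesis using that by simp
  qed
  ultimately have "?p - q = 0" by (rule poly_zero_at_nodes)
  then show ?thesis by simp
qed

text \<open>
  Division by \<open>P\<^sub>k\<close> with remainder: the multiple of \<open>P\<^sub>k\<close> contributes nothing to the integral, by
  orthogonality, and nothing to the sum, because \<open>P\<^sub>k\<close> vanishes at the nodes. On the remainder, whose
  degree is below \<open>k\<close>, the rule integrates the interpolation polynomial and hence is exact.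
\<close>

lemma gauss_quadrature_poly:
  assumes "degree q < 2 * k"
  shows "(\<Sum>i=1..k. gauss_weight k i * poly q (gauss_node k i)) = integral {0..1} (poly q)"
proof -
  define a where "a = q div legendre01 k"
  define b where "b = q mod legendre01 k"
  have q: "q = legendre01 k * a + b" by (simp add: a_def b_def)
  have k: "k > 0" using assms by simp
  have b: "degree b < k"
    using k degree_mod_less[of "legendre01 k" q] by (auto simp: b_def)
  have a: "degree a < k"
  proof (cases "a = 0")
    case False
    then have "degree (legendre01 k * a) = k + degree a" by (simp add: degree_mult_eq)
    moreover have "degree (legendre01 k * a) \<le> max (degree q) (degree b)"
      using degree_diff_le_max[of q b] q by (metis add_diff_cancel_right')
    ultimately show ?thesis using assms b by simp
  qed (use k in simp)
  have int: "integral {0..1} (poly q) = integral {0..1} (poly b)"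
  proof -
    have "integral {0..1} (poly q) = integral {0..1} (poly (legendre01 k * a)) + integral {0..1} (poly b)"
      by (subst q) (simp add: poly_add_fun integral_add del: poly_mult)
    then show ?thesis using legendre01_orthogonal[OF a] by simp
  qed
  have "poly q (gauss_node k i) = poly b (gauss_node k i)" if "i \<in> {1..k}" for i
    using gauss_node_root[OF that] by (simp add: q)
  then have "(\<Sum>i=1..k. gauss_weight k i * poly q (gauss_node k i))
     = (\<Sum>i=1..k. poly b (gauss_node k i) * integral {0..1} (poly (lagrange_poly k i)))"
    by (intro sum.cong) (auto simp: gauss_weight_def gauss_lagrange_eq_poly[abs_def])
  also have "\<dots> = integral {0..1} (\<lambda>x. \<Sum>i=1..k. poly b (gauss_node k i) * poly (lagrange_poly k i) x)"
    by (subst integral_sum) (auto intro!: integrable_continuous_interval continuous_intros)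
  also have "\<dots> = integral {0..1} (poly b)"
    using arg_cong[OF lagrange_interpolation_poly[OF b], of poly]
    by (intro integral_cong) (auto simp: fun_eq_iff poly_sum)
  finally show ?thesis using int by simp
qed

lemma legendre01_expansion:
  assumes "degree q < s"
  shows "q = (\<Sum>j<s. smult (integral {0..1} (poly (legendre01 j * q))) (legendre01 j))"
proof -
  have ex: "\<exists>a. q = (\<Sum>j<s. smult (a j) (legendre01 j))" using assms
  proof (induction s arbitrary: q)
    case (Suc s)
    define b where "b = coeff q s / coeff (legendre01 s) s"
    have lc: "coeff (legendre01 s) s \<noteq> 0" by (metis degree_legendre01 leading_coeff_0_iff legendre01_nonzero)
    let ?q = "q - smult b (legendre01 s)"
    have cs: "coeff ?q s = 0" using lc by (simp add: b_def)
    have dle: "degree ?q \<le> s" using Suc.prems by (intro degree_diff_le) (auto intro: order_trans[OF degree_smult_le])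
    show ?case
    proof (cases "?q = 0")
      case True
      then show ?thesis
        by (intro exI[of _ "\<lambda>j. if j = s then b else 0"]) (simp add: if_distrib[of "\<lambda>x. smult x _"] cong: if_cong)
    next
      case False
      then have "degree ?q \<noteq> s" by (metis cs leading_coeff_0_iff)
      then have "degree ?q < s" using dle by simp
      then obtain a where "?q = (\<Sum>j<s. smult (a j) (legendre01 j))" using Suc.IH[of ?q] by blast
      moreover have "(\<Sum>j<s. smult ((a(s := b)) j) (legendre01 j)) = (\<Sum>j<s. smult (a j) (legendre01 j))"
        by (intro sum.cong) auto
      ultimately have "q = (\<Sum>j<Suc s. smult ((a(s := b)) j) (legendre01 j))"
        unfolding sum.lessThan_Suc by (metis diff_add_cancel fun_upd_same)
      then show ?thesis by (rule exI[of _ "a(s := b)"])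
    qed
  qed simp
  then obtain a where a: "q = (\<Sum>j<s. smult (a j) (legendre01 j))" by blast
  have "integral {0..1} (poly (legendre01 i * q)) = a i" if "i < s" for i
  proof -
    have "integral {0..1} (poly (legendre01 i * q)) = integral {0..1} (\<lambda>x. \<Sum>j<s. a j * poly (legendre01 i * legendre01 j) x)"
      by (subst a, rule integral_cong) (simp add: poly_sum sum_distrib_left mult.left_commute)
    also have "\<dots> = (\<Sum>j<s. a j * integral {0..1} (poly (legendre01 i * legendre01 j)))"
      by (subst integral_sum) (auto intro!: integrable_continuous_interval continuous_intros simp del: poly_mult)
    also have "\<dots> = a i" using that
      by (simp add: legendre01_orthonormal if_distrib[of "\<lambda>x. a _ * x"] del: poly_mult cong: if_cong)
    finally show ?thesis .
  qed
  then have "(\<Sum>j<s. smult (integral {0..1} (poly (legendre01 j * q))) (legendre01 j))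
      = (\<Sum>j<s. smult (a j) (legendre01 j))"
    by (intro sum.cong) (simp_all del: poly_mult)
  also have "\<dots> = q" by (rule a[symmetric])
  finally show ?thesis by (rule sym)
qed

section \<open>Polynomials with values in a normed space\<close>

text \<open>
  The notion of \<^const>\<open>polynomial_curve\<close> for an arbitrary normed space: besides positions and
  momenta, the polynomials in question take real numbers, multipliers and matrices as values.
\<close>

definition poly_fun :: "nat \<Rightarrow> (real \<Rightarrow> 'a::real_normed_vector) \<Rightarrow> bool" where
  "poly_fun d f \<longleftrightarrow> (\<exists>a. \<forall>x. f x = (\<Sum>i\<le>d. x ^ i *\<^sub>R a i))"

lemma polynomial_curve_eq_poly_fun: "polynomial_curve d f \<longleftrightarrow> poly_fun d f"
  by (simp add: polynomial_curve_def poly_fun_def)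

lemma poly_fun_monom: "n \<le> d \<Longrightarrow> poly_fun d (\<lambda>x. x ^ n *\<^sub>R a)"
  unfolding poly_fun_def
  by (intro exI[of _ "\<lambda>i. if i = n then a else 0"])
     (simp add: if_distrib[of "\<lambda>v. _ *\<^sub>R v"] cong: if_cong)

lemma poly_fun_add:
  assumes "poly_fun d f" "poly_fun d g"
  shows "poly_fun d (\<lambda>x. f x + g x)"
proof -
  obtain a b where "\<And>x. f x = (\<Sum>i\<le>d. x ^ i *\<^sub>R a i)" "\<And>x. g x = (\<Sum>i\<le>d. x ^ i *\<^sub>R b i)"
    using assms unfolding poly_fun_def by metis
  then have "\<forall>x. f x + g x = (\<Sum>i\<le>d. x ^ i *\<^sub>R (a i + b i))"
    by (simp add: scaleR_add_right sum.distrib)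
  then show ?thesis unfolding poly_fun_def by (rule exI[of _ "\<lambda>i. a i + b i"])
qed

lemma poly_fun_0: "poly_fun d (\<lambda>x. 0)"
  unfolding poly_fun_def by (rule exI[of _ "\<lambda>_. 0"]) simp

lemma poly_fun_sum:
  "(\<And>i. i \<in> I \<Longrightarrow> poly_fun d (f i)) \<Longrightarrow> poly_fun d (\<lambda>x. \<Sum>i\<in>I. f i x)"
  by (induction I rule: infinite_finite_induct) (auto intro: poly_fun_0 poly_fun_add)

lemma poly_fun_mono:
  assumes "poly_fun d f" "d \<le> e"
  shows "poly_fun e f"
proof -
  obtain a where "\<And>x. f x = (\<Sum>i\<le>d. x ^ i *\<^sub>R a i)" using assms unfolding poly_fun_def by metis
  then have "f = (\<lambda>x. \<Sum>i\<le>d. x ^ i *\<^sub>R a i)" by auto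
  then show ?thesis using assms(2) by (auto intro!: poly_fun_sum poly_fun_monom)
qed

lemma poly_fun_const: "poly_fun d (\<lambda>x. a)"
  using poly_fun_monom[of 0 d a] by simp

lemma poly_fun_bounded_linear:
  assumes "bounded_linear L" "poly_fun d f"
  shows "poly_fun d (\<lambda>x. L (f x))"
proof -
  obtain a where "\<And>x. f x = (\<Sum>i\<le>d. x ^ i *\<^sub>R a i)" using assms unfolding poly_fun_def by metis
  then have "\<forall>x. L (f x) = (\<Sum>i\<le>d. x ^ i *\<^sub>R L (a i))"
    by (simp add: linear_sum linear_cmul bounded_linear.linear[OF assms(1)])
  then show ?thesis unfolding poly_fun_def by (rule exI[of _ "\<lambda>i. L (a i)"])
qed

lemma poly_fun_diff:
  assumes "poly_fun d f" "poly_fun d g"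
  shows "poly_fun d (\<lambda>x. f x - g x)"
  using poly_fun_add[OF assms(1) poly_fun_bounded_linear[OF bounded_linear_minus[OF bounded_linear_ident] assms(2)]]
  by simp

lemma poly_fun_scaleR: "poly_fun d f \<Longrightarrow> poly_fun d (\<lambda>x. c *\<^sub>R f x)"
  using poly_fun_bounded_linear[OF bounded_linear_scaleR_right] .

lemma poly_fun_bilinear:
  assumes "bounded_bilinear B" "poly_fun d f" "poly_fun e g"
  shows "poly_fun (d + e) (\<lambda>x. B (f x) (g x))"
proof -
  interpret bounded_bilinear B by fact
  obtain a b where "\<And>x. f x = (\<Sum>i\<le>d. x ^ i *\<^sub>R a i)" "\<And>x. g x = (\<Sum>i\<le>e. x ^ i *\<^sub>R b i)"
    using assms unfolding poly_fun_def by metis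
  then have "B (f x) (g x) = (\<Sum>i\<le>d. \<Sum>j\<le>e. x ^ (i + j) *\<^sub>R B (a i) (b j))" for x
    by (simp add: sum_left sum_right scaleR_left scaleR_right power_add scaleR_sum_right)
       (subst sum.swap, simp add: mult.commute)
  then show ?thesis by (simp) (intro poly_fun_sum poly_fun_monom, auto)
qed

lemma poly_fun_poly:
  assumes "degree p \<le> d"
  shows "poly_fun d (\<lambda>x. poly p x *\<^sub>R a)"
proof -
  have "poly p x *\<^sub>R a = (\<Sum>i\<le>degree p. x ^ i *\<^sub>R (coeff p i *\<^sub>R a))" for x
    by (simp add: poly_altdef scaleR_sum_left mult.commute)
  then show ?thesis using assms by (simp del: scaleR_scaleR) (intro poly_fun_sum poly_fun_monom, auto)
qed

lemma poly_fun_rescale: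
  assumes "poly_fun d f"
  shows "poly_fun d (\<lambda>x. f (x * h))"
proof -
  obtain a where "\<And>x. f x = (\<Sum>i\<le>d. x ^ i *\<^sub>R a i)" using assms unfolding poly_fun_def by metis
  then have "\<forall>x. f (x * h) = (\<Sum>i\<le>d. x ^ i *\<^sub>R (h ^ i *\<^sub>R a i))"
    by (simp add: power_mult_distrib)
  then show ?thesis unfolding poly_fun_def by (rule exI[of _ "\<lambda>i. h ^ i *\<^sub>R a i"])
qed

lemma poly_fun_derivative:
  fixes f :: "real \<Rightarrow> 'a::real_normed_vector"
  assumes "poly_fun d f"
  obtains f' where "poly_fun (d - 1) f'" "\<And>x. (f has_vector_derivative f' x) (at x)"
proof -
  obtain a where a: "\<And>x. f x = (\<Sum>i\<le>d. x ^ i *\<^sub>R a i)" using assms unfolding poly_fun_def by metis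
  then have f: "f = (\<lambda>x. \<Sum>i\<le>d. x ^ i *\<^sub>R a i)" by auto
  show ?thesis
  proof
    show "poly_fun (d - 1) (\<lambda>x. \<Sum>i\<le>d. x ^ (i - 1) *\<^sub>R (real i *\<^sub>R a i))"
      by (intro poly_fun_sum poly_fun_monom) auto
    show "(f has_vector_derivative (\<Sum>i\<le>d. x ^ (i - 1) *\<^sub>R (real i *\<^sub>R a i))) (at x)" for x
      unfolding f
      by (auto intro!: derivative_eq_intros simp: has_vector_derivative_def[symmetric] scaleR_sum_right mult_ac)
  qed
qed

lemma poly_fun_continuous: "poly_fun d f \<Longrightarrow> continuous_on S f"
  by (rule poly_fun_derivative[of d f])
     (auto intro!: continuous_at_imp_continuous_on has_vector_derivative_continuous)

lemma has_integral_poly_scaleR_sum: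
  fixes q :: "nat \<Rightarrow> real poly"
  shows "((\<lambda>x. \<Sum>i\<le>d. poly (q i) x *\<^sub>R a i) has_integral (\<Sum>i\<le>d. integral {0..1} (poly (q i)) *\<^sub>R a i)) {0..1}"
  by (intro has_integral_sum has_integral_scaleR_left integrable_integral) simp_all

text \<open>
  The vector-valued statements about quadrature, interpolation and projection are linear in the
  function, so they reduce to monomials.
\<close>

lemma gauss_quadrature:
  fixes f :: "real \<Rightarrow> 'a::real_normed_vector"
  assumes "poly_fun d f" "d < 2 * k"
  shows "(f has_integral (\<Sum>i=1..k. gauss_weight k i *\<^sub>R f (gauss_node k i))) {0..1}"
proof -
  obtain a where a: "\<And>x. f x = (\<Sum>i\<le>d. x ^ i *\<^sub>R a i)" using assms unfolding poly_fun_def by metis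
  then have f: "f = (\<lambda>x. \<Sum>i\<le>d. poly (monom 1 i) x *\<^sub>R a i)" by (auto simp: poly_monom)
  have "(\<Sum>i=1..k. gauss_weight k i *\<^sub>R f (gauss_node k i))
      = (\<Sum>n\<le>d. (\<Sum>i=1..k. gauss_weight k i * poly (monom 1 n) (gauss_node k i)) *\<^sub>R a n)"
    unfolding f scaleR_sum_right scaleR_sum_left by (subst sum.swap) simp
  also have "\<dots> = (\<Sum>n\<le>d. integral {0..1} (poly (monom 1 n)) *\<^sub>R a n)"
    using assms(2) by (intro sum.cong refl) (subst gauss_quadrature_poly, auto simp: degree_monom_eq)
  finally have "(\<Sum>i=1..k. gauss_weight k i *\<^sub>R f (gauss_node k i)) = (\<Sum>n\<le>d. integral {0..1} (poly (monom 1 n)) *\<^sub>R a n)" .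
  moreover have "(f has_integral (\<Sum>n\<le>d. integral {0..1} (poly (monom 1 n)) *\<^sub>R a n)) {0..1}"
    unfolding f by (rule has_integral_poly_scaleR_sum)
  ultimately show ?thesis by (simp only:)
qed

lemma lagrange_interpolation:
  fixes f :: "real \<Rightarrow> 'a::real_normed_vector"
  assumes "poly_fun d f" "d < s"
  shows "(\<Sum>j=1..s. gauss_lagrange s j x *\<^sub>R f (gauss_node s j)) = f x"
proof -
  obtain a where a: "\<And>x. f x = (\<Sum>i\<le>d. x ^ i *\<^sub>R a i)" using assms unfolding poly_fun_def by metis
  have "(\<Sum>j=1..s. gauss_lagrange s j x *\<^sub>R f (gauss_node s j))
      = (\<Sum>n\<le>d. (\<Sum>j=1..s. poly (monom 1 n) (gauss_node s j) * gauss_lagrange s j x) *\<^sub>R a n)"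
    unfolding a scaleR_sum_right scaleR_sum_left by (subst sum.swap) (simp add: poly_monom mult.commute)
  also have "\<dots> = (\<Sum>n\<le>d. x ^ n *\<^sub>R a n)"
  proof (intro sum.cong refl)
    fix n assume "n \<in> {..d}"
    then have "(\<Sum>j=1..s. smult (poly (monom 1 n) (gauss_node s j)) (lagrange_poly s j)) = monom 1 n"
      using assms by (intro lagrange_interpolation_poly) (auto simp: degree_monom_eq)
    from arg_cong[OF this, of "\<lambda>p. poly p x"]
    show "(\<Sum>j=1..s. poly (monom 1 n) (gauss_node s j) * gauss_lagrange s j x) *\<^sub>R a n = x ^ n *\<^sub>R a n"
      by (simp add: gauss_lagrange_eq_poly poly_sum poly_monom)
  qed
  finally show ?thesis by (simp add: a)
qed

text \<open>
  Lagrange interpolation at the Gauss nodes. It serves for the constraint force and, by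
  \<open>legendre_projection_eq_gauss_interp\<close> below, for truncated Legendre series.
\<close>

definition gauss_interp :: "nat \<Rightarrow> (real \<Rightarrow> 'a::real_normed_vector) \<Rightarrow> real \<Rightarrow> 'a" where
  "gauss_interp s f x = (\<Sum>j=1..s. gauss_lagrange s j x *\<^sub>R f (gauss_node s j))"

lemma poly_fun_gauss_interp: "poly_fun (s - 1) (gauss_interp s f)"
  unfolding gauss_interp_def[abs_def] gauss_lagrange_eq_poly
  by (intro poly_fun_sum poly_fun_poly degree_lagrange_poly)

lemma gauss_interp_node: "i \<in> {1..s} \<Longrightarrow> gauss_interp s f (gauss_node s i) = f (gauss_node s i)"
proof -
  assume i: "i \<in> {1..s}"
  have "gauss_interp s f (gauss_node s i) = (\<Sum>j=1..s. if j = i then f (gauss_node s j) else 0)"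
    unfolding gauss_interp_def using i by (intro sum.cong) (auto simp: gauss_lagrange_node)
  then show ?thesis using i by simp
qed

text \<open>
  For degree at most \<open>s\<close>, the Legendre series truncated before \<open>P\<^sub>s\<close> differs from the polynomial by a
  multiple of \<open>P\<^sub>s\<close>. It agrees with the polynomial at the zeros of \<open>P\<^sub>s\<close>, and its degree is below
  \<open>s\<close>; thus it is the interpolation polynomial.
\<close>

lemma legendre_projection_poly:
  assumes "degree q \<le> s"
  shows "(\<Sum>j<s. integral {0..1} (poly (legendre01 j * q)) * poly (legendre01 j) x)
    = (\<Sum>j=1..s. gauss_lagrange s j x * poly q (gauss_node s j))"
proof -
  define b where "b j = integral {0..1} (poly (legendre01 j * q))" for j
  define r where "r = (\<Sum>j<s. smult (b j) (legendre01 j))"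
  have q: "q = r + smult (b s) (legendre01 s)"
    using legendre01_expansion[of q "Suc s"] assms by (simp add: r_def b_def del: poly_mult)
  have poly_r: "poly r x = (\<Sum>j<s. b j * poly (legendre01 j) x)" by (simp add: r_def poly_sum)
  show ?thesis
  proof (cases "s = 0")
    case False
    have "degree r \<le> s - 1" unfolding r_def
      by (intro degree_sum_le) (auto intro: order_trans[OF degree_smult_le])
    then have "degree r < s" using False by simp
    from arg_cong[OF lagrange_interpolation_poly[OF this], of "\<lambda>p. poly p x"]
    have "poly r x = (\<Sum>j=1..s. gauss_lagrange s j x * poly r (gauss_node s j))"
      by (simp add: poly_sum gauss_lagrange_eq_poly mult.commute)
    also have "\<dots> = (\<Sum>j=1..s. gauss_lagrange s j x * poly q (gauss_node s j))"
      by (intro sum.cong refl) (subst q, simp add: gauss_node_root)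
    finally show ?thesis by (simp add: poly_r b_def del: poly_mult)
  qed simp
qed

lemma legendre_projection_eq_gauss_interp:
  fixes f :: "real \<Rightarrow> 'a::banach"
  assumes "poly_fun s f"
  shows "(\<Sum>j<s. poly (legendre01 j) x *\<^sub>R integral {0..1} (\<lambda>z. poly (legendre01 j) z *\<^sub>R f z))
    = gauss_interp s f x"
proof -
  obtain a where a: "\<And>x. f x = (\<Sum>i\<le>s. x ^ i *\<^sub>R a i)" using assms unfolding poly_fun_def by metis
  have int: "integral {0..1} (\<lambda>z. poly (legendre01 j) z *\<^sub>R f z)
      = (\<Sum>n\<le>s. integral {0..1} (poly (legendre01 j * monom 1 n)) *\<^sub>R a n)" for j
  proof -
    have "(\<lambda>z. poly (legendre01 j) z *\<^sub>R f z) = (\<lambda>z. \<Sum>n\<le>s. poly (legendre01 j * monom 1 n) z *\<^sub>R a n)"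
      by (simp add: fun_eq_iff a scaleR_sum_right poly_monom)
    then show ?thesis using has_integral_poly_scaleR_sum[where d = s and q = "\<lambda>n. legendre01 j * monom 1 n" and a = a]
      by (simp add: integral_unique del: poly_mult)
  qed
  have "(\<Sum>j<s. poly (legendre01 j) x *\<^sub>R integral {0..1} (\<lambda>z. poly (legendre01 j) z *\<^sub>R f z))
      = (\<Sum>n\<le>s. (\<Sum>j<s. integral {0..1} (poly (legendre01 j * monom 1 n)) * poly (legendre01 j) x) *\<^sub>R a n)"
    unfolding int scaleR_sum_right scaleR_sum_left
    by (subst sum.swap) (simp add: mult.commute del: poly_mult)
  also have "\<dots> = (\<Sum>n\<le>s. (\<Sum>j=1..s. gauss_lagrange s j x * poly (monom 1 n) (gauss_node s j)) *\<^sub>R a n)"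
    by (intro sum.cong refl) (subst legendre_projection_poly, auto simp: degree_monom_eq)
  also have "\<dots> = gauss_interp s f x"
    unfolding gauss_interp_def a scaleR_sum_right scaleR_sum_left
    by (subst sum.swap) (simp add: poly_monom)
  finally show ?thesis .
qed

section \<open>Gradients of polynomials and of analytic functions\<close>

lemma grad_eqI: "GDERIV f x :> d \<Longrightarrow> grad f x = d"
  unfolding grad_def gderiv_def
  by (rule the_equality) (auto dest: has_derivative_unique simp: fun_eq_iff vector_eq_ldot)

text \<open>
  For \<open>\<alpha> i = 0\<close> the exponent \<open>\<alpha> i - 1\<close> is truncated to \<open>0\<close>; the factor \<open>\<alpha> i\<close> then removes the term.
\<close>

definition monomial_gradient :: "('m::finite \<Rightarrow> nat) \<Rightarrow> real^'m \<Rightarrow> real^'m" where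
  "monomial_gradient \<alpha> x = (\<Sum>i\<in>UNIV. (real (\<alpha> i) * monomial_at (\<alpha>(i := \<alpha> i - 1)) x) *\<^sub>R axis i 1)"

lemma monomial_at_remove: "monomial_at \<alpha> x = (x $ i) ^ \<alpha> i * (\<Prod>j\<in>UNIV - {i}. (x $ j) ^ \<alpha> j)"
  unfolding monomial_at_def by (rule prod.remove) auto

lemma GDERIV_monomial: "GDERIV (monomial_at \<alpha>) x :> monomial_gradient \<alpha> x"
proof -
  have eq: "(\<Prod>j\<in>UNIV - {i}. (x $ j) ^ \<alpha> j) * (x $ i) ^ (\<alpha> i - 1) = monomial_at (\<alpha>(i := \<alpha> i - 1)) x" for i
    by (subst monomial_at_remove[of _ _ i]) (auto simp: mult.commute intro!: prod.cong)
  have "((\<lambda>x. (x $ i) ^ \<alpha> i) has_derivative (\<lambda>h. real (\<alpha> i) * (h $ i) * (x $ i) ^ (\<alpha> i - 1))) (at x)" for i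
    by (auto intro!: derivative_eq_intros bounded_linear.has_derivative[OF bounded_linear_vec_nth] simp: mult_ac)
  then have "((\<lambda>x. \<Prod>i\<in>UNIV. (x $ i) ^ \<alpha> i) has_derivative
      (\<lambda>h. \<Sum>i\<in>UNIV. real (\<alpha> i) * (h $ i) * (x $ i) ^ (\<alpha> i - 1) * (\<Prod>j\<in>UNIV - {i}. (x $ j) ^ \<alpha> j))) (at x)"
    by (intro has_derivative_prod) auto
  moreover have "(\<Sum>i\<in>UNIV. real (\<alpha> i) * (h $ i) * (x $ i) ^ (\<alpha> i - 1) * (\<Prod>j\<in>UNIV - {i}. (x $ j) ^ \<alpha> j))
      = h \<bullet> monomial_gradient \<alpha> x" for h
    unfolding monomial_gradient_def inner_sum_right
    by (intro sum.cong refl) (simp only: eq[symmetric] inner_axis inner_scaleR_right inner_real_def mult_ac mult_1_right)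
  ultimately show ?thesis
    by (simp add: gderiv_def monomial_at_def[abs_def])
qed

lemma sum_fun_upd_diff:
  fixes \<alpha> :: "'m::finite \<Rightarrow> nat"
  assumes "\<alpha> i > 0"
  shows "sum (\<alpha>(i := \<alpha> i - 1)) UNIV = sum \<alpha> UNIV - 1"
proof -
  have "sum \<alpha> UNIV = \<alpha> i + sum \<alpha> (UNIV - {i})"
    by (rule sum.remove) auto
  moreover have "sum (\<alpha>(i := \<alpha> i - 1)) UNIV = (\<alpha>(i := \<alpha> i - 1)) i + sum (\<alpha>(i := \<alpha> i - 1)) (UNIV - {i})"
    by (rule sum.remove) auto
  moreover have "sum (\<alpha>(i := \<alpha> i - 1)) (UNIV - {i}) = sum \<alpha> (UNIV - {i})"
    by (intro sum.cong) auto
  ultimately show ?thesis using assms by simp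
qed

lemma finite_multi_indices:
  "finite {\<alpha> :: 'm::finite \<Rightarrow> nat. sum \<alpha> UNIV \<le> n}"
proof (rule finite_subset)
  show "{\<alpha> :: 'm \<Rightarrow> nat. sum \<alpha> UNIV \<le> n} \<subseteq> {\<alpha>. \<forall>i. (i \<in> UNIV \<longrightarrow> \<alpha> i \<in> {..n}) \<and> (i \<notin> UNIV \<longrightarrow> \<alpha> i = 0)}"
  proof clarsimp
    fix \<alpha> :: "'m \<Rightarrow> nat" and i assume "sum \<alpha> UNIV \<le> n"
    moreover have "\<alpha> i \<le> sum \<alpha> UNIV" by (rule member_le_sum) auto
    ultimately show "\<alpha> i \<le> n" by simp
  qed
  show "finite {\<alpha> :: 'm \<Rightarrow> nat. \<forall>i. (i \<in> UNIV \<longrightarrow> \<alpha> i \<in> {..n}) \<and> (i \<notin> UNIV \<longrightarrow> \<alpha> i = 0)}"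
    by (rule finite_set_of_finite_funs) auto
qed

lemma finite_multi_indices_eq:
  "finite {\<alpha> :: 'm::finite \<Rightarrow> nat. sum \<alpha> UNIV = n}"
  by (rule finite_subset[OF _ finite_multi_indices[of n]]) auto

lemma abs_monomial_at_le: "\<bar>monomial_at \<alpha> x\<bar> \<le> norm x ^ sum \<alpha> UNIV"
proof -
  have "\<bar>monomial_at \<alpha> x\<bar> = (\<Prod>i\<in>UNIV. \<bar>x $ i\<bar> ^ \<alpha> i)"
    by (simp add: monomial_at_def abs_prod power_abs)
  also have "\<dots> \<le> (\<Prod>i\<in>UNIV. norm x ^ \<alpha> i)"
    by (intro prod_mono) (auto intro!: power_mono component_le_norm_cart)
  also have "\<dots> = norm x ^ sum \<alpha> UNIV" by (simp add: power_sum)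
  finally show ?thesis .
qed

lemma norm_monomial_gradient_le:
  "norm (monomial_gradient \<alpha> x) \<le> real (sum \<alpha> UNIV) * norm x ^ (sum \<alpha> UNIV - 1)"
proof -
  have "norm (monomial_gradient \<alpha> x) \<le> (\<Sum>i\<in>UNIV. real (\<alpha> i) * norm x ^ (sum \<alpha> UNIV - 1))"
    unfolding monomial_gradient_def
  proof (rule sum_norm_le)
    fix i
    show "norm ((real (\<alpha> i) * monomial_at (\<alpha>(i := \<alpha> i - 1)) x) *\<^sub>R axis i (1::real))
        \<le> real (\<alpha> i) * norm x ^ (sum \<alpha> UNIV - 1)"
    proof (cases "\<alpha> i = 0")
      case False
      then show ?thesis using abs_monomial_at_le[of "\<alpha>(i := \<alpha> i - 1)" x] sum_fun_upd_diff[of \<alpha> i]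
        by (simp add: abs_mult mult_left_mono)
    qed simp
  qed
  then show ?thesis by (simp add: sum_distrib_right[symmetric])
qed

lemma monomial_at_degree_1:
  assumes "sum \<alpha> UNIV \<le> 1"
  shows "\<exists>c d. \<forall>x. monomial_at \<alpha> x = c + x \<bullet> d"
proof (cases "\<forall>i. \<alpha> i = 0")
  case True
  then show ?thesis by (intro exI[of _ 1] exI[of _ 0]) (simp add: monomial_at_def)
next
  case False
  then obtain i where i: "\<alpha> i > 0" by auto
  have s: "sum \<alpha> UNIV = \<alpha> i + sum \<alpha> (UNIV - {i})" by (rule sum.remove) auto
  then have "\<alpha> i = 1" "sum \<alpha> (UNIV - {i}) = 0" using i assms by linarith+
  then have "monomial_at \<alpha> x = 0 + x \<bullet> axis i 1" for x
    by (subst monomial_at_remove[of _ _ i]) (auto simp: inner_axis intro!: prod.neutral)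
  then show ?thesis by blast
qed

text \<open>
  By linearity only monomials matter, and the partial derivatives of a monomial of degree at most two
  have degree at most one.
\<close>

lemma quadratic_gradient_affine:
  assumes "polynomial_degree_le_on UNIV 2 f"
  shows "\<exists>b L. bounded_linear L \<and> (\<forall>x. GDERIV f x :> (b + L x))"
proof -
  define Q where "Q f \<longleftrightarrow> (\<exists>b L. bounded_linear L \<and> (\<forall>x. GDERIV f x :> (b + L x)))"
    for f :: "real^'a \<Rightarrow> real"
  obtain a where a: "\<And>x. f x = (\<Sum>\<alpha> | sum \<alpha> UNIV \<le> 2. a \<alpha> * monomial_at \<alpha> x)"
    using assms unfolding polynomial_degree_le_on_def by auto
  have add: "Q (\<lambda>x. f x + g x)" if fg: "Q f" "Q g" for f g
  proof -
    obtain b L b' L' where *: "bounded_linear L" "\<And>x. GDERIV f x :> (b + L x)"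
      "bounded_linear L'" "\<And>x. GDERIV g x :> (b' + L' x)"
      using fg unfolding Q_def by blast
    have "GDERIV (\<lambda>x. f x + g x) x :> (b + b') + (L x + L' x)" for x
      using GDERIV_add[OF *(2,4), of x] by (simp add: algebra_simps)
    then show ?thesis unfolding Q_def using bounded_linear_add[OF *(1,3)] by blast
  qed
  have zero: "Q (\<lambda>x. 0)" unfolding Q_def
    by (intro exI[of _ 0] exI[of _ "\<lambda>_. 0"]) (simp add: GDERIV_const)
  have mono: "Q (\<lambda>x. c * monomial_at \<alpha> x)" if \<alpha>: "sum \<alpha> UNIV \<le> 2" for c \<alpha>
  proof -
    have "\<exists>p q. \<forall>x. real (\<alpha> i) * monomial_at (\<alpha>(i := \<alpha> i - 1)) x = p + x \<bullet> q" for i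
    proof (cases "\<alpha> i = 0")
      case False
      then have "sum (\<alpha>(i := \<alpha> i - 1)) UNIV \<le> 1" using sum_fun_upd_diff[of \<alpha> i] \<alpha> by simp
      then obtain p q where "\<forall>x. monomial_at (\<alpha>(i := \<alpha> i - 1)) x = p + x \<bullet> q"
        using monomial_at_degree_1 by blast
      then show ?thesis
        by (intro exI[of _ "real (\<alpha> i) * p"] exI[of _ "real (\<alpha> i) *\<^sub>R q"]) (simp add: distrib_left)
    qed (intro exI[of _ 0], simp)
    then obtain p q where pq: "\<And>i x. real (\<alpha> i) * monomial_at (\<alpha>(i := \<alpha> i - 1)) x = p i + x \<bullet> q i"
      by metis
    let ?b = "c *\<^sub>R (\<Sum>i\<in>UNIV. p i *\<^sub>R axis i 1)"
    let ?L = "\<lambda>x. c *\<^sub>R (\<Sum>i\<in>UNIV. (x \<bullet> q i) *\<^sub>R axis i 1)"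
    have "GDERIV (\<lambda>x. c * monomial_at \<alpha> x) x :> (c *\<^sub>R monomial_gradient \<alpha> x)" for x
      using GDERIV_mult[OF GDERIV_const[of c x] GDERIV_monomial[of \<alpha> x]] by simp
    moreover have "c *\<^sub>R monomial_gradient \<alpha> x = ?b + ?L x" for x
      unfolding monomial_gradient_def pq by (simp add: scaleR_add_left sum.distrib scaleR_add_right)
    moreover have "bounded_linear ?L"
      by (intro bounded_linear_intros)
    ultimately show ?thesis unfolding Q_def by (intro exI[of _ ?b] exI[of _ ?L]) simp
  qed
  have "Q (\<lambda>x. \<Sum>\<alpha>\<in>A. a \<alpha> * monomial_at \<alpha> x)" if "finite A" "A \<subseteq> {\<alpha>. sum \<alpha> UNIV \<le> 2}" for A
    using that by (induction A rule: finite_induct) (auto intro: zero add mono)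
  from this[OF finite_multi_indices[of 2] order_refl] have "Q f" by (simp add: a[abs_def])
  then show ?thesis by (simp add: Q_def)
qed

text \<open>
  The power series is grouped by total degree, which turns it into an ordinary series of homogeneous
  polynomials. It converges absolutely at the point with all coordinates \<open>r\<close>, and this gives a
  summable majorant \<open>B\<close>. On the ball of radius \<open>r / 2\<close> the gradient of the part of degree \<open>n\<close> is
  at most \<open>n / 2\<^sup>n\<close> times the majorant, up to a constant, so the series may be differentiated term
  by term. A gradient of degree \<open>n - 1 \<ge> R\<close> also has the factor \<open>norm y ^ R\<close>, which gives the
  remainder of the truncated series.
\<close>

lemma analytic_gradient_expansion:
  fixes U :: "real^'m::finite \<Rightarrow> real"
  assumes "real_analytic_on U D" "x0 \<in> D"
  obtains \<rho> a where "\<rho> > 0"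
    "\<And>y. norm y < \<rho> \<Longrightarrow> GDERIV U (x0 + y) :> grad U (x0 + y)"
    "\<And>R. \<exists>C. \<forall>y. norm y < \<rho> \<longrightarrow> norm (grad U (x0 + y)
        - (\<Sum>n\<le>R. \<Sum>\<alpha> | sum \<alpha> UNIV = n. a \<alpha> *\<^sub>R monomial_gradient \<alpha> y)) \<le> C * norm y ^ R"
proof -
  obtain \<rho> a where \<rho>: "\<rho> > 0" and
    U: "\<And>x. x \<in> ball x0 \<rho> \<Longrightarrow> ((\<lambda>\<alpha>. a \<alpha> * monomial_at \<alpha> (x - x0)) has_sum U x) UNIV"
    using assms unfolding real_analytic_on_def by blast
  define A where "A n = {\<alpha> :: 'm \<Rightarrow> nat. sum \<alpha> UNIV = n}" for n
  have finA: "finite (A n)" for n unfolding A_def by (rule finite_multi_indices_eq)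
  define r where "r = \<rho> / (2 * real CARD('m))"
  have r: "r > 0" using \<rho> by (simp add: r_def)
  define S where "S = (\<lambda>n. \<Sum>\<alpha>\<in>A n. \<bar>a \<alpha>\<bar>)"
  define B where "B = (\<lambda>n. S n * r ^ n)"
  have S0: "S n \<ge> 0" for n by (simp add: S_def sum_nonneg)
  have B0: "B n \<ge> 0" for n using S0 r by (simp add: B_def)
  have B: "summable B"
  proof -
    define e where "e = ((\<chi> i. r) :: real^'m)"
    have "norm e \<le> (\<Sum>i\<in>UNIV. \<bar>e $ i\<bar>)" by (rule norm_le_l1_cart)
    also have "\<dots> = \<rho> / 2" using r by (simp add: e_def) (simp add: r_def)
    finally have "x0 + e \<in> ball x0 \<rho>" using \<rho> by (simp add: dist_norm)
    then have "(\<lambda>\<alpha>. a \<alpha> * monomial_at \<alpha> e) summable_on UNIV"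
      using U[of "x0 + e"] has_sum_imp_summable by fastforce
    then have "(\<lambda>\<alpha>. norm (a \<alpha> * monomial_at \<alpha> e)) summable_on UNIV"
      by (rule summable_on_iff_abs_summable_on_real[THEN iffD1])
    moreover have "norm (a \<alpha> * monomial_at \<alpha> e) = \<bar>a \<alpha>\<bar> * r ^ sum \<alpha> UNIV" for \<alpha>
      using r by (simp add: monomial_at_def e_def abs_mult power_sum[symmetric])
    ultimately have sm: "(\<lambda>\<alpha>. \<bar>a \<alpha>\<bar> * r ^ sum \<alpha> UNIV) summable_on UNIV" by simp
    show ?thesis
    proof (rule summableI_nonneg_bounded[of _ "infsum (\<lambda>\<alpha>. \<bar>a \<alpha>\<bar> * r ^ sum \<alpha> UNIV) UNIV"])
      fix N
      have "(\<Sum>n<N. B n) = (\<Sum>n<N. \<Sum>\<alpha>\<in>A n. \<bar>a \<alpha>\<bar> * r ^ sum \<alpha> UNIV)"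
        by (intro sum.cong refl) (simp add: B_def S_def sum_distrib_right A_def)
      also have "\<dots> = (\<Sum>\<alpha>\<in>(\<Union>n<N. A n). \<bar>a \<alpha>\<bar> * r ^ sum \<alpha> UNIV)"
        by (rule sum.UNION_disjoint[symmetric]) (use finA in \<open>auto simp: A_def\<close>)
      also have "\<dots> \<le> infsum (\<lambda>\<alpha>. \<bar>a \<alpha>\<bar> * r ^ sum \<alpha> UNIV) UNIV"
        using r finA by (intro finite_sum_le_infsum sm) auto
      finally show "(\<Sum>n<N. B n) \<le> infsum (\<lambda>\<alpha>. \<bar>a \<alpha>\<bar> * r ^ sum \<alpha> UNIV) UNIV" .
    qed (rule B0)
  qed
  define f where "f = (\<lambda>n y. \<Sum>\<alpha>\<in>A n. a \<alpha> * monomial_at \<alpha> y)"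
  define G where "G = (\<lambda>n y. \<Sum>\<alpha>\<in>A n. a \<alpha> *\<^sub>R monomial_gradient \<alpha> y)"
  have fU: "(\<lambda>n. f n y) sums U (x0 + y)" if "norm y < \<rho>" for y
  proof -
    have "x0 + y \<in> ball x0 \<rho>" using that by (simp add: dist_norm)
    from U[OF this] have "((\<lambda>\<alpha>. a \<alpha> * monomial_at \<alpha> y) has_sum U (x0 + y)) UNIV" by simp
    moreover have "bij_betw snd (Sigma (UNIV::nat set) A) UNIV"
      by (rule bij_betwI[of _ _ _ "\<lambda>\<alpha>. (sum \<alpha> UNIV, \<alpha>)"]) (auto simp: A_def)
    ultimately have "((\<lambda>z. a (snd z) * monomial_at (snd z) y) has_sum U (x0 + y)) (Sigma UNIV A)"
      by (simp add: has_sum_reindex_bij_betw[where f = "\<lambda>\<alpha>. a \<alpha> * monomial_at \<alpha> y"])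
    then have "((\<lambda>n. f n y) has_sum U (x0 + y)) UNIV"
      by (rule has_sum_SigmaD) (simp add: f_def has_sum_finite finA)
    then show ?thesis by (rule has_sum_imp_sums)
  qed
  have fG: "(f n has_derivative (\<lambda>h. h \<bullet> G n y)) (at y within T)" for n y T
  proof -
    have "(monomial_at \<alpha> has_derivative (\<lambda>h. h \<bullet> monomial_gradient \<alpha> y)) (at y within T)" for \<alpha>
      using GDERIV_monomial[of \<alpha> y] unfolding gderiv_def by (rule has_derivative_at_withinI)
    then have "((\<lambda>y. a \<alpha> * monomial_at \<alpha> y) has_derivative (\<lambda>h. a \<alpha> * (h \<bullet> monomial_gradient \<alpha> y))) (at y within T)" for \<alpha>
      by (rule has_derivative_mult_right)
    then show ?thesis unfolding f_def G_def inner_sum_right inner_scaleR_right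
      by (rule has_derivative_sum)
  qed
  have Gle: "norm (G n y) \<le> S n * (real n * norm y ^ (n - 1))" for n y
  proof -
    have "norm (G n y) \<le> (\<Sum>\<alpha>\<in>A n. \<bar>a \<alpha>\<bar> * (real n * norm y ^ (n - 1)))"
      unfolding G_def using norm_monomial_gradient_le[of _ y]
      by (intro sum_norm_le) (auto simp: A_def intro!: mult_left_mono)
    then show ?thesis by (simp add: S_def sum_distrib_right)
  qed
  \<comment> \<open>The power \<open>norm y ^ R\<close> is split off, and the remaining factors are at most \<open>r / 2\<close>; \<open>n \<le> 2\<^sup>n\<close>.\<close>
  have Gbound: "norm (G n y) \<le> (2 / r) ^ (R + 1) * norm y ^ R * B n" if n: "n > R" and y: "norm y < r / 2" for n y R
  proof -
    obtain m where m: "n = R + 1 + m" using n by (metis less_iff_Suc_add add.assoc add.commute plus_1_eq_Suc)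
    have "norm y ^ (n - 1) = norm y ^ R * norm y ^ m" by (simp add: m power_add)
    also have "\<dots> \<le> norm y ^ R * (r / 2) ^ m"
      using y by (intro mult_left_mono power_mono) auto
    finally have "real n * norm y ^ (n - 1) \<le> 2 ^ n * (norm y ^ R * (r / 2) ^ m)"
      using r by (intro mult_mono) (auto simp: less_imp_le)
    also have "\<dots> = (2 / r) ^ (R + 1) * norm y ^ R * r ^ n"
      using r by (simp add: m power_add power_divide field_simps)
    finally have "S n * (real n * norm y ^ (n - 1)) \<le> S n * ((2 / r) ^ (R + 1) * norm y ^ R * r ^ n)"
      by (rule mult_left_mono) (rule S0)
    then show ?thesis using Gle[of n y] by (simp add: B_def mult_ac)
  qed
  have G0: "G 0 y = 0" for y using Gle[of 0 y] by simp
  have GleB: "norm (G n y) \<le> (2 / r) * B n" if "norm y < r / 2" for n y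
    using Gbound[of 0 n y] that B0[of 0] r by (cases "n = 0") (auto simp: G0)
  have sumG: "summable (\<lambda>n. G n y)" if "norm y < r / 2" for y
    by (rule summable_comparison_test'[OF summable_mult[OF B, of "2 / r"], of 0]) (rule GleB[OF that])
  have r2: "r / 2 < \<rho>"
  proof -
    have "r \<le> \<rho> / 2" unfolding r_def using \<rho> by (simp add: field_simps)
    then show ?thesis using \<rho> r by simp
  qed
  have ser: "\<exists>g. \<forall>y\<in>ball 0 (r / 2). (\<lambda>n. f n y) sums g y \<and>
      (g has_derivative (\<lambda>h. h \<bullet> (\<Sum>n. G n y))) (at y within ball 0 (r / 2))"
  proof (rule has_derivative_series)
    show "convex (ball (0::real^'m) (r / 2))" by simp
    show "0 \<in> ball (0::real^'m) (r / 2)" using r by simp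
    show "(\<lambda>n. f n 0) sums U (x0 + 0)" using fU[of 0] \<rho> by simp
    show "(f n has_derivative (\<lambda>h. h \<bullet> G n y)) (at y within ball 0 (r / 2))" for n y by (rule fG)
    fix e :: real assume e: "e > 0"
    have "summable (\<lambda>n. (2 / r) * B n)" by (intro summable_mult B)
    from suminf_exist_split[OF e this] obtain N
      where N: "\<And>n. n \<ge> N \<Longrightarrow> norm (\<Sum>i. (2 / r) * B (i + n)) < e" by blast
    show "\<forall>\<^sub>F n in sequentially. \<forall>y\<in>ball 0 (r / 2). \<forall>h. norm (sum (\<lambda>i. h \<bullet> G i y) {..<n} - h \<bullet> (\<Sum>n. G n y)) \<le> e * norm h"
      unfolding eventually_sequentially
    proof (intro exI[of _ N] allI impI ballI)
      fix n y h assume n: "n \<ge> N" and "y \<in> ball (0::real^'m) (r / 2)"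
      then have y: "norm y < r / 2" by simp
      have sB: "summable (\<lambda>i. (2 / r) * B (i + n))"
        using summable_mult[OF B, of "2 / r"] by (rule summable_ignore_initial_segment)
      have "sum (\<lambda>i. h \<bullet> G i y) {..<n} - h \<bullet> (\<Sum>n. G n y) = - (h \<bullet> (\<Sum>i. G (i + n) y))"
        using suminf_minus_initial_segment[OF sumG[OF y], of n]
        by (simp add: inner_sum_right inner_diff_right)
      then have cs: "norm (sum (\<lambda>i. h \<bullet> G i y) {..<n} - h \<bullet> (\<Sum>n. G n y)) \<le> norm h * norm (\<Sum>i. G (i + n) y)"
        by (simp add: Cauchy_Schwarz_ineq2)
      have "norm (\<Sum>i. G (i + n) y) \<le> (\<Sum>i. (2 / r) * B (i + n))"
        by (rule norm_suminf_le[OF GleB[OF y] sB])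
      also have "\<dots> \<le> e" using N[OF n] by simp
      finally have "norm h * norm (\<Sum>i. G (i + n) y) \<le> norm h * e"
        by (rule mult_left_mono) simp
      with cs show "norm (sum (\<lambda>i. h \<bullet> G i y) {..<n} - h \<bullet> (\<Sum>n. G n y)) \<le> e * norm h"
        by (simp only: mult.commute order_trans)
    qed
  qed
  then obtain g where g0: "\<forall>y\<in>ball 0 (r / 2). (\<lambda>n. f n y) sums g y \<and>
      (g has_derivative (\<lambda>h. h \<bullet> (\<Sum>n. G n y))) (at y within ball 0 (r / 2))"
    by blast
  have g: "(\<lambda>n. f n y) sums g y" "(g has_derivative (\<lambda>h. h \<bullet> (\<Sum>n. G n y))) (at y within ball 0 (r / 2))"
    if "norm y < r / 2" for y
    using bspec[OF g0, of y] that by simp_all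
  have gU: "g y = U (x0 + y)" if "norm y < r / 2" for y
    using sums_unique2[OF g(1) fU, of y] that r2 by simp
  have der: "GDERIV U (x0 + y) :> (\<Sum>n. G n y)" if y: "norm y < r / 2" for y
  proof -
    have "(g has_derivative (\<lambda>h. h \<bullet> (\<Sum>n. G n y))) (at y)"
      using g(2)[OF y] y at_within_open[of y "ball 0 (r / 2)"] by simp
    moreover have "((\<lambda>x. x - x0) has_derivative (\<lambda>h. h)) (at (x0 + y))"
      using has_derivative_diff[OF has_derivative_ident has_derivative_const, of x0 "at (x0 + y)"] by simp
    ultimately have "((\<lambda>x. g (x - x0)) has_derivative (\<lambda>h. h \<bullet> (\<Sum>n. G n y))) (at (x0 + y))"
      using has_derivative_compose[of "\<lambda>x. x - x0" "\<lambda>h. h" "x0 + y" UNIV g "\<lambda>h. h \<bullet> (\<Sum>n. G n y)"]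
      by simp
    moreover have "g (x - x0) = U x" if "x \<in> ball x0 (r / 2)" for x
      using gU[of "x - x0"] that by (simp add: dist_norm norm_minus_commute)
    moreover have "x0 + y \<in> ball x0 (r / 2)" using y by (simp add: dist_norm)
    ultimately show ?thesis unfolding gderiv_def
      using has_derivative_transform_within_open[of "\<lambda>x. g (x - x0)" _ "x0 + y" UNIV "ball x0 (r / 2)" U] by simp
  qed
  show ?thesis
  proof
    show "r / 2 > 0" using r by simp
    show "GDERIV U (x0 + y) :> grad U (x0 + y)" if "norm y < r / 2" for y
      using der[OF that] grad_eqI by metis
    fix R
    show "\<exists>C. \<forall>y. norm y < r / 2 \<longrightarrow> norm (grad U (x0 + y)
        - (\<Sum>n\<le>R. \<Sum>\<alpha> | sum \<alpha> UNIV = n. a \<alpha> *\<^sub>R monomial_gradient \<alpha> y)) \<le> C * norm y ^ R"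
    proof (intro exI[of _ "(2 / r) ^ (R + 1) * (\<Sum>n. B (n + Suc R))"] allI impI)
      fix y :: "real^'m" assume y: "norm y < r / 2"
      have "grad U (x0 + y) - (\<Sum>n\<le>R. \<Sum>\<alpha> | sum \<alpha> UNIV = n. a \<alpha> *\<^sub>R monomial_gradient \<alpha> y)
          = (\<Sum>n. G (n + Suc R) y)"
        using suminf_minus_initial_segment[OF sumG[OF y], of "Suc R"] grad_eqI[OF der[OF y]]
        by (simp add: G_def A_def lessThan_Suc_atMost)
      moreover have "norm (\<Sum>n. G (n + Suc R) y) \<le> (\<Sum>n. (2 / r) ^ (R + 1) * norm y ^ R * B (n + Suc R))"
        using B by (intro norm_suminf_le Gbound y summable_mult) (auto intro: summable_ignore_initial_segment simp del: add_Suc_right)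
      moreover have "\<dots> = (2 / r) ^ (R + 1) * norm y ^ R * (\<Sum>n. B (n + Suc R))"
        using B by (intro suminf_mult summable_ignore_initial_segment)
      ultimately show "norm (grad U (x0 + y) - (\<Sum>n\<le>R. \<Sum>\<alpha> | sum \<alpha> UNIV = n. a \<alpha> *\<^sub>R monomial_gradient \<alpha> y))
          \<le> (2 / r) ^ (R + 1) * (\<Sum>n. B (n + Suc R)) * norm y ^ R"
        by (simp add: mult_ac)
    qed
  qed
qed

section \<open>Expansions in powers of the step size\<close>

definition big_O_unif :: "nat \<Rightarrow> (real \<Rightarrow> real \<Rightarrow> 'a::real_normed_vector) \<Rightarrow> bool" where
  "big_O_unif r f \<longleftrightarrow> (\<exists>C. \<forall>\<^sub>F h in at_right 0. \<forall>c\<in>{0..1}. norm (f h c) \<le> C * h ^ r)"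

text \<open>
  Smoothness of order \<open>r\<close> in the local time \<open>t = h c\<close>, uniformly in \<open>h\<close>: Taylor's formula with a
  polynomial in \<open>t\<close> whose coefficients may depend on \<open>h\<close> but stay bounded. Unlike a bound on
  derivatives, this property passes to products and through operators that use the values at
  finitely many nodes only, such as interpolation.
\<close>

definition h_jet :: "nat \<Rightarrow> (real \<Rightarrow> real \<Rightarrow> 'a::real_normed_vector) \<Rightarrow> bool" where
  "h_jet r f \<longleftrightarrow> (\<exists>a. (\<forall>m. big_O_unif 0 (\<lambda>h c. a m h)) \<and>
     big_O_unif r (\<lambda>h c. f h c - (\<Sum>m<r. (h * c) ^ m *\<^sub>R a m h)))"

lemma eventually_h_small: "\<forall>\<^sub>F h in at_right 0. 0 < h \<and> h < (1::real)"
  using eventually_at_right_real[of 0 1] by (rule eventually_mono) (auto intro: zero_less_one)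

lemma big_O_unifI:
  assumes "\<forall>\<^sub>F h in at_right 0. \<forall>c\<in>{0..1}. norm (f h c) \<le> C * h ^ r"
  shows "big_O_unif r f"
  using assms unfolding big_O_unif_def by blast

lemma big_O_unifE:
  assumes "big_O_unif r f"
  obtains C where "C > 0" "\<forall>\<^sub>F h in at_right 0. 0 < h \<and> h < 1 \<and> (\<forall>c\<in>{0..1}. norm (f h c) \<le> C * h ^ r)"
proof -
  obtain C where "\<forall>\<^sub>F h in at_right 0. \<forall>c\<in>{0..1}. norm (f h c) \<le> C * h ^ r"
    using assms unfolding big_O_unif_def by blast
  then have "\<forall>\<^sub>F h in at_right 0. 0 < h \<and> h < 1 \<and> (\<forall>c\<in>{0..1}. norm (f h c) \<le> (\<bar>C\<bar> + 1) * h ^ r)"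
    using eventually_h_small
  proof eventually_elim
    case (elim h)
    have "C * h ^ r \<le> (\<bar>C\<bar> + 1) * h ^ r" using elim by (intro mult_right_mono) auto
    then show ?case using elim by (meson order_trans)
  qed
  then show ?thesis by (intro that[of "\<bar>C\<bar> + 1"]) auto
qed

lemma big_O_unif_0: "big_O_unif r (\<lambda>h c. 0)"
  by (rule big_O_unifI[of _ 0]) simp

lemma big_O_unif_const: "big_O_unif 0 (\<lambda>h c. a)"
  by (rule big_O_unifI[of _ "norm a"]) simp

lemma big_O_unif_cong:
  assumes "big_O_unif r f" "\<forall>\<^sub>F h in at_right 0. \<forall>c\<in>{0..1}. f h c = g h c"
  shows "big_O_unif r g"
proof -
  obtain C where "\<forall>\<^sub>F h in at_right 0. \<forall>c\<in>{0..1}. norm (f h c) \<le> C * h ^ r"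
    using assms(1) unfolding big_O_unif_def by blast
  with assms(2) have "\<forall>\<^sub>F h in at_right 0. \<forall>c\<in>{0..1}. norm (g h c) \<le> C * h ^ r"
    by eventually_elim auto
  then show ?thesis by (rule big_O_unifI)
qed

lemma big_O_unif_bilinear:
  assumes "bounded_bilinear B" "big_O_unif r f" "big_O_unif s g"
  shows "big_O_unif (r + s) (\<lambda>h c. B (f h c) (g h c))"
proof -
  interpret bounded_bilinear B by fact
  obtain K where K: "K > 0" "\<And>x y. norm (B x y) \<le> norm x * norm y * K"
    using pos_bounded by blast
  obtain C where C: "C > 0" "\<forall>\<^sub>F h in at_right 0. 0 < h \<and> h < 1 \<and> (\<forall>c\<in>{0..1}. norm (f h c) \<le> C * h ^ r)"
    using assms(2) by (rule big_O_unifE)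
  obtain C' where C': "C' > 0" "\<forall>\<^sub>F h in at_right 0. 0 < h \<and> h < 1 \<and> (\<forall>c\<in>{0..1}. norm (g h c) \<le> C' * h ^ s)"
    using assms(3) by (rule big_O_unifE)
  show ?thesis
  proof (rule big_O_unifI[of _ "C * C' * K"])
    show "\<forall>\<^sub>F h in at_right 0. \<forall>c\<in>{0..1}. norm (B (f h c) (g h c)) \<le> C * C' * K * h ^ (r + s)"
      using C(2) C'(2)
    proof eventually_elim
      case (elim h)
      show ?case
      proof
        fix c :: real assume c: "c \<in> {0..1}"
        have "norm (B (f h c) (g h c)) \<le> norm (f h c) * norm (g h c) * K" by (rule K)
        also have "\<dots> \<le> (C * h ^ r) * (C' * h ^ s) * K"
          using elim c K C(1) by (intro mult_right_mono mult_mono) auto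
        finally show "norm (B (f h c) (g h c)) \<le> C * C' * K * h ^ (r + s)"
          by (simp add: power_add mult_ac)
      qed
    qed
  qed
qed

lemma big_O_unif_add:
  assumes "big_O_unif r f" "big_O_unif r g"
  shows "big_O_unif r (\<lambda>h c. f h c + g h c)"
proof -
  obtain C where C: "\<forall>\<^sub>F h in at_right 0. \<forall>c\<in>{0..1}. norm (f h c) \<le> C * h ^ r"
    using assms(1) unfolding big_O_unif_def by blast
  obtain C' where C': "\<forall>\<^sub>F h in at_right 0. \<forall>c\<in>{0..1}. norm (g h c) \<le> C' * h ^ r"
    using assms(2) unfolding big_O_unif_def by blast
  have "\<forall>\<^sub>F h in at_right 0. \<forall>c\<in>{0..1}. norm (f h c + g h c) \<le> (C + C') * h ^ r"
    using C C'
    by eventually_elim (auto simp: distrib_right intro!: order_trans[OF norm_triangle_ineq] add_mono)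
  then show ?thesis by (rule big_O_unifI)
qed

lemma big_O_unif_bounded_linear:
  assumes "bounded_linear L" "big_O_unif r f"
  shows "big_O_unif r (\<lambda>h c. L (f h c))"
proof -
  have "bounded_bilinear (\<lambda>x (y::real). y *\<^sub>R L x)"
    by (rule bounded_bilinear.comp1[OF bounded_bilinear.flip[OF bounded_bilinear_scaleR] assms(1)])
  from big_O_unif_bilinear[OF this assms(2) big_O_unif_const[of 1]]
  show ?thesis by simp
qed

lemma big_O_unif_scale: "big_O_unif r f \<Longrightarrow> big_O_unif r (\<lambda>h c. k *\<^sub>R f h c)"
  using big_O_unif_bounded_linear[OF bounded_linear_scaleR_right] .

lemma big_O_unif_minus: "big_O_unif r f \<Longrightarrow> big_O_unif r (\<lambda>h c. - f h c)"
  using big_O_unif_bounded_linear[OF bounded_linear_minus[OF bounded_linear_ident]] .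

lemma big_O_unif_diff: "big_O_unif r f \<Longrightarrow> big_O_unif r g \<Longrightarrow> big_O_unif r (\<lambda>h c. f h c - g h c)"
  using big_O_unif_add[OF _ big_O_unif_minus] by simp

lemma big_O_unif_sum:
  "(\<And>i. i \<in> I \<Longrightarrow> big_O_unif r (f i)) \<Longrightarrow> big_O_unif r (\<lambda>h c. \<Sum>i\<in>I. f i h c)"
  by (induction I rule: infinite_finite_induct) (auto intro: big_O_unif_0 big_O_unif_add)

lemma big_O_unif_power_h: "big_O_unif n (\<lambda>h c. h ^ n)"
proof (rule big_O_unifI[of _ 1])
  show "\<forall>\<^sub>F h in at_right 0. \<forall>c\<in>{0..1}. norm (h ^ n) \<le> 1 * h ^ n"
    using eventually_h_small by eventually_elim auto
qed

lemma big_O_unif_of_c: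
  assumes "continuous_on {0..1} \<phi>"
  shows "big_O_unif 0 (\<lambda>h c. \<phi> c)"
proof -
  have "bounded (\<phi> ` {0..1})"
    using assms by (intro compact_imp_bounded compact_continuous_image) auto
  then obtain K where "\<forall>x\<in>\<phi> ` {0..1}. norm x \<le> K" unfolding bounded_iff by blast
  then show ?thesis by (intro big_O_unifI[of _ K]) auto
qed

lemma big_O_unif_mono:
  assumes "big_O_unif r f" "s \<le> r"
  shows "big_O_unif s f"
proof -
  obtain C where C: "C > 0" "\<forall>\<^sub>F h in at_right 0. 0 < h \<and> h < 1 \<and> (\<forall>c\<in>{0..1}. norm (f h c) \<le> C * h ^ r)"
    using assms(1) by (rule big_O_unifE)
  have "\<forall>\<^sub>F h in at_right 0. \<forall>c\<in>{0..1}. norm (f h c) \<le> C * h ^ s"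
    using C(2)
  proof eventually_elim
    case (elim h)
    then have "h ^ r \<le> h ^ s" using assms(2) by (intro power_decreasing) auto
    then have "C * h ^ r \<le> C * h ^ s" using C(1) by (intro mult_left_mono) auto
    then show ?case using elim by (meson order_trans)
  qed
  then show ?thesis by (rule big_O_unifI)
qed

lemma big_O_unif_node:
  assumes "big_O_unif r f" "x \<in> {0..1}"
  shows "big_O_unif r (\<lambda>h c. f h x)"
proof -
  obtain C where "\<forall>\<^sub>F h in at_right 0. \<forall>c\<in>{0..1}. norm (f h c) \<le> C * h ^ r"
    using assms(1) unfolding big_O_unif_def by blast
  then have "\<forall>\<^sub>F h in at_right 0. \<forall>c\<in>{0..1::real}. norm (f h x) \<le> C * h ^ r"
    by eventually_elim (use assms(2) in auto)
  then show ?thesis by (rule big_O_unifI)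
qed

lemma big_O_unif_h_mult: "big_O_unif r f \<Longrightarrow> big_O_unif (Suc r) (\<lambda>h c. h *\<^sub>R f h c)"
  using big_O_unif_bilinear[OF bounded_bilinear_scaleR big_O_unif_power_h[of 1]] by simp

lemma big_O_unif_h_divide:
  assumes "big_O_unif (n + r) f"
  shows "big_O_unif r (\<lambda>h c. (1 / h ^ n) *\<^sub>R f h c)"
proof -
  obtain C where C: "\<forall>\<^sub>F h in at_right 0. 0 < h \<and> h < 1 \<and> (\<forall>c\<in>{0..1}. norm (f h c) \<le> C * h ^ (n + r))"
    using assms(1) by (rule big_O_unifE)
  have "\<forall>\<^sub>F h in at_right 0. \<forall>c\<in>{0..1}. norm ((1 / h ^ n) *\<^sub>R f h c) \<le> C * h ^ r"
    using C
  proof eventually_elim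
    case (elim h)
    show ?case
    proof
      fix c :: real assume "c \<in> {0..1}"
      then have "norm (f h c) / h ^ n \<le> C * h ^ (n + r) / h ^ n" using elim by (intro divide_right_mono) auto
      then show "norm ((1 / h ^ n) *\<^sub>R f h c) \<le> C * h ^ r" using elim by (simp add: power_add)
    qed
  qed
  then show ?thesis by (rule big_O_unifI)
qed

lemma h_jetI:
  assumes "\<And>m. big_O_unif 0 (\<lambda>h c. a m h)" "big_O_unif r (\<lambda>h c. f h c - (\<Sum>m<r. (h * c) ^ m *\<^sub>R a m h))"
  shows "h_jet r f"
  using assms unfolding h_jet_def by blast

lemma h_jet_cong:
  assumes "h_jet r f" "\<forall>\<^sub>F h in at_right 0. \<forall>c\<in>{0..1}. f h c = g h c"
  shows "h_jet r g"
proof -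
  obtain a where a: "\<And>m. big_O_unif 0 (\<lambda>h c. a m h)"
    "big_O_unif r (\<lambda>h c. f h c - (\<Sum>m<r. (h * c) ^ m *\<^sub>R a m h))"
    using assms(1) unfolding h_jet_def by blast
  have "big_O_unif r (\<lambda>h c. g h c - (\<Sum>m<r. (h * c) ^ m *\<^sub>R a m h))"
    by (rule big_O_unif_cong[OF a(2)], rule eventually_mono[OF assms(2)]) auto
  with a(1) show ?thesis by (rule h_jetI)
qed

lemma h_jet_big_O: "big_O_unif r f \<Longrightarrow> h_jet r f"
  by (rule h_jetI[of "\<lambda>_ _. 0"]) (auto intro: big_O_unif_0)

lemma h_jet_0_iff: "h_jet 0 f \<longleftrightarrow> big_O_unif 0 f"
  unfolding h_jet_def by (auto intro: exI[of _ "\<lambda>_ _. 0"] big_O_unif_0)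

lemma h_jet_add:
  assumes "h_jet r f" "h_jet r g"
  shows "h_jet r (\<lambda>h c. f h c + g h c)"
proof -
  obtain a b where a: "\<And>m. big_O_unif 0 (\<lambda>h c. a m h)"
    "big_O_unif r (\<lambda>h c. f h c - (\<Sum>m<r. (h * c) ^ m *\<^sub>R a m h))" and
    b: "\<And>m. big_O_unif 0 (\<lambda>h c. b m h)"
    "big_O_unif r (\<lambda>h c. g h c - (\<Sum>m<r. (h * c) ^ m *\<^sub>R b m h))"
    using assms unfolding h_jet_def by blast
  show ?thesis
  proof (rule h_jetI[of "\<lambda>m h. a m h + b m h"])
    show "big_O_unif 0 (\<lambda>h c. a m h + b m h)" for m by (intro big_O_unif_add a b)
    show "big_O_unif r (\<lambda>h c. f h c + g h c - (\<Sum>m<r. (h * c) ^ m *\<^sub>R (a m h + b m h)))"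
      using big_O_unif_add[OF a(2) b(2)] by (simp add: scaleR_add_right sum.distrib add_diff_add)
  qed
qed

lemma h_jet_zero: "h_jet r (\<lambda>h c. 0)"
  by (intro h_jet_big_O big_O_unif_0)

lemma h_jet_sum:
  "(\<And>i. i \<in> I \<Longrightarrow> h_jet r (f i)) \<Longrightarrow> h_jet r (\<lambda>h c. \<Sum>i\<in>I. f i h c)"
  by (induction I rule: infinite_finite_induct) (auto intro: h_jet_zero h_jet_add)

text \<open>
  A power of \<open>h c\<close> is a term of the expansion or belongs to the remainder, depending on \<open>n\<close>. This
  makes products of expansions expansions again.
\<close>

lemma h_jet_monom:
  assumes "big_O_unif 0 (\<lambda>h c. a h)"
  shows "h_jet r (\<lambda>h c. (h * c) ^ n *\<^sub>R a h)"
proof (cases "n < r")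
  case True
  show ?thesis
  proof (rule h_jetI[of "\<lambda>m h. if m = n then a h else 0"])
    show "big_O_unif 0 (\<lambda>h c. if m = n then a h else 0)" for m
      using assms by (cases "m = n") (auto intro: big_O_unif_0)
    show "big_O_unif r (\<lambda>h c. (h * c) ^ n *\<^sub>R a h - (\<Sum>m<r. (h * c) ^ m *\<^sub>R (if m = n then a h else 0)))"
      using True by (simp add: if_distrib[of "\<lambda>v. _ *\<^sub>R v"] big_O_unif_0 cong: if_cong)
  qed
next
  case False
  have "continuous_on {0..1} (\<lambda>c::real. c ^ n)" by (intro continuous_intros)
  from big_O_unif_bilinear[OF bounded_bilinear_scaleR big_O_unif_of_c[OF this] assms]
  have "big_O_unif 0 (\<lambda>h c. c ^ n *\<^sub>R a h)" by simp
  from big_O_unif_bilinear[OF bounded_bilinear_scaleR big_O_unif_power_h[of n] this]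
  have "big_O_unif n (\<lambda>h c. (h * c) ^ n *\<^sub>R a h)" by (simp add: power_mult_distrib)
  from h_jet_big_O[OF big_O_unif_mono[OF this, of r]] show ?thesis using False by simp
qed

lemma h_jet_const: "h_jet r (\<lambda>h c. a)"
  using h_jet_monom[OF big_O_unif_const, of r 0 a] by simp

lemma h_jet_poly_part:
  assumes "\<And>m. big_O_unif 0 (\<lambda>h c. a m h)"
  shows "h_jet r (\<lambda>h c. \<Sum>m<n. (h * c) ^ m *\<^sub>R a m h)"
  by (intro h_jet_sum h_jet_monom assms)

lemma h_jet_bounded:
  assumes "h_jet r f"
  shows "big_O_unif 0 f"
proof -
  obtain a where a: "\<And>m. big_O_unif 0 (\<lambda>h c. a m h)"
    "big_O_unif r (\<lambda>h c. f h c - (\<Sum>m<r. (h * c) ^ m *\<^sub>R a m h))"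
    using assms(1) unfolding h_jet_def by blast
  have "big_O_unif 0 (\<lambda>h c. \<Sum>m<r. (h * c) ^ m *\<^sub>R a m h)"
    using h_jet_poly_part[OF a(1), of 0] by (simp add: h_jet_0_iff)
  from big_O_unif_add[OF big_O_unif_mono[OF a(2), of 0] this] show ?thesis by simp
qed

lemma h_jet_mono:
  assumes "h_jet r f" "s \<le> r"
  shows "h_jet s f"
proof -
  obtain a where a: "\<And>m. big_O_unif 0 (\<lambda>h c. a m h)"
    "big_O_unif r (\<lambda>h c. f h c - (\<Sum>m<r. (h * c) ^ m *\<^sub>R a m h))"
    using assms(1) unfolding h_jet_def by blast
  from h_jet_add[OF h_jet_big_O[OF big_O_unif_mono[OF a(2) assms(2)]] h_jet_poly_part[where a = a and r = s and n = r, OF a(1)]]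
  show ?thesis by simp
qed

lemma h_jet_bilinear:
  assumes "bounded_bilinear B" "h_jet r f" "h_jet r g"
  shows "h_jet r (\<lambda>h c. B (f h c) (g h c))"
proof -
  interpret bounded_bilinear B by fact
  obtain a b where a: "\<And>m. big_O_unif 0 (\<lambda>h c. a m h)"
    "big_O_unif r (\<lambda>h c. f h c - (\<Sum>m<r. (h * c) ^ m *\<^sub>R a m h))" and
    b: "\<And>m. big_O_unif 0 (\<lambda>h c. b m h)"
    "big_O_unif r (\<lambda>h c. g h c - (\<Sum>m<r. (h * c) ^ m *\<^sub>R b m h))"
    using assms unfolding h_jet_def by blast
  define p q where "p = (\<lambda>h c. \<Sum>m<r. (h * c) ^ m *\<^sub>R a m h)" and "q = (\<lambda>h c. \<Sum>m<r. (h * c) ^ m *\<^sub>R b m h)"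
  have "h_jet r (\<lambda>h c. \<Sum>m<r. \<Sum>n<r. (h * c) ^ (m + n) *\<^sub>R B (a m h) (b n h))"
    using big_O_unif_bilinear[OF assms(1) a(1) b(1)] by (intro h_jet_sum h_jet_monom) simp
  moreover have "(\<Sum>m<r. \<Sum>n<r. (h * c) ^ (m + n) *\<^sub>R B (a m h) (b n h)) = B (p h c) (q h c)" for h c
    unfolding p_def q_def by (simp add: sum_left sum_right scaleR_left scaleR_right power_add scaleR_sum_right)
       (subst sum.swap, simp add: mult.commute)
  ultimately have 1: "h_jet r (\<lambda>h c. B (p h c) (q h c))" by simp
  have p0: "big_O_unif 0 p"
    using h_jet_poly_part[OF a(1), of 0] by (simp add: h_jet_0_iff p_def)
  have 2: "big_O_unif r (\<lambda>h c. B (f h c - p h c) (g h c))"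
    using big_O_unif_bilinear[OF assms(1) a(2) h_jet_bounded[OF assms(3)]] by (simp add: p_def)
  have 3: "big_O_unif r (\<lambda>h c. B (p h c) (g h c - q h c))"
    using big_O_unif_bilinear[OF assms(1) p0 b(2)] by (simp add: q_def)
  from h_jet_add[OF 1 h_jet_big_O[OF big_O_unif_add[OF 2 3]]]
  show ?thesis by (simp add: diff_left diff_right)
qed

lemma h_jet_bounded_linear:
  assumes "bounded_linear L" "h_jet r f"
  shows "h_jet r (\<lambda>h c. L (f h c))"
proof -
  have "bounded_bilinear (\<lambda>x (y::real). y *\<^sub>R L x)"
    by (rule bounded_bilinear.comp1[OF bounded_bilinear.flip[OF bounded_bilinear_scaleR] assms(1)])
  from h_jet_bilinear[OF this assms(2) h_jet_const[of r 1]]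
  show ?thesis by simp
qed

lemma h_jet_minus: "h_jet r f \<Longrightarrow> h_jet r (\<lambda>h c. - f h c)"
  using h_jet_bounded_linear[OF bounded_linear_minus[OF bounded_linear_ident]] .

lemma h_jet_diff: "h_jet r f \<Longrightarrow> h_jet r g \<Longrightarrow> h_jet r (\<lambda>h c. f h c - g h c)"
  using h_jet_add[OF _ h_jet_minus] by simp

text \<open>
  Multiplication by the local time gains an order. All gains of order in the sequel come from here,
  as integration over the step produces the factor \<open>h c\<close>.
\<close>

lemma h_jet_shift:
  assumes "h_jet r f"
  shows "h_jet (Suc r) (\<lambda>h c. (h * c) *\<^sub>R f h c)"
proof -
  obtain a where a: "\<And>m. big_O_unif 0 (\<lambda>h c. a m h)"
    "big_O_unif r (\<lambda>h c. f h c - (\<Sum>m<r. (h * c) ^ m *\<^sub>R a m h))"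
    using assms(1) unfolding h_jet_def by blast
  have 1: "h_jet (Suc r) (\<lambda>h c. \<Sum>m<r. (h * c) ^ Suc m *\<^sub>R a m h)"
    by (intro h_jet_sum h_jet_monom a)
  have "big_O_unif 0 (\<lambda>h c. c)" by (intro big_O_unif_of_c continuous_intros)
  from big_O_unif_h_mult[OF big_O_unif_bilinear[OF bounded_bilinear_scaleR this a(2)]]
  have "big_O_unif (Suc r) (\<lambda>h c. (h * c) *\<^sub>R (f h c - (\<Sum>m<r. (h * c) ^ m *\<^sub>R a m h)))"
    by simp
  from h_jet_add[OF 1 h_jet_big_O[OF this]] show ?thesis
    by (simp add: scaleR_diff_right scaleR_sum_right)
qed

text \<open>
  A linear operator that reproduces \<open>1, c, \<dots>, c\<^bsup>r - 1\<^esup>\<close> leaves the polynomial part of the expansion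
  unchanged, and it maps the remainder to a finite sum of terms of order \<open>h\<^sup>r\<close>. Interpolation at the
  Gauss nodes and the discretized Legendre projection are of this kind.
\<close>

lemma h_jet_reproducing_operator:
  fixes f :: "real \<Rightarrow> real \<Rightarrow> 'a::real_normed_vector"
  assumes "h_jet r f" "finite I" "\<And>i. i \<in> I \<Longrightarrow> x i \<in> {0..1}" "\<And>i. i \<in> I \<Longrightarrow> continuous_on {0..1} (\<phi> i)"
    and reproduces: "\<And>n c. n < r \<Longrightarrow> (\<Sum>i\<in>I. \<phi> i c * x i ^ n) = c ^ n"
  shows "h_jet r (\<lambda>h c. \<Sum>i\<in>I. \<phi> i c *\<^sub>R f h (x i))"
proof -
  obtain a where a: "\<And>m. big_O_unif 0 (\<lambda>h c. a m h)"
    "big_O_unif r (\<lambda>h c. f h c - (\<Sum>m<r. (h * c) ^ m *\<^sub>R a m h))"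
    using assms(1) unfolding h_jet_def by blast
  define p where "p = (\<lambda>h c. \<Sum>m<r. (h * c) ^ m *\<^sub>R a m h)"
  have p: "(\<Sum>i\<in>I. \<phi> i c *\<^sub>R p h (x i)) = p h c" for h c
  proof -
    have "(\<Sum>i\<in>I. \<phi> i c *\<^sub>R p h (x i)) = (\<Sum>m<r. (\<Sum>i\<in>I. \<phi> i c * x i ^ m) *\<^sub>R (h ^ m *\<^sub>R a m h))"
      unfolding p_def scaleR_sum_right scaleR_sum_left
      by (subst sum.swap) (simp add: power_mult_distrib mult_ac)
    also have "\<dots> = p h c" unfolding p_def
      by (intro sum.cong) (auto simp: reproduces power_mult_distrib mult.commute)
    finally show ?thesis .
  qed
  have 1: "h_jet r p" unfolding p_def by (rule h_jet_poly_part[OF a(1)])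
  have "big_O_unif (0 + r) (\<lambda>h c. \<phi> i c *\<^sub>R (f h (x i) - p h (x i)))" if "i \<in> I" for i
    using assms(3,4)[OF that] big_O_unif_node[OF a(2), of "x i"]
    by (intro big_O_unif_bilinear[OF bounded_bilinear_scaleR] big_O_unif_of_c) (auto simp: p_def)
  then have "big_O_unif r (\<lambda>h c. \<Sum>i\<in>I. \<phi> i c *\<^sub>R (f h (x i) - p h (x i)))"
    by (intro big_O_unif_sum) simp
  from h_jet_add[OF 1 h_jet_big_O[OF this]]
  show ?thesis by (simp add: scaleR_diff_right sum_subtractf p)
qed

lemma h_jet_gauss_interp:
  assumes "h_jet r f" "r \<le> s"
  shows "h_jet r (\<lambda>h. gauss_interp s (f h))"
  unfolding gauss_interp_def[abs_def]
proof (rule h_jet_reproducing_operator[OF assms(1)])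
  show "gauss_node s i \<in> {0..1}" if "i \<in> {1..s}" for i using gauss_node_in_closed[OF that] .
  show "continuous_on {0..1} (gauss_lagrange s i)" for i
    unfolding gauss_lagrange_eq_poly[abs_def] by (intro continuous_intros)
  show "(\<Sum>i=1..s. gauss_lagrange s i c * gauss_node s i ^ n) = c ^ n" if "n < r" for n c
    using lagrange_interpolation[of n "\<lambda>x. x ^ n *\<^sub>R (1::real)" s c] poly_fun_monom[of n n "1::real"] that assms(2)
    by simp
qed simp

text \<open>
  Degree below \<open>s\<close> times degree below \<open>s\<close> is at most \<open>2 s - 2 < 2 k\<close>: the \<open>k\<close>-point rule computes the
  Legendre coefficients of such polynomials exactly, so the discretized projection reproduces them.
\<close>

lemma h_jet_legendre_discrete_projection:
  fixes f :: "real \<Rightarrow> real \<Rightarrow> 'a::real_normed_vector"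
  assumes "h_jet r f" "r \<le> s" "s \<le> k"
  shows "h_jet r (\<lambda>h c. \<Sum>j<s. poly (legendre01 j) c *\<^sub>R
     (\<Sum>i=1..k. (gauss_weight k i * poly (legendre01 j) (gauss_node k i)) *\<^sub>R f h (gauss_node k i)))"
proof -
  define \<phi> where "\<phi> i c = (\<Sum>j<s. gauss_weight k i * poly (legendre01 j) (gauss_node k i) * poly (legendre01 j) c)" for i c
  have "h_jet r (\<lambda>h c. \<Sum>i=1..k. \<phi> i c *\<^sub>R f h (gauss_node k i))"
  proof (rule h_jet_reproducing_operator[OF assms(1)])
    show "gauss_node k i \<in> {0..1}" if "i \<in> {1..k}" for i using gauss_node_in_closed[OF that] .
    show "continuous_on {0..1} (\<phi> i)" for i
      unfolding \<phi>_def[abs_def] by (intro continuous_intros)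
    fix n c assume n: "n < r"
    have "(\<Sum>i=1..k. \<phi> i c * gauss_node k i ^ n)
        = (\<Sum>j<s. (\<Sum>i=1..k. gauss_weight k i * poly (legendre01 j * monom 1 n) (gauss_node k i)) * poly (legendre01 j) c)"
      unfolding \<phi>_def sum_distrib_right by (subst sum.swap) (simp add: poly_monom mult_ac)
    also have "\<dots> = (\<Sum>j<s. integral {0..1} (poly (legendre01 j * monom 1 n)) * poly (legendre01 j) c)"
    proof (intro sum.cong refl)
      fix j assume "j \<in> {..<s}"
      then have "degree (legendre01 j * monom 1 n) < 2 * k"
        using degree_mult_le[of "legendre01 j" "monom 1 n"] n assms by (simp add: degree_monom_eq)
      from gauss_quadrature_poly[OF this]
      show "(\<Sum>i=1..k. gauss_weight k i * poly (legendre01 j * monom 1 n) (gauss_node k i)) * poly (legendre01 j) c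
        = integral {0..1} (poly (legendre01 j * monom 1 n)) * poly (legendre01 j) c" by (simp only:)
    qed
    also have "\<dots> = poly (monom 1 n) c"
    proof -
      have "monom 1 n = (\<Sum>j<s. smult (integral {0..1} (poly (legendre01 j * monom 1 n))) (legendre01 j))"
        using n assms by (intro legendre01_expansion) (auto simp: degree_monom_eq)
      from arg_cong[OF this, of "\<lambda>p. poly p c"] show ?thesis by (simp add: poly_sum del: poly_mult)
    qed
    finally show "(\<Sum>i=1..k. \<phi> i c * gauss_node k i ^ n) = c ^ n" by (simp add: poly_monom)
  qed simp
  moreover have "(\<Sum>i=1..k. \<phi> i c *\<^sub>R f h (gauss_node k i)) = (\<Sum>j<s. poly (legendre01 j) c *\<^sub>R
     (\<Sum>i=1..k. (gauss_weight k i * poly (legendre01 j) (gauss_node k i)) *\<^sub>R f h (gauss_node k i)))" for h c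
    unfolding \<phi>_def scaleR_sum_left scaleR_sum_right by (subst sum.swap) (simp add: mult_ac)
  ultimately show ?thesis by simp
qed

text \<open>
  The coefficients of a polynomial are fixed linear combinations of its values at the Gauss nodes.
  Hence every uniform bound on \<open>[0, 1]\<close> passes to the coefficients and to the derivative.
\<close>

lemma poly_fun_coefficients:
  obtains \<kappa> :: "nat \<Rightarrow> nat \<Rightarrow> real" where
    "\<And>(f :: real \<Rightarrow> 'a::real_normed_vector) c. poly_fun d f \<Longrightarrow>
       f c = (\<Sum>m\<le>d. c ^ m *\<^sub>R (\<Sum>j=1..Suc d. \<kappa> m j *\<^sub>R f (gauss_node (Suc d) j)))"
proof
  fix f :: "real \<Rightarrow> 'a" and c assume f: "poly_fun d f"
  have lp: "gauss_lagrange (Suc d) j c = (\<Sum>m\<le>d. coeff (lagrange_poly (Suc d) j) m * c ^ m)" if "j \<in> {1..Suc d}" for j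
    using degree_lagrange_poly[OF that] unfolding gauss_lagrange_eq_poly poly_altdef
    by (intro sum.mono_neutral_left) (auto simp: coeff_eq_0)
  have "f c = (\<Sum>j=1..Suc d. gauss_lagrange (Suc d) j c *\<^sub>R f (gauss_node (Suc d) j))"
    using lagrange_interpolation[OF f, of "Suc d" c] by simp
  also have "\<dots> = (\<Sum>j=1..Suc d. (\<Sum>m\<le>d. coeff (lagrange_poly (Suc d) j) m * c ^ m) *\<^sub>R f (gauss_node (Suc d) j))"
    by (intro sum.cong refl) (simp add: lp)
  also have "\<dots> = (\<Sum>m\<le>d. c ^ m *\<^sub>R (\<Sum>j=1..Suc d. coeff (lagrange_poly (Suc d) j) m *\<^sub>R f (gauss_node (Suc d) j)))"
    unfolding scaleR_sum_left scaleR_sum_right by (subst sum.swap) (simp add: mult.commute)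
  finally show "f c = (\<Sum>m\<le>d. c ^ m *\<^sub>R (\<Sum>j=1..Suc d. coeff (lagrange_poly (Suc d) j) m *\<^sub>R f (gauss_node (Suc d) j)))" .
qed

lemma big_O_unif_poly_coefficients:
  fixes f :: "real \<Rightarrow> real \<Rightarrow> 'a::real_normed_vector"
  assumes "\<And>h. poly_fun d (f h)" "big_O_unif r f"
  obtains A where "\<And>m. big_O_unif r (\<lambda>h c. A m h)" "\<And>h c. f h c = (\<Sum>m\<le>d. c ^ m *\<^sub>R A m h)"
proof -
  obtain \<kappa> :: "nat \<Rightarrow> nat \<Rightarrow> real" where
    \<kappa>: "\<And>(f :: real \<Rightarrow> 'a) c. poly_fun d f \<Longrightarrow>
       f c = (\<Sum>m\<le>d. c ^ m *\<^sub>R (\<Sum>j=1..Suc d. \<kappa> m j *\<^sub>R f (gauss_node (Suc d) j)))"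
    using poly_fun_coefficients[where 'a = 'a and d = d] by blast
  show ?thesis
  proof
    show "big_O_unif r (\<lambda>h c. \<Sum>j=1..Suc d. \<kappa> m j *\<^sub>R f h (gauss_node (Suc d) j))" for m
      by (intro big_O_unif_sum big_O_unif_scale big_O_unif_node[OF assms(2)] gauss_node_in_closed)
    show "f h c = (\<Sum>m\<le>d. c ^ m *\<^sub>R (\<Sum>j=1..Suc d. \<kappa> m j *\<^sub>R f h (gauss_node (Suc d) j)))" for h c
      by (rule \<kappa>[OF assms(1)])
  qed
qed

lemma big_O_unif_poly_derivative:
  fixes f f' :: "real \<Rightarrow> real \<Rightarrow> 'a::real_normed_vector"
  assumes "\<And>h. poly_fun d (f h)" "big_O_unif r f"
    and der: "\<forall>\<^sub>F h in at_right 0. \<forall>c\<in>{0..1}. (f h has_vector_derivative f' h c) (at c)"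
  shows "big_O_unif r f'"
proof -
  obtain A where A: "\<And>m. big_O_unif r (\<lambda>h c. A m h)" "\<And>h c. f h c = (\<Sum>m\<le>d. c ^ m *\<^sub>R A m h)"
    using big_O_unif_poly_coefficients[OF assms(1,2)] by blast
  have fh: "f h = (\<lambda>c. \<Sum>m\<le>d. c ^ m *\<^sub>R A m h)" for h using A(2) by auto
  have *: "(f h has_vector_derivative (\<Sum>m\<le>d. (real m * c ^ (m - 1)) *\<^sub>R A m h)) (at c)" for h c
    unfolding fh
    by (auto intro!: derivative_eq_intros simp: has_vector_derivative_def scaleR_sum_right mult_ac)
  have "big_O_unif (0 + r) (\<lambda>h c. (real m * c ^ (m - 1)) *\<^sub>R A m h)" for m
    by (intro big_O_unif_bilinear[OF bounded_bilinear_scaleR] big_O_unif_of_c continuous_intros A)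
  then have "big_O_unif r (\<lambda>h c. \<Sum>m\<le>d. (real m * c ^ (m - 1)) *\<^sub>R A m h)"
    by (intro big_O_unif_sum) simp
  then show ?thesis
    by (rule big_O_unif_cong, intro eventually_mono[OF der])
       (use vector_derivative_unique_at[OF *] in blast)
qed

text \<open>
  For a polynomial in \<open>c\<close> of fixed degree, smoothness of order \<open>r\<close> in \<open>h c\<close> is a condition on the
  coefficients: the one of \<open>c\<^sup>m\<close> is \<open>O(h\<^sup>m)\<close> for \<open>m \<le> r\<close> and \<open>O(h\<^sup>r)\<close> beyond. The converse is
  \<open>h_jet_of_coefficients\<close>.
\<close>

lemma h_jet_poly_coefficients:
  fixes f :: "real \<Rightarrow> real \<Rightarrow> 'a::real_normed_vector"
  assumes "\<And>h. poly_fun d (f h)" "h_jet r f" "r \<le> Suc d"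
  obtains A where "\<And>m. big_O_unif (min m r) (\<lambda>h c. A m h)"
    "\<And>h c. f h c = (\<Sum>m\<le>d. c ^ m *\<^sub>R A m h)"
proof -
  obtain a where a: "\<And>m. big_O_unif 0 (\<lambda>h c. a m h)"
    "big_O_unif r (\<lambda>h c. f h c - (\<Sum>m<r. (h * c) ^ m *\<^sub>R a m h))"
    using assms(2) unfolding h_jet_def by blast
  have pf: "poly_fun d (\<lambda>c. f h c - (\<Sum>m<r. c ^ m *\<^sub>R (h ^ m *\<^sub>R a m h)))" for h
    using assms(3) by (intro poly_fun_diff poly_fun_sum poly_fun_monom assms(1)) auto
  have "poly_fun d (\<lambda>c. f h c - (\<Sum>m<r. (h * c) ^ m *\<^sub>R a m h))" for h
    using pf[of h] by (simp add: power_mult_distrib mult.commute[of "h ^ _"])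
  then obtain B where B: "\<And>m. big_O_unif r (\<lambda>h c. B m h)"
    "\<And>h c. f h c - (\<Sum>m<r. (h * c) ^ m *\<^sub>R a m h) = (\<Sum>m\<le>d. c ^ m *\<^sub>R B m h)"
    using big_O_unif_poly_coefficients[OF _ a(2)] by blast
  define A where "A m h = (if m < r then h ^ m *\<^sub>R a m h else 0) + B m h" for m h
  show ?thesis
  proof
    fix m
    show "big_O_unif (min m r) (\<lambda>h c. A m h)"
    proof (cases "m < r")
      case True
      have "big_O_unif (m + 0) (\<lambda>h c. h ^ m *\<^sub>R a m h)"
        by (intro big_O_unif_bilinear[OF bounded_bilinear_scaleR] big_O_unif_power_h a)
      then show ?thesis using True unfolding A_def
        by (simp add: big_O_unif_add big_O_unif_mono[OF B(1)])
    qed (simp add: A_def B)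
  next
    fix h c
    have "f h c = (\<Sum>m<r. (h * c) ^ m *\<^sub>R a m h) + (\<Sum>m\<le>d. c ^ m *\<^sub>R B m h)"
      using B(2)[of h c] by (simp add: algebra_simps)
    also have "(\<Sum>m<r. (h * c) ^ m *\<^sub>R a m h) = (\<Sum>m\<le>d. c ^ m *\<^sub>R (if m < r then h ^ m *\<^sub>R a m h else 0))"
      using assms(3) by (intro sum.mono_neutral_cong_left) (auto simp: power_mult_distrib mult.commute)
    finally show "f h c = (\<Sum>m\<le>d. c ^ m *\<^sub>R A m h)"
      by (simp add: A_def scaleR_add_right sum.distrib)
  qed
qed

lemma h_jet_of_coefficients:
  assumes "\<And>m. m \<le> d \<Longrightarrow> big_O_unif (min m r) (\<lambda>h c. A m h)"
  shows "h_jet r (\<lambda>h c. \<Sum>m\<le>d. c ^ m *\<^sub>R A m h)"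
proof (rule h_jet_sum)
  fix m assume "m \<in> {..d}"
  then have Am: "big_O_unif (min m r) (\<lambda>h c. A m h)" using assms by simp
  show "h_jet r (\<lambda>h c. c ^ m *\<^sub>R A m h)"
  proof (cases "m \<le> r")
    case True
    then have "big_O_unif 0 (\<lambda>h c. (1 / h ^ m) *\<^sub>R A m h)"
      using Am by (intro big_O_unif_h_divide) (simp add: min_def)
    from h_jet_monom[OF this, of r m]
    show ?thesis by (rule h_jet_cong, intro eventually_mono[OF eventually_h_small]) (simp add: power_mult_distrib)
  next
    case False
    have "big_O_unif (0 + r) (\<lambda>h c. c ^ m *\<^sub>R A m h)"
      using Am False by (intro big_O_unif_bilinear[OF bounded_bilinear_scaleR] big_O_unif_of_c continuous_intros) (simp add: min_def)
    then show ?thesis by (intro h_jet_big_O) simp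
  qed
qed

text \<open>
  Differential equations in rescaled time have the form \<open>f' = h w\<close>. With \<open>w\<close> a polynomial in \<open>c\<close>, the
  integral is \<open>h c\<close> times a polynomial with the coefficients of \<open>w\<close> divided by \<open>m + 1\<close>.
\<close>

lemma h_jet_primitive:
  fixes f w :: "real \<Rightarrow> real \<Rightarrow> 'a::real_normed_vector"
  assumes "\<And>h. poly_fun d (w h)" "h_jet r w" "r \<le> Suc d"
    and der: "\<forall>\<^sub>F h in at_right 0. \<forall>c\<in>{0..1}. (f h has_vector_derivative h *\<^sub>R w h c) (at c)"
  obtains W where "h_jet r W"
    "\<forall>\<^sub>F h in at_right 0. \<forall>c\<in>{0..1}. f h c = f h 0 + (h * c) *\<^sub>R W h c"
proof -
  obtain A where A: "\<And>m. big_O_unif (min m r) (\<lambda>h c. A m h)"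
    "\<And>h c. w h c = (\<Sum>m\<le>d. c ^ m *\<^sub>R A m h)"
    using h_jet_poly_coefficients[OF assms(1-3)] by blast
  define W where "W h c = (\<Sum>m\<le>d. c ^ m *\<^sub>R ((1 / real (Suc m)) *\<^sub>R A m h))" for h c
  show ?thesis
  proof
    show "h_jet r W" unfolding W_def by (intro h_jet_of_coefficients big_O_unif_scale A)
    show "\<forall>\<^sub>F h in at_right 0. \<forall>c\<in>{0..1}. f h c = f h 0 + (h * c) *\<^sub>R W h c"
      using der
    proof eventually_elim
      case (elim h)
      have pow: "((\<lambda>c. c ^ Suc m *\<^sub>R x) has_vector_derivative ((real (Suc m) * c ^ m) *\<^sub>R x)) (at c within {0..1})"
        for m and x :: 'a and c
      proof -
        have "((\<lambda>c. c ^ Suc m) has_vector_derivative (real (Suc m) * c ^ m)) (at c within {0..1})"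
          using DERIV_pow[of "Suc m" c "{0..1}"] by (simp add: has_real_derivative_iff_has_vector_derivative)
        then show ?thesis by (rule bounded_linear.has_vector_derivative[OF bounded_linear_scaleR_left])
      qed
      have hcW: "(h * c) *\<^sub>R W h c = (\<Sum>m\<le>d. c ^ Suc m *\<^sub>R ((h / real (Suc m)) *\<^sub>R A m h))" for c
        by (simp add: W_def scaleR_sum_right mult_ac)
      have "((\<lambda>c. (h * c) *\<^sub>R W h c) has_vector_derivative
          (\<Sum>m\<le>d. (real (Suc m) * c ^ m) *\<^sub>R ((h / real (Suc m)) *\<^sub>R A m h))) (at c within {0..1})" for c
        unfolding hcW by (intro has_vector_derivative_sum pow)
      moreover have "(\<Sum>m\<le>d. (real (Suc m) * c ^ m) *\<^sub>R ((h / real (Suc m)) *\<^sub>R A m h)) = h *\<^sub>R w h c" for c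
        unfolding A(2) scaleR_sum_right by (intro sum.cong refl) (simp add: mult.commute)
      ultimately have dW: "((\<lambda>c. (h * c) *\<^sub>R W h c) has_vector_derivative h *\<^sub>R w h c) (at c within {0..1})" for c
        by simp
      have "((\<lambda>c. f h c - (h * c) *\<^sub>R W h c) has_vector_derivative (h *\<^sub>R w h c - h *\<^sub>R w h c)) (at c within {0..1})"
        if "c \<in> {0..1}" for c
        by (rule has_vector_derivative_diff[OF has_vector_derivative_at_within[OF bspec[OF elim that]] dW])
      then have zero: "\<And>c. c \<in> {0..1} \<Longrightarrow> ((\<lambda>c. f h c - (h * c) *\<^sub>R W h c) has_vector_derivative 0) (at c within {0..1})"
        by simp
      obtain k where k: "\<And>c. c \<in> {0..1} \<Longrightarrow> f h c - (h * c) *\<^sub>R W h c = k"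
        by (rule has_vector_derivative_zero_constant[OF convex_real_interval(5) zero]) auto
      show ?case using k[of 0] k by (auto simp: algebra_simps)
    qed
  qed
qed

lemma h_jet_monomial_at:
  fixes y :: "real \<Rightarrow> real \<Rightarrow> real^'m::finite"
  assumes "h_jet r y"
  shows "h_jet r (\<lambda>h c. monomial_at \<alpha> (y h c))"
proof -
  have pow: "h_jet r (\<lambda>h c. (y h c $ i) ^ n)" for i n
  proof (induction n)
    case (Suc n)
    from h_jet_bilinear[OF bounded_bilinear_mult h_jet_bounded_linear[OF bounded_linear_vec_nth assms] Suc]
    show ?case by simp
  qed (simp add: h_jet_const)
  have "h_jet r (\<lambda>h c. \<Prod>i\<in>I. (y h c $ i) ^ \<alpha> i)" if "finite I" for I
    using that
  proof (induction I)
    case (insert i I)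
    then show ?case using h_jet_bilinear[OF bounded_bilinear_mult pow insert.IH] by simp
  qed (simp add: h_jet_const)
  then show ?thesis unfolding monomial_at_def by simp
qed

text \<open>
  The expansion of the gradient about \<open>x0\<close> is a polynomial in the displacement, up to an error of
  order \<open>norm y ^ r\<close>; the displacement is \<open>O(h)\<close>.
\<close>

lemma h_jet_analytic_gradient:
  fixes U :: "real^'m::finite \<Rightarrow> real"
  assumes "real_analytic_on U D" "x0 \<in> D" "h_jet r y" "big_O_unif 1 y"
  shows "h_jet r (\<lambda>h c. grad U (x0 + y h c))"
proof -
  obtain \<rho> a where \<rho>: "\<rho> > 0" "\<And>y. norm y < \<rho> \<Longrightarrow> GDERIV U (x0 + y) :> grad U (x0 + y)"
    "\<And>R. \<exists>C. \<forall>y. norm y < \<rho> \<longrightarrow> norm (grad U (x0 + y)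
        - (\<Sum>n\<le>R. \<Sum>\<alpha> | sum \<alpha> UNIV = n. a \<alpha> *\<^sub>R monomial_gradient \<alpha> y)) \<le> C * norm y ^ R"
    using analytic_gradient_expansion[OF assms(1,2)] by blast
  define P where "P y = (\<Sum>n\<le>r. \<Sum>\<alpha> | sum \<alpha> UNIV = n. a \<alpha> *\<^sub>R monomial_gradient \<alpha> y)" for y :: "real^'m"
  obtain C where C: "\<And>y. norm y < \<rho> \<Longrightarrow> norm (grad U (x0 + y) - P y) \<le> C * norm y ^ r"
    using \<rho>(3)[of r] unfolding P_def by blast
  have "h_jet r (\<lambda>h c. monomial_gradient \<alpha> (y h c))" for \<alpha>
    unfolding monomial_gradient_def
    by (intro h_jet_sum h_jet_bilinear[OF bounded_bilinear_scaleR] h_jet_const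
        h_jet_bilinear[OF bounded_bilinear_mult] h_jet_monomial_at assms(3))
  then have P: "h_jet r (\<lambda>h c. P (y h c))"
    unfolding P_def by (intro h_jet_sum h_jet_bounded_linear[OF bounded_linear_scaleR_right])
  obtain K where K: "K > 0" "\<forall>\<^sub>F h in at_right 0. 0 < h \<and> h < 1 \<and> (\<forall>c\<in>{0..1}. norm (y h c) \<le> K * h ^ 1)"
    using assms(4) by (rule big_O_unifE)
  have "\<forall>\<^sub>F h in at_right 0. h < \<rho> / K"
    using eventually_at_right_real[of 0 "\<rho> / K"] K(1) \<rho>(1) by (auto elim: eventually_mono)
  with K(2) have "\<forall>\<^sub>F h in at_right 0. \<forall>c\<in>{0..1}. norm (grad U (x0 + y h c) - P (y h c)) \<le> (\<bar>C\<bar> * K ^ r) * h ^ r"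
  proof eventually_elim
    case (elim h)
    show ?case
    proof
      fix c :: real assume "c \<in> {0..1}"
      then have y: "norm (y h c) \<le> K * h" using elim by auto
      also have "K * h < \<rho>" using elim K(1) by (simp add: field_simps)
      finally have "norm (grad U (x0 + y h c) - P (y h c)) \<le> C * norm (y h c) ^ r" by (rule C)
      also have "\<dots> \<le> \<bar>C\<bar> * (K * h) ^ r"
        using y by (intro mult_mono power_mono) auto
      finally show "norm (grad U (x0 + y h c) - P (y h c)) \<le> (\<bar>C\<bar> * K ^ r) * h ^ r"
        by (simp add: power_mult_distrib mult_ac)
    qed
  qed
  then have "big_O_unif r (\<lambda>h c. grad U (x0 + y h c) - P (y h c))" by (rule big_O_unifI)
  from h_jet_add[OF h_jet_big_O[OF this] P] show ?thesis by simp
qed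

text \<open>
  The polynomial part of the expansion has degree below \<open>2 k\<close> and is integrated exactly.
\<close>

lemma h_jet_quadrature_error:
  assumes "h_jet (2 * k) f" "\<forall>\<^sub>F h in at_right 0. (f h has_integral I h) {0..1}"
  shows "big_O_unif (2 * k) (\<lambda>h c. (\<Sum>i=1..k. gauss_weight k i * f h (gauss_node k i)) - I h)"
proof -
  obtain a where a: "\<And>m. big_O_unif 0 (\<lambda>h c. a m h)"
    "big_O_unif (2 * k) (\<lambda>h c. f h c - (\<Sum>m<2*k. (h * c) ^ m *\<^sub>R a m h))"
    using assms(1) unfolding h_jet_def by blast
  define p where "p = (\<lambda>h c. \<Sum>m<2*k. (h * c) ^ m *\<^sub>R a m h)"
  have p: "(p h has_integral (\<Sum>i=1..k. gauss_weight k i * p h (gauss_node k i))) {0..1}" for h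
  proof (cases "k = 0")
    case False
    have "poly_fun (2 * k - 1) (\<lambda>c. \<Sum>m<2*k. c ^ m *\<^sub>R (h ^ m *\<^sub>R a m h))"
      by (intro poly_fun_sum poly_fun_monom) auto
    then have "poly_fun (2 * k - 1) (p h)" by (simp add: p_def power_mult_distrib mult_ac)
    from gauss_quadrature[OF this, of k] False show ?thesis by simp
  qed (simp add: p_def)
  have 1: "big_O_unif (2 * k) (\<lambda>h c. \<Sum>i=1..k. gauss_weight k i *\<^sub>R (f h (gauss_node k i) - p h (gauss_node k i)))"
    using gauss_node_in_closed a(2) unfolding p_def
    by (intro big_O_unif_sum big_O_unif_scale big_O_unif_node[where x = "gauss_node k _" and f = "\<lambda>h c. f h c - (\<Sum>m<2*k. (h * c) ^ m *\<^sub>R a m h)"])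
  obtain C where C: "\<forall>\<^sub>F h in at_right 0. 0 < h \<and> h < 1 \<and> (\<forall>c\<in>{0..1}. norm (f h c - p h c) \<le> C * h ^ (2 * k))" "C > 0"
    using a(2) unfolding p_def by (rule big_O_unifE)
  have 2: "big_O_unif (2 * k) (\<lambda>h c. I h - (\<Sum>i=1..k. gauss_weight k i * p h (gauss_node k i)))"
  proof (rule big_O_unifI[of _ C])
    show "\<forall>\<^sub>F h in at_right 0. \<forall>c\<in>{0..1::real}. norm (I h - (\<Sum>i=1..k. gauss_weight k i * p h (gauss_node k i))) \<le> C * h ^ (2 * k)"
      using C(1) assms(2)
    proof eventually_elim
      case (elim h)
      have "((\<lambda>c. f h c - p h c) has_integral (I h - (\<Sum>i=1..k. gauss_weight k i * p h (gauss_node k i)))) (cbox 0 1)"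
        using elim p by (auto intro: has_integral_diff)
      from has_integral_bound[OF _ this, of "C * h ^ (2 * k)"] elim C(2)
      show ?case by auto
    qed
  qed
  from big_O_unif_diff[OF 1 2] show ?thesis
    by (simp add: sum_subtractf right_diff_distrib)
qed

section \<open>One step of the procedure\<close>

lemma bounded_bilinear_matrix_vector_mult:
  "bounded_bilinear (\<lambda>(A :: real^'n::finite^'m::finite) x. A *v x)"
proof -
  have "bilinear (\<lambda>(A :: real^'n^'m) x. A *v x)"
    unfolding bilinear_def
    by (auto intro!: linearI simp: matrix_vector_mult_add_rdistrib matrix_vector_right_distrib
        matrix_vector_mult_scaleR scaleR_matrix_vector_assoc[symmetric])
  then show ?thesis by (simp add: bilinear_conv_bounded_bilinear)
qed

lemma bounded_linear_transpose: "bounded_linear (transpose :: real^'n::finite^'m::finite \<Rightarrow> _)"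
  unfolding linear_conv_bounded_linear[symmetric]
  by (intro linearI) (simp_all add: transpose_def vec_eq_iff)

lemma inner_matrix_transpose: "(A *v x) \<bullet> (y :: real^'m::finite) = x \<bullet> (transpose A *v y)"
  by (metis dot_lmul_matrix inner_commute vector_transpose_matrix transpose_transpose)

lemma sym_pos_def_injective:
  assumes "sym_pos_def A" "A *v x = 0"
  shows "x = 0"
  using assms unfolding sym_pos_def_def by (metis inner_zero_right less_irrefl)

lemma sym_pos_def_invertible: "sym_pos_def A \<Longrightarrow> invertible A"
  unfolding invertible_left_inverse matrix_left_invertible_ker using sym_pos_def_injective by blast

lemma sym_pos_def_transpose_inv:
  assumes "sym_pos_def A"
  shows "transpose (matrix_inv A) = matrix_inv A"
proof -
  have A: "transpose A = A" using assms by (simp add: sym_pos_def_def)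
  have inv: "A ** matrix_inv A = mat 1"
    using sym_pos_def_invertible[OF assms] unfolding invertible_def matrix_inv_def by (rule someI2_ex) simp
  have "transpose (matrix_inv A) ** A = mat 1"
    using arg_cong[OF inv, of transpose] by (simp add: matrix_transpose_mul A transpose_mat)
  then have "transpose (matrix_inv A) ** (A ** matrix_inv A) = matrix_inv A"
    by (simp add: matrix_mul_assoc)
  then show ?thesis by (simp add: inv)
qed

lemma grad_matrix_affine:
  fixes g :: "real^'m::finite \<Rightarrow> real^'n::finite"
  assumes "\<forall>j. polynomial_degree_le_on UNIV 2 (\<lambda>x. g x $ j)"
  shows "\<exists>\<Gamma>. bounded_linear \<Gamma> \<and> (\<forall>x y. grad_matrix g (x + y) = grad_matrix g x + \<Gamma> y)" (is ?affine)
    and "GDERIV (\<lambda>y. g y $ j) x :> column j (grad_matrix g x)"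
proof -
  have "\<forall>j. \<exists>b L. bounded_linear L \<and> (\<forall>x. GDERIV (\<lambda>x. g x $ j) x :> (b + L x))"
    using quadratic_gradient_affine assms by blast
  then obtain b L where L: "\<And>j. bounded_linear (L j)"
    "\<And>j x. GDERIV (\<lambda>x. g x $ j) x :> (b j + L j x)" by metis
  have gm: "grad_matrix g x = (\<chi> i j. (b j + L j x) $ i)" for x
    by (simp add: grad_matrix_def grad_eqI[OF L(2)])
  have "bounded_linear (\<lambda>y. \<chi> i j. L j y $ i)"
    unfolding linear_conv_bounded_linear[symmetric]
    using bounded_linear.linear[OF L(1)]
    by (intro linearI) (simp_all add: vec_eq_iff linear_add linear_cmul)
  moreover have "grad_matrix g (x + y) = grad_matrix g x + (\<chi> i j. L j y $ i)" for x y
    using bounded_linear.linear[OF L(1)] by (simp add: gm vec_eq_iff linear_add)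
  ultimately show ?affine by blast
  have "column j (grad_matrix g x) = b j + L j x" by (simp add: gm column_def vec_eq_iff)
  then show "GDERIV (\<lambda>y. g y $ j) x :> column j (grad_matrix g x)" using L(2) by simp
qed

lemma GDERIV_compose_curve:
  assumes "GDERIV f (w t) :> d" "(w has_vector_derivative w') (at t within S)"
  shows "((\<lambda>t. f (w t)) has_vector_derivative (d \<bullet> w')) (at t within S)"
proof -
  have "((\<lambda>t. f (w t)) has_derivative (\<lambda>h. (h *\<^sub>R w') \<bullet> d)) (at t within S)"
    using assms has_derivative_compose[of w "\<lambda>h. h *\<^sub>R w'" t S f "\<lambda>h. h \<bullet> d"]
    by (simp add: gderiv_def has_vector_derivative_def)
  then show ?thesis by (simp add: has_vector_derivative_def inner_commute)
qed

lemma transpose_vector_mult_nth: "(transpose A *v x) $ j = column j A \<bullet> x"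
  by (simp add: matrix_vector_mult_def transpose_def column_def inner_vec_def)

lemma constraint_derivative:
  fixes g :: "real^'m::finite \<Rightarrow> real^'n::finite"
  assumes "\<forall>j. polynomial_degree_le_on UNIV 2 (\<lambda>x. g x $ j)"
    "(w has_vector_derivative w') (at t within S)"
  shows "((\<lambda>t. g (w t) $ j) has_vector_derivative (transpose (grad_matrix g (w t)) *v w') $ j) (at t within S)"
  unfolding transpose_vector_mult_nth
  by (rule GDERIV_compose_curve[OF grad_matrix_affine(2)[OF assms(1)] assms(2)])

lemma real_analytic_on_GDERIV:
  assumes "real_analytic_on U D" "x \<in> D"
  shows "GDERIV U x :> grad U x"
proof -
  have "GDERIV U (x + 0) :> grad U (x + 0)"
    by (rule analytic_gradient_expansion[OF assms]) (metis norm_zero)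
  then show ?thesis by simp
qed

lemma has_vector_derivative_rescale:
  assumes "(f has_vector_derivative f') (at (c * h))"
  shows "((\<lambda>c. f (c * h)) has_vector_derivative h *\<^sub>R f') (at c)"
proof -
  have "((\<lambda>c. c * h) has_vector_derivative h) (at c)"
    by (auto intro!: derivative_eq_intros simp: has_real_derivative_iff_has_vector_derivative[symmetric])
  from vector_diff_chain_at[OF this assms] show ?thesis by (simp add: comp_def)
qed

lemma polynomial_degree_le_on_curve:
  fixes w :: "real \<Rightarrow> real^'m::finite"
  assumes "polynomial_degree_le_on D \<mu> f" "poly_fun s w" "s * \<mu> \<le> N"
  obtains Q where "poly_fun N Q" "\<And>c. w c \<in> D \<Longrightarrow> f (w c) = Q c"
proof -
  obtain a where a: "\<And>x. x \<in> D \<Longrightarrow> f x = (\<Sum>\<alpha> | sum \<alpha> UNIV \<le> \<mu>. a \<alpha> * monomial_at \<alpha> x)"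
    using assms(1) unfolding polynomial_degree_le_on_def by auto
  have pow: "poly_fun (s * n) (\<lambda>c. (w c $ i) ^ n)" for i n
  proof (induction n)
    case (Suc n)
    from poly_fun_bilinear[OF bounded_bilinear_mult poly_fun_bounded_linear[OF bounded_linear_vec_nth assms(2)] Suc]
    show ?case by simp
  qed (simp add: poly_fun_const)
  have "poly_fun (s * sum \<alpha> I) (\<lambda>c. \<Prod>i\<in>I. (w c $ i) ^ \<alpha> i)" if "finite I" for I \<alpha>
    using that
  proof (induction I)
    case (insert i I)
    then show ?case using poly_fun_bilinear[OF bounded_bilinear_mult pow insert.IH] by (simp add: distrib_left)
  qed (simp add: poly_fun_const)
  then have mono: "poly_fun (s * sum \<alpha> UNIV) (\<lambda>c. monomial_at \<alpha> (w c))" for \<alpha>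
    unfolding monomial_at_def by simp
  have "poly_fun N (\<lambda>c. \<Sum>\<alpha> | sum \<alpha> UNIV \<le> \<mu>. a \<alpha> *\<^sub>R monomial_at \<alpha> (w c))"
  proof (intro poly_fun_sum poly_fun_scaleR poly_fun_mono[OF mono])
    fix \<alpha> :: "'m \<Rightarrow> nat" assume "\<alpha> \<in> {\<alpha>. sum \<alpha> UNIV \<le> \<mu>}"
    then have "s * sum \<alpha> UNIV \<le> s * \<mu>" by simp
    then show "s * sum \<alpha> UNIV \<le> N" using assms(3) by linarith
  qed
  then show ?thesis using a by (intro that) auto
qed

text \<open>
  A single step with \<open>h\<close> fixed. The curves \<open>q\<close> and \<open>p\<close> are \<open>u\<close> and \<open>v\<close> in the rescaled time
  \<open>c \<in> [0, 1]\<close>.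
\<close>

locale gauss_step =
  fixes M :: "real^'m::finite^'m" and U :: "real^'m \<Rightarrow> real" and D :: "(real^'m) set"
    and g :: "real^'m \<Rightarrow> real^'n::finite" and s k :: nat and h :: real
    and q0 p0 :: "real^'m" and u v :: "real \<Rightarrow> real^'m" and l :: "nat \<Rightarrow> real^'n"
  assumes M: "sym_pos_def M"
    and U: "real_analytic_on U D"
    and g: "\<forall>j. polynomial_degree_le_on UNIV 2 (\<lambda>x. g x $ j)"
    and sk: "1 \<le> s" "s \<le> k"
    and step: "procedure_step M U D g s k h q0 p0 u v l"
begin

abbreviation "K \<equiv> matrix_inv M"

definition "q c = u (c * h)"
definition "p c = v (c * h)"
text \<open>
  The vectors \<open>l i\<close> become the values at the Gauss nodes of one polynomial, so that the constraint
  force can be written as an interpolation polynomial.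
\<close>

definition "multiplier = gauss_interp s (\<lambda>x. l (inv_into {1..s} (gauss_node s) x))"
definition "force c = (\<Sum>j<s. poly (legendre01 j) c *\<^sub>R psi_hat U k h j u)"

lemma multiplier_node: "i \<in> {1..s} \<Longrightarrow> multiplier (gauss_node s i) = l i"
  unfolding multiplier_def by (simp only: gauss_interp_node inv_into_f_f[OF gauss_node_inj])

lemma initial: "q 0 = q0" "p 0 = p0"
  using step by (simp_all add: procedure_step_def q_def p_def)

lemma poly_fun_q: "poly_fun s q" and poly_fun_p: "poly_fun s p"
  using step unfolding procedure_step_def polynomial_curve_eq_poly_fun q_def[abs_def] p_def[abs_def]
  by (auto intro: poly_fun_rescale)

lemma q_in: "c \<in> {0..1} \<Longrightarrow> q c \<in> D"
  using step by (simp add: procedure_step_def q_def)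

lemma q_deriv:
  assumes "c \<in> {0..1}"
  shows "(q has_vector_derivative h *\<^sub>R (K *v gauss_interp s p c)) (at c)"
proof -
  have "(\<Sum>j<s. poly (legendre01 j) c *\<^sub>R gamma_coeff h j v) = gauss_interp s p c"
    unfolding gamma_coeff_def using legendre_projection_eq_gauss_interp[OF poly_fun_p] by (simp add: p_def)
  moreover have "(u has_vector_derivative
      (K *v (\<Sum>j<s. poly (legendre01 j) c *\<^sub>R gamma_coeff h j v))) (at (c * h))"
    using step assms unfolding procedure_step_def by blast
  ultimately have "(u has_vector_derivative K *v gauss_interp s p c) (at (c * h))" by (simp only:)
  then show ?thesis unfolding q_def[abs_def] by (rule has_vector_derivative_rescale)
qed

lemma p_deriv:
  assumes "c \<in> {0..1}"
  shows "(p has_vector_derivative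
    h *\<^sub>R (force c - gauss_interp s (\<lambda>c. grad_matrix g (q c) *v multiplier c) c)) (at c)"
proof -
  have "gauss_interp s (\<lambda>c. grad_matrix g (q c) *v multiplier c) c =
    (\<Sum>j=1..s. gauss_lagrange s j c *\<^sub>R (grad_matrix g (u (gauss_node s j * h)) *v l j))"
    unfolding gauss_interp_def[of s "\<lambda>c. grad_matrix g (q c) *v multiplier c"]
    by (intro sum.cong refl) (simp add: q_def multiplier_node)
  moreover have "(v has_vector_derivative
      (force c - (\<Sum>j=1..s. gauss_lagrange s j c *\<^sub>R (grad_matrix g (u (gauss_node s j * h)) *v l j)))) (at (c * h))"
    using step assms unfolding procedure_step_def force_def by blast
  ultimately have "(v has_vector_derivative
    force c - gauss_interp s (\<lambda>c. grad_matrix g (q c) *v multiplier c) c) (at (c * h))"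
    by (simp only:)
  then show ?thesis unfolding p_def[abs_def] by (rule has_vector_derivative_rescale)
qed

lemma hidden_node: "i \<in> {1..s} \<Longrightarrow> hidden_constraint M g (q (gauss_node s i)) (p (gauss_node s i)) = 0"
  using step by (simp add: procedure_step_def q_def p_def)

lemma poly_fun_grad_matrix: "poly_fun s (\<lambda>c. grad_matrix g (q c))"
proof -
  obtain \<Gamma> where \<Gamma>: "bounded_linear \<Gamma>" "\<And>x y. grad_matrix g (x + y) = grad_matrix g x + \<Gamma> y"
    using grad_matrix_affine(1)[OF g] by blast
  have "grad_matrix g (q c) = grad_matrix g 0 + \<Gamma> (q c)" for c using \<Gamma>(2)[of 0 "q c"] by simp
  then show ?thesis
    by (simp add: poly_fun_add poly_fun_const poly_fun_bounded_linear[OF \<Gamma>(1) poly_fun_q])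
qed

lemma poly_fun_K: "poly_fun d f \<Longrightarrow> poly_fun d (\<lambda>c. K *v f c)"
  by (rule poly_fun_bounded_linear[OF bounded_bilinear.bounded_linear_right[OF bounded_bilinear_matrix_vector_mult]])

text \<open>
  The derivative of \<open>g (q c)\<close> is the product of the Jacobian, of degree at most \<open>s\<close> because \<open>g\<close> is
  quadratic, and a velocity of degree at most \<open>s - 1\<close>. At the Gauss nodes the momentum in the velocity
  is not changed by the interpolation, and the product is \<open>h\<close> times the hidden constraint. The
  \<open>s\<close>-point rule is exact for the product and yields zero.
\<close>

lemma constraint_preserved:
  assumes "g q0 = 0"
  shows "g (u h) = 0"
proof -
  have "g (q 1) $ j = 0" for j
  proof -
    define F where "F c = (transpose (grad_matrix g (q c)) *v (h *\<^sub>R (K *v gauss_interp s p c))) $ j" for c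
    have "(F has_integral (g (q 1) $ j - g (q 0) $ j)) {0..1}"
      unfolding F_def
      by (rule fundamental_theorem_of_calculus)
         (simp, rule constraint_derivative[OF g], rule has_vector_derivative_at_within, erule q_deriv)
    moreover have "poly_fun (s + (s - 1)) F"
      unfolding F_def
      by (intro poly_fun_bounded_linear[OF bounded_linear_vec_nth]
          poly_fun_bilinear[OF bounded_bilinear_matrix_vector_mult]
          poly_fun_bounded_linear[OF bounded_linear_transpose] poly_fun_grad_matrix
          poly_fun_scaleR poly_fun_K poly_fun_gauss_interp)
    then have "(F has_integral (\<Sum>i=1..s. gauss_weight s i *\<^sub>R F (gauss_node s i))) {0..1}"
      using sk by (intro gauss_quadrature) auto
    moreover have "(\<Sum>i=1..s. gauss_weight s i *\<^sub>R F (gauss_node s i)) = 0"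
    proof (intro sum.neutral ballI)
      fix i assume i: "i \<in> {1..s}"
      have "F (gauss_node s i) = 0"
        using hidden_node[OF i] i
        by (simp add: F_def hidden_constraint_def gauss_interp_node matrix_vector_mult_scaleR)
      then show "gauss_weight s i *\<^sub>R F (gauss_node s i) = 0" by simp
    qed
        ultimately have "g (q 1) $ j - g (q 0) $ j = 0"
      by (simp only: has_integral_unique)
    then show ?thesis using assms by (simp add: initial)
  qed
  then show ?thesis by (simp add: vec_eq_iff q_def)
qed

text \<open>
  The power of the potential force, \<open>\<nabla>U(q) \<bullet> q'\<close> in rescaled time.
\<close>

definition "work_rate c = grad U (q c) \<bullet> (h *\<^sub>R (K *v gauss_interp s p c))"

lemma potential_deriv:
  assumes "c \<in> {0..1}"
  shows "((\<lambda>c. U (q c)) has_vector_derivative work_rate c) (at c)"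
  unfolding work_rate_def
  by (intro GDERIV_compose_curve real_analytic_on_GDERIV[OF U] q_deriv q_in assms)

lemma work_rate_has_integral: "(work_rate has_integral (U (q 1) - U q0)) {0..1}"
proof -
  have "(work_rate has_integral (U (q 1) - U (q 0))) {0..1}"
    by (rule fundamental_theorem_of_calculus)
       (simp, rule has_vector_derivative_at_within, erule potential_deriv)
  then show ?thesis by (simp add: initial)
qed

lemma inner_K_commute: "x \<bullet> (K *v y) = (K *v x) \<bullet> y"
  using inner_matrix_transpose[of K x y] sym_pos_def_transpose_inv[OF M] by simp

lemma poly_fun_force: "poly_fun (s - 1) force"
  unfolding force_def by (intro poly_fun_sum poly_fun_poly) auto

text \<open>
  The rate of change of the kinetic energy is \<open>p' \<bullet> K p\<close> of degree at most \<open>2 s - 1\<close>, so its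
  integral may be computed from the Gauss nodes. There the constraint force is orthogonal to \<open>K p\<close> by the hidden constraint. What
  remains pairs \<open>psi_hat\<close> with the Legendre coefficients of \<open>p\<close>. Exchanging the sum over the Legendre
  index with the sum over the \<open>k\<close> quadrature nodes reassembles the velocity at these nodes: the
  work of the potential force computed by the \<open>k\<close>-point rule.
\<close>

lemma kinetic_energy_change:
  "1 / 2 * (p 1 \<bullet> (K *v p 1)) - 1 / 2 * (p0 \<bullet> (K *v p0))
     = (\<Sum>i=1..k. gauss_weight k i * work_rate (gauss_node k i))"
proof -
  define X where "X c = force c - gauss_interp s (\<lambda>c. grad_matrix g (q c) *v multiplier c) c" for c
  have "((\<lambda>c. 1 / 2 * (p c \<bullet> (K *v p c))) has_vector_derivative h * (X c \<bullet> (K *v p c))) (at c)"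
    if "c \<in> {0..1}" for c
  proof -
    have pd: "(p has_vector_derivative h *\<^sub>R X c) (at c)" using p_deriv[OF that] by (simp add: X_def)
    have "((\<lambda>c. K *v p c) has_vector_derivative K *v (h *\<^sub>R X c)) (at c)"
      by (rule bounded_linear.has_vector_derivative[OF
            bounded_bilinear.bounded_linear_right[OF bounded_bilinear_matrix_vector_mult] pd])
    from bounded_bilinear.has_vector_derivative[OF bounded_bilinear_inner pd this]
    have "((\<lambda>c. p c \<bullet> (K *v p c)) has_vector_derivative
       (p c \<bullet> (K *v (h *\<^sub>R X c)) + (h *\<^sub>R X c) \<bullet> (K *v p c))) (at c)" .
    moreover have "p c \<bullet> (K *v (h *\<^sub>R X c)) + (h *\<^sub>R X c) \<bullet> (K *v p c) = 2 * (h * (X c \<bullet> (K *v p c)))"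
      unfolding inner_K_commute[of "p c"] by (simp add: inner_commute)
    ultimately have "((\<lambda>c. p c \<bullet> (K *v p c)) has_vector_derivative 2 * (h * (X c \<bullet> (K *v p c)))) (at c)"
      by simp
    from bounded_linear.has_vector_derivative[OF bounded_linear_mult_right[of "1/2"] this]
    show ?thesis by simp
  qed
  then have "((\<lambda>c. h * (X c \<bullet> (K *v p c))) has_integral
      (1 / 2 * (p 1 \<bullet> (K *v p 1)) - 1 / 2 * (p 0 \<bullet> (K *v p 0)))) {0..1}"
    by (intro fundamental_theorem_of_calculus) (auto intro: has_vector_derivative_at_within)
  moreover have quad: "((\<lambda>c. Y c \<bullet> (K *v p c)) has_integral
      (\<Sum>i=1..s. gauss_weight s i *\<^sub>R (Y (gauss_node s i) \<bullet> (K *v p (gauss_node s i))))) {0..1}"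
    if "poly_fun (s - 1) Y" for Y
    using sk by (intro gauss_quadrature[of "(s - 1) + s"]
        poly_fun_bilinear[OF bounded_bilinear_inner] that poly_fun_K poly_fun_p) auto
  have "poly_fun (s - 1) X"
    unfolding X_def by (intro poly_fun_diff poly_fun_force poly_fun_gauss_interp)
  from has_integral_mult_right[OF quad[OF this], of h]
  have "((\<lambda>c. h * (X c \<bullet> (K *v p c))) has_integral
      h * (\<Sum>i=1..s. gauss_weight s i *\<^sub>R (X (gauss_node s i) \<bullet> (K *v p (gauss_node s i))))) {0..1}" .
  ultimately have "1 / 2 * (p 1 \<bullet> (K *v p 1)) - 1 / 2 * (p 0 \<bullet> (K *v p 0))
      = h * (\<Sum>i=1..s. gauss_weight s i *\<^sub>R (X (gauss_node s i) \<bullet> (K *v p (gauss_node s i))))"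
    by (rule has_integral_unique)
  also have "(\<Sum>i=1..s. gauss_weight s i *\<^sub>R (X (gauss_node s i) \<bullet> (K *v p (gauss_node s i))))
      = (\<Sum>i=1..s. gauss_weight s i *\<^sub>R (force (gauss_node s i) \<bullet> (K *v p (gauss_node s i))))"
  proof (intro sum.cong refl)
    fix i assume i: "i \<in> {1..s}"
    have "(grad_matrix g (q (gauss_node s i)) *v multiplier (gauss_node s i)) \<bullet> (K *v p (gauss_node s i)) = 0"
      using hidden_node[OF i] by (simp add: inner_matrix_transpose hidden_constraint_def)
    then show "gauss_weight s i *\<^sub>R (X (gauss_node s i) \<bullet> (K *v p (gauss_node s i)))
        = gauss_weight s i *\<^sub>R (force (gauss_node s i) \<bullet> (K *v p (gauss_node s i)))"
      using i by (simp add: X_def gauss_interp_node inner_diff_left)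
  qed
  also have "\<dots> = integral {0..1} (\<lambda>c. force c \<bullet> (K *v p c))"
    using quad[OF poly_fun_force] by (simp add: integral_unique)
  also have "\<dots> = integral {0..1} (\<lambda>c. \<Sum>j<s. psi_hat U k h j u \<bullet> (K *v (poly (legendre01 j) c *\<^sub>R p c)))"
    by (intro integral_cong) (simp add: force_def inner_sum_left matrix_vector_mult_scaleR)
  also have "\<dots> = (\<Sum>j<s. psi_hat U k h j u \<bullet> (K *v gamma_coeff h j v))"
  proof (intro integral_unique has_integral_sum)
    fix j
    have "(\<lambda>c. poly (legendre01 j) c *\<^sub>R p c) integrable_on {0..1}"
      by (intro integrable_continuous_interval continuous_intros poly_fun_continuous[OF poly_fun_p])
    then have "((\<lambda>c. poly (legendre01 j) c *\<^sub>R p c) has_integral gamma_coeff h j v) {0..1}"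
      unfolding gamma_coeff_def p_def by (rule integrable_integral)
    then show "((\<lambda>c. psi_hat U k h j u \<bullet> (K *v (poly (legendre01 j) c *\<^sub>R p c))) has_integral
        psi_hat U k h j u \<bullet> (K *v gamma_coeff h j v)) {0..1}"
      by (rule has_integral_linear[OF _ bounded_linear_compose[OF bounded_linear_inner_right
            bounded_bilinear.bounded_linear_right[OF bounded_bilinear_matrix_vector_mult]], unfolded comp_def])
  qed simp
  also have "\<dots> = (\<Sum>i=1..k. gauss_weight k i * (grad U (q (gauss_node k i)) \<bullet>
      (K *v (\<Sum>j<s. poly (legendre01 j) (gauss_node k i) *\<^sub>R gamma_coeff h j v))))"
    unfolding psi_hat_def inner_sum_left linear_sum[OF matrix_vector_mul_linear] inner_sum_right sum_distrib_left
    by (subst sum.swap) (simp add: q_def matrix_vector_mult_scaleR mult_ac)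
  also have "\<dots> = (\<Sum>i=1..k. gauss_weight k i * (grad U (q (gauss_node k i)) \<bullet> (K *v gauss_interp s p (gauss_node k i))))"
    unfolding gamma_coeff_def using legendre_projection_eq_gauss_interp[OF poly_fun_p] by (simp add: p_def)
  finally show ?thesis
    by (simp add: work_rate_def sum_distrib_left mult_ac initial)
qed

lemma energy_change:
  "hamiltonian M U (u h) (v h) - hamiltonian M U q0 p0
    = (\<Sum>i=1..k. gauss_weight k i * work_rate (gauss_node k i)) - integral {0..1} work_rate"
  using kinetic_energy_change integral_unique[OF work_rate_has_integral]
  by (simp add: hamiltonian_def q_def p_def)

text \<open>
  Here \<open>U (q c)\<close> is a polynomial \<open>Q\<close> of degree at most \<open>s \<mu> \<le> 2 k\<close>, whose derivative is integrated
  exactly. Since \<open>Q\<close> agrees with \<open>U (q c)\<close> on \<open>[0, 1]\<close> only, the derivatives are compared at interior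
  points, which include the quadrature nodes.
\<close>

lemma energy_preserved:
  assumes "polynomial_degree_le_on D \<mu> U" "s * \<mu> \<le> 2 * k"
  shows "hamiltonian M U (u h) (v h) = hamiltonian M U q0 p0"
proof -
  obtain Q where Q: "poly_fun (2 * k) Q" "\<And>c. q c \<in> D \<Longrightarrow> U (q c) = Q c"
    using polynomial_degree_le_on_curve[OF assms(1) poly_fun_q assms(2)] by blast
  obtain Q' where Q': "poly_fun (2 * k - 1) Q'" "\<And>c. (Q has_vector_derivative Q' c) (at c)"
    using poly_fun_derivative[OF Q(1)] by blast
  have "Q' c = work_rate c" if c: "c \<in> {0<..<1}" for c
  proof (rule vector_derivative_unique_at[OF Q'(2)])
    have "((\<lambda>c. U (q c)) has_vector_derivative work_rate c) (at c)"
      using potential_deriv c by simp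
    then show "(Q has_vector_derivative work_rate c) (at c)"
      by (rule has_vector_derivative_transform_within_open[of _ _ _ "{0<..<1}"])
         (use c Q(2) q_in in auto)
  qed
  then have "(\<Sum>i=1..k. gauss_weight k i * work_rate (gauss_node k i)) = (\<Sum>i=1..k. gauss_weight k i *\<^sub>R Q' (gauss_node k i))"
    using gauss_node_in by (intro sum.cong) auto
  also have "\<dots> = Q 1 - Q 0"
  proof (rule has_integral_unique)
    show "(Q' has_integral (\<Sum>i=1..k. gauss_weight k i *\<^sub>R Q' (gauss_node k i))) {0..1}"
      using sk by (intro gauss_quadrature[OF Q'(1)]) auto
    show "(Q' has_integral (Q 1 - Q 0)) {0..1}"
      by (rule fundamental_theorem_of_calculus) (auto intro: has_vector_derivative_at_within Q'(2))
  qed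
  also have "\<dots> = integral {0..1} work_rate"
    using Q(2) q_in integral_unique[OF work_rate_has_integral] by (simp flip: initial)
  finally show ?thesis using energy_change by simp
qed

end

section \<open>Smoothness of the numerical solution in the step size\<close>

text \<open>
  A polynomial of degree \<open>s\<close> is controlled by its values at \<open>0\<close> and at the \<open>s\<close> Gauss nodes:
  \<open>(P c - P 0) / c\<close> is a polynomial of degree \<open>s - 1\<close> and equals its own interpolation polynomial.
\<close>

lemma big_O_unif_from_nodes:
  fixes P :: "real \<Rightarrow> real \<Rightarrow> 'a::real_normed_vector"
  assumes s: "1 \<le> s" and P: "\<And>h. poly_fun s (P h)" and P0: "big_O_unif r (\<lambda>h c. P h 0)"
    and Pi: "\<And>i. i \<in> {1..s} \<Longrightarrow> big_O_unif r (\<lambda>h c. P h (gauss_node s i))"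
  shows "big_O_unif r P"
proof -
  have "\<exists>Q. poly_fun (s - 1) Q \<and> (\<forall>c. P h c = P h 0 + c *\<^sub>R Q c)" for h
  proof -
    obtain a where a: "\<And>c. P h c = (\<Sum>i\<le>s. c ^ i *\<^sub>R a i)"
      using P unfolding poly_fun_def by metis
    obtain n where n: "s = Suc n" using s by (cases s) auto
    have "P h c = P h 0 + c *\<^sub>R (\<Sum>i\<le>n. c ^ i *\<^sub>R a (Suc i))" for c
      unfolding a n sum.atMost_Suc_shift by (simp add: scaleR_sum_right)
    moreover have "poly_fun (s - 1) (\<lambda>c. \<Sum>i\<le>n. c ^ i *\<^sub>R a (Suc i))"
      unfolding n by (intro poly_fun_sum poly_fun_monom) auto
    ultimately show ?thesis by blast
  qed
  then obtain Q where Q: "\<And>h. poly_fun (s - 1) (Q h)" "\<And>h c. P h c = P h 0 + c *\<^sub>R Q h c"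
    by metis
  have "big_O_unif r (\<lambda>h c. (1 / gauss_node s i) *\<^sub>R (P h (gauss_node s i) - P h 0))" if "i \<in> {1..s}" for i
    by (intro big_O_unif_scale big_O_unif_diff Pi P0 that)
  moreover have "(1 / gauss_node s i) *\<^sub>R (P h (gauss_node s i) - P h 0) = Q h (gauss_node s i)" if "i \<in> {1..s}" for h i
    using gauss_node_in[OF that] Q(2)[of h "gauss_node s i"] by simp
  ultimately have Qi: "big_O_unif r (\<lambda>h c. Q h (gauss_node s i))" if "i \<in> {1..s}" for i
    using that by simp
  have "big_O_unif (0 + r) (\<lambda>h c. \<Sum>j=1..s. gauss_lagrange s j c *\<^sub>R Q h (gauss_node s j))"
    unfolding gauss_lagrange_eq_poly
    by (intro big_O_unif_sum big_O_unif_bilinear[OF bounded_bilinear_scaleR] big_O_unif_of_c continuous_intros Qi)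
  moreover have "(\<Sum>j=1..s. gauss_lagrange s j c *\<^sub>R Q h (gauss_node s j)) = Q h c" for h c
    using s by (intro lagrange_interpolation[OF Q(1)]) auto
  ultimately have "big_O_unif r Q" by simp
  then have "big_O_unif (0 + r) (\<lambda>h c. c *\<^sub>R Q h c)"
    by (intro big_O_unif_bilinear[OF bounded_bilinear_scaleR] big_O_unif_of_c continuous_intros)
  from big_O_unif_add[OF P0, of "\<lambda>h c. c *\<^sub>R Q h c"] this
  show ?thesis by (simp flip: Q(2))
qed

text \<open>
  If \<open>r\<close> is at least the degree, then every coefficient of \<open>c\<^sup>m\<close> is already \<open>O(h\<^sup>m)\<close>, and the
  polynomial in \<open>c\<close> is a polynomial in \<open>h c\<close> with bounded coefficients.
\<close>

lemma h_jet_polynomial_all_orders: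
  assumes "\<And>h. poly_fun d (f h)" "h_jet r f" "d \<le> r" "r \<le> Suc d"
  shows "h_jet R f"
proof -
  obtain A where A: "\<And>m. big_O_unif (min m r) (\<lambda>h c. A m h)"
    "\<And>h c. f h c = (\<Sum>m\<le>d. c ^ m *\<^sub>R A m h)"
    using h_jet_poly_coefficients[OF assms(1,2,4)] by blast
  have "h_jet R (\<lambda>h c. \<Sum>m\<le>d. c ^ m *\<^sub>R A m h)"
    using assms(3) by (intro h_jet_of_coefficients big_O_unif_mono[OF A(1)]) auto
  then show ?thesis by (simp flip: A(2))
qed

lemma gauss_interp_cong:
  "(\<And>i. i \<in> {1..s} \<Longrightarrow> f (gauss_node s i) = f' (gauss_node s i)) \<Longrightarrow> gauss_interp s f = gauss_interp s f'"
  unfolding gauss_interp_def by auto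

lemma gauss_interp_diff: "gauss_interp s (\<lambda>c. f c - f' c) c = gauss_interp s f c - gauss_interp s f' c"
  by (simp add: gauss_interp_def scaleR_diff_right sum_subtractf)

lemma gauss_interp_idem: "gauss_interp s (gauss_interp s f) = gauss_interp s f"
  by (rule gauss_interp_cong) (rule gauss_interp_node)

lemma gauss_interp_bounded_linear:
  "bounded_linear F \<Longrightarrow> gauss_interp s (\<lambda>c. F (f c)) c = F (gauss_interp s f c)"
  by (simp add: gauss_interp_def linear_sum linear_cmul bounded_linear.linear)

text \<open>
  The sum of a polynomial of degree \<open>s\<close> and of an expansion of order \<open>r + 1 \<le> s + 1\<close> is a polynomial of
  degree at most \<open>s\<close> up to \<open>O(h\<^bsup>r + 1\<^esup>)\<close>. If the sum vanishes at \<open>s + 1\<close> points, then the polynomial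
  is \<open>O(h\<^bsup>r + 1\<^esup>)\<close> at these points and therefore everywhere. This is where the iteration gains
  information: the order \<open>r + 1\<close> of the second summand becomes the order of the whole sum.
\<close>

lemma big_O_unif_vanishing_at_nodes:
  fixes N A Z :: "real \<Rightarrow> real \<Rightarrow> 'a::real_normed_vector"
  assumes s: "1 \<le> s" "r \<le> s" and A: "\<And>h. poly_fun s (A h)" and Z: "h_jet (Suc r) Z"
    and N: "\<forall>\<^sub>F h in at_right 0. \<forall>c\<in>{0..1}. N h c = A h c + Z h c"
    and N0: "\<forall>\<^sub>F h in at_right 0. N h 0 = 0"
    and Ni: "\<forall>\<^sub>F h in at_right 0. \<forall>i\<in>{1..s}. N h (gauss_node s i) = 0"
  shows "big_O_unif (Suc r) N"
proof -
  obtain a where a: "\<And>m. big_O_unif 0 (\<lambda>h c. a m h)"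
    "big_O_unif (Suc r) (\<lambda>h c. Z h c - (\<Sum>m<Suc r. (h * c) ^ m *\<^sub>R a m h))"
    using Z unfolding h_jet_def by blast
  define R where "R h c = Z h c - (\<Sum>m<Suc r. (h * c) ^ m *\<^sub>R a m h)" for h c
  define P where "P h c = A h c + (\<Sum>m<Suc r. c ^ m *\<^sub>R (h ^ m *\<^sub>R a m h))" for h c
  have R: "big_O_unif (Suc r) R" unfolding R_def[abs_def] by (rule a(2))
  have NPR: "\<forall>\<^sub>F h in at_right 0. \<forall>c\<in>{0..1}. N h c = P h c + R h c"
    by (rule eventually_mono[OF N]) (auto simp: P_def R_def power_mult_distrib mult.commute)
  have at_zero: "big_O_unif (Suc r) (\<lambda>h c. P h x)" if x: "x \<in> {0..1}" "\<forall>\<^sub>F h in at_right 0. N h x = 0" for x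
  proof (rule big_O_unif_cong[OF big_O_unif_minus[OF big_O_unif_node[OF R x(1)]]])
    show "\<forall>\<^sub>F h in at_right 0. \<forall>c\<in>{0..1::real}. - R h x = P h x"
      using NPR x(2)
    proof eventually_elim
      case (elim h)
      then have "P h x + R h x = 0" using x(1) by metis
      then show ?case by (simp add: eq_neg_iff_add_eq_0 neg_eq_iff_add_eq_0 add.commute)
    qed
  qed
  have "big_O_unif (Suc r) P"
  proof (rule big_O_unif_from_nodes[OF s(1)])
    show "poly_fun s (P h)" for h
      unfolding P_def using s(2) by (intro poly_fun_add poly_fun_sum poly_fun_monom A) auto
    show "big_O_unif (Suc r) (\<lambda>h c. P h 0)" by (rule at_zero[OF _ N0]) simp
    fix i assume i: "i \<in> {1..s}"
    have "\<forall>\<^sub>F h in at_right 0. N h (gauss_node s i) = 0"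
      by (rule eventually_mono[OF Ni]) (use i in blast)
    then show "big_O_unif (Suc r) (\<lambda>h c. P h (gauss_node s i))"
      by (rule at_zero[OF gauss_node_in_closed[OF i]])
  qed
  from big_O_unif_add[OF this R] show ?thesis
    by (rule big_O_unif_cong, intro eventually_mono[OF NPR]) auto
qed

text \<open>
  Written as \<open>L = S\<^sup>-\<^sup>1 (W - h c A L)\<close> at the nodes, the system is a fixed-point equation in which the
  unknown on the right carries the factor \<open>h c\<close>. The equation shows that \<open>L\<close> is bounded for small \<open>h\<close>,
  and every further use of it gains one order, up to the order of the data.
\<close>

lemma h_jet_solve_perturbed_system:
  fixes S :: "real^'n::finite^'n" and A :: "real \<Rightarrow> real \<Rightarrow> real^'n^'n" and L W :: "real \<Rightarrow> real \<Rightarrow> real^'n"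
  assumes "invertible S" and A: "h_jet r A" and W: "h_jet r W" and r: "r \<le> s"
    and L: "\<And>h. gauss_interp s (L h) = L h"
    and system: "\<forall>\<^sub>F h in at_right 0. \<forall>i\<in>{1..s}.
      (S + (h * gauss_node s i) *\<^sub>R A h (gauss_node s i)) *v L h (gauss_node s i) = W h (gauss_node s i)"
  shows "h_jet r L"
proof -
  note mult_linear = bounded_bilinear.bounded_linear_right[OF bounded_bilinear_matrix_vector_mult]
  obtain T where T: "T ** S = mat 1" using assms(1) unfolding invertible_def by blast
  define Z where "Z h c = A h c *v L h c" for h c
  have L_node: "\<forall>\<^sub>F h in at_right 0. \<forall>i\<in>{1..s}. L h (gauss_node s i) =
      T *v (W h (gauss_node s i) - (h * gauss_node s i) *\<^sub>R Z h (gauss_node s i))"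
    using system
  proof eventually_elim
    case (elim h)
    show ?case
    proof
      fix i assume i: "i \<in> {1..s}"
      let ?x = "gauss_node s i"
      have "S *v L h ?x + (h * ?x) *\<^sub>R Z h ?x = W h ?x"
        using bspec[OF elim i]
        by (simp add: Z_def matrix_vector_mult_add_rdistrib scaleR_matrix_vector_assoc)
      then have "S *v L h ?x = W h ?x - (h * ?x) *\<^sub>R Z h ?x" by (simp add: algebra_simps)
      from arg_cong[OF this, of "\<lambda>y. T *v y"]
      show "L h ?x = T *v (W h ?x - (h * ?x) *\<^sub>R Z h ?x)"
        by (simp add: matrix_vector_mul_assoc T)
    qed
  qed
  have L_eq: "\<forall>\<^sub>F h in at_right 0. \<forall>c\<in>{0..1}.
      T *v (gauss_interp s (W h) c - gauss_interp s (\<lambda>c. (h * c) *\<^sub>R Z h c) c) = L h c"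
    using L_node
  proof eventually_elim
    case (elim h)
    have "gauss_interp s (L h) = gauss_interp s (\<lambda>c. T *v (W h c - (h * c) *\<^sub>R Z h c))"
      using elim by (intro gauss_interp_cong) auto
    then have "L h c = T *v (gauss_interp s (W h) c - gauss_interp s (\<lambda>c. (h * c) *\<^sub>R Z h c) c)" for c
      by (simp add: L gauss_interp_bounded_linear[OF mult_linear] gauss_interp_diff)
    then show ?case by simp
  qed
  have "big_O_unif 0 (\<lambda>h c. L h (gauss_node s i))" if i: "i \<in> {1..s}" for i
  proof -
    let ?x = "gauss_node s i"
    have x: "?x \<in> {0..1}" by (rule gauss_node_in_closed[OF i])
    obtain K1 where K1: "K1 > 0" "\<And>(B::real^'n^'n) z. norm (B *v z) \<le> norm B * norm z * K1"
      using bounded_bilinear.pos_bounded[OF bounded_bilinear_matrix_vector_mult[where 'n = 'n and 'm = 'n]] by blast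
    obtain K2 where K2: "K2 > 0" "\<And>z. norm (T *v z) \<le> norm z * K2"
      using bounded_linear.pos_bounded[OF mult_linear[of T]] by blast
    obtain CA where CA: "CA > 0" "\<forall>\<^sub>F h in at_right 0. 0 < h \<and> h < 1 \<and> (\<forall>c\<in>{0..1}. norm (A h c) \<le> CA * h ^ 0)"
      by (rule big_O_unifE[OF h_jet_bounded[OF A]])
    obtain CW where CW: "CW > 0" "\<forall>\<^sub>F h in at_right 0. 0 < h \<and> h < 1 \<and> (\<forall>c\<in>{0..1}. norm (W h c) \<le> CW * h ^ 0)"
      by (rule big_O_unifE[OF h_jet_bounded[OF W]])
    have pos: "K2 * (CA * K1) > 0" using K1(1) K2(1) CA(1) by simp
    \<comment> \<open>For such \<open>h\<close> the perturbation contributes at most half of the norm of \<open>L\<close>.\<close>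
    have "\<forall>\<^sub>F h in at_right 0. h < 1 / (2 * (K2 * (CA * K1)))"
      using eventually_at_right_real[of 0 "1 / (2 * (K2 * (CA * K1)))"] pos by (auto elim: eventually_mono)
    with L_node CA(2) CW(2)
    have "\<forall>\<^sub>F h in at_right 0. norm (L h ?x) \<le> 2 * K2 * CW"
    proof eventually_elim
      case (elim h)
      have h: "h > 0" using elim by simp
      have A1: "norm (A h ?x) \<le> CA" and W1: "norm (W h ?x) \<le> CW" using elim x by auto
      have Z1: "norm (Z h ?x) \<le> CA * norm (L h ?x) * K1"
        unfolding Z_def using K1(1) A1 by (intro order_trans[OF K1(2)] mult_right_mono) auto
      have "norm ((h * ?x) *\<^sub>R Z h ?x) = (h * ?x) * norm (Z h ?x)" using h x by simp
      also have "\<dots> \<le> (h * 1) * (CA * norm (L h ?x) * K1)"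
        using h x Z1 by (intro mult_mono) auto
      finally have "norm (W h ?x - (h * ?x) *\<^sub>R Z h ?x) \<le> CW + h * (CA * norm (L h ?x) * K1)"
        using W1 norm_triangle_ineq4[of "W h ?x" "(h * ?x) *\<^sub>R Z h ?x"] by linarith
      then have "norm (T *v (W h ?x - (h * ?x) *\<^sub>R Z h ?x)) \<le> (CW + h * (CA * norm (L h ?x) * K1)) * K2"
        using K2(1) by (intro order_trans[OF K2(2)] mult_right_mono) auto
      then have "norm (L h ?x) \<le> (CW + h * (CA * norm (L h ?x) * K1)) * K2"
        by (simp only: bspec[OF elim(1) i, symmetric])
      also have "\<dots> = K2 * CW + (h * (K2 * (CA * K1))) * norm (L h ?x)" by (simp add: algebra_simps)
      also have "\<dots> \<le> K2 * CW + (1 / 2) * norm (L h ?x)"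
      proof -
        have "h * (K2 * (CA * K1)) \<le> 1 / 2" using elim pos by (simp add: field_simps)
        then have "(h * (K2 * (CA * K1))) * norm (L h ?x) \<le> (1 / 2) * norm (L h ?x)" by (rule mult_right_mono) simp
        then show ?thesis by simp
      qed
      finally show ?case by simp
    qed
    then show ?thesis by (intro big_O_unifI[of _ "2 * K2 * CW"]) (simp add: eventually_mono)
  qed
  then have "big_O_unif (0 + 0) (\<lambda>h c. \<Sum>j=1..s. gauss_lagrange s j c *\<^sub>R L h (gauss_node s j))"
    unfolding gauss_lagrange_eq_poly
    by (intro big_O_unif_sum big_O_unif_bilinear[OF bounded_bilinear_scaleR] big_O_unif_of_c continuous_intros)
  moreover have "(\<Sum>j=1..s. gauss_lagrange s j c *\<^sub>R L h (gauss_node s j)) = L h c" for h c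
    using fun_cong[OF L[of h], of c] by (simp add: gauss_interp_def)
  ultimately have bounded: "big_O_unif 0 L" by simp
  have "h_jet r' L" if "r' \<le> r" for r'
    using that
  proof (induction r')
    case 0
    then show ?case using bounded by (simp add: h_jet_0_iff)
  next
    case (Suc r')
    then have "h_jet r' Z"
      unfolding Z_def by (intro h_jet_bilinear[OF bounded_bilinear_matrix_vector_mult] h_jet_mono[OF A]) auto
    then have 1: "h_jet (Suc r') (\<lambda>h. gauss_interp s (\<lambda>c. (h * c) *\<^sub>R Z h c))"
      using Suc.prems r by (intro h_jet_gauss_interp h_jet_shift) auto
    have 2: "h_jet (Suc r') (\<lambda>h. gauss_interp s (W h))"
      using Suc.prems r by (intro h_jet_gauss_interp h_jet_mono[OF W]) auto
    show ?case
      by (rule h_jet_cong[OF h_jet_bounded_linear[OF mult_linear h_jet_diff[OF 2 1]] L_eq])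
  qed
  then show ?thesis by simp
qed

lemma bounded_bilinear_matrix_mult:
  "bounded_bilinear (\<lambda>(A :: real^'n::finite^'m::finite) (B :: real^'l::finite^'n). A ** B)"
proof -
  have "bilinear (\<lambda>(A :: real^'n^'m) (B :: real^'l^'n). A ** B)"
    unfolding bilinear_def
    by (auto intro!: linearI simp: matrix_matrix_mult_def vec_eq_iff sum.distrib
        distrib_left distrib_right sum_distrib_left mult_ac)
  then show ?thesis by (simp add: bilinear_conv_bounded_bilinear)
qed

text \<open>
  A family of steps from the same initial values, indexed by the step size, in rescaled time. The
  equations are to hold for small \<open>h\<close>, polynomiality for every \<open>h\<close>; a family given for small \<open>h\<close> can be
  extended by zero.
\<close>

locale gauss_step_family =
  fixes M :: "real^'m::finite^'m" and U :: "real^'m \<Rightarrow> real" and D :: "(real^'m) set"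
    and g :: "real^'m \<Rightarrow> real^'n::finite" and s k :: nat
    and q0 p0 :: "real^'m" and q p :: "real \<Rightarrow> real \<Rightarrow> real^'m" and L :: "real \<Rightarrow> real \<Rightarrow> real^'n"
    and force :: "real \<Rightarrow> real \<Rightarrow> real^'m"
  assumes U: "real_analytic_on U D" and q0: "q0 \<in> D"
    and g: "\<forall>j. polynomial_degree_le_on UNIV 2 (\<lambda>x. g x $ j)"
    and regular: "sym_pos_def (transpose (grad_matrix g q0) ** matrix_inv M ** grad_matrix g q0)"
    and hidden0: "hidden_constraint M g q0 p0 = 0"
    and sk: "1 \<le> s" "s \<le> k"
    and poly_fun_q: "\<And>h. poly_fun s (q h)" and poly_fun_p: "\<And>h. poly_fun s (p h)"
    and L: "\<And>h. gauss_interp s (L h) = L h"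
    and force: "\<And>h c. force h c = (\<Sum>j<s. poly (legendre01 j) c *\<^sub>R
      (\<Sum>i=1..k. (gauss_weight k i * poly (legendre01 j) (gauss_node k i)) *\<^sub>R grad U (q h (gauss_node k i))))"
    and initial: "\<forall>\<^sub>F h in at_right 0. q h 0 = q0 \<and> p h 0 = p0"
    and q_deriv: "\<forall>\<^sub>F h in at_right 0. \<forall>c\<in>{0..1}.
      (q h has_vector_derivative h *\<^sub>R (matrix_inv M *v gauss_interp s (p h) c)) (at c)"
    and p_deriv: "\<forall>\<^sub>F h in at_right 0. \<forall>c\<in>{0..1}. (p h has_vector_derivative
      h *\<^sub>R (force h c - gauss_interp s (\<lambda>c. grad_matrix g (q h c) *v L h c) c)) (at c)"
    and hidden_node: "\<forall>\<^sub>F h in at_right 0. \<forall>i\<in>{1..s}.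
      hidden_constraint M g (q h (gauss_node s i)) (p h (gauss_node s i)) = 0"
    and p_bounded: "big_O_unif 0 p"
begin

abbreviation "K \<equiv> matrix_inv M"

definition "hidden_form A z = transpose A *v (K *v z)" for A :: "real^'n^'m"

lemmas mult_vec_bilinear = bounded_bilinear_matrix_vector_mult

lemmas mult_vec_linear = bounded_bilinear.bounded_linear_right[OF mult_vec_bilinear]

lemma bilinear_hidden: "bounded_bilinear hidden_form"
  unfolding hidden_form_def[abs_def]
  by (rule bounded_bilinear.comp[OF mult_vec_bilinear bounded_linear_transpose mult_vec_linear])

lemma hidden_eq: "hidden_constraint M g x z = hidden_form (grad_matrix g x) z"
  by (simp add: hidden_constraint_def hidden_form_def)

lemma h_jet_K_interp: "h_jet r p \<Longrightarrow> r \<le> s \<Longrightarrow> h_jet r (\<lambda>h c. K *v gauss_interp s (p h) c)"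
  by (intro h_jet_bounded_linear[OF mult_vec_linear] h_jet_gauss_interp)

lemma poly_fun_K_interp: "poly_fun (s - 1) (\<lambda>c. K *v gauss_interp s (p h) c)"
  by (intro poly_fun_bounded_linear[OF mult_vec_linear] poly_fun_gauss_interp)

lemma h_jet_q:
  assumes "h_jet r p" "r \<le> s"
  obtains Y where "h_jet r Y" "\<forall>\<^sub>F h in at_right 0. \<forall>c\<in>{0..1}. q h c = q0 + (h * c) *\<^sub>R Y h c"
proof -
  have "r \<le> Suc (s - 1)" using assms(2) by simp
  from h_jet_primitive[OF poly_fun_K_interp h_jet_K_interp[OF assms] this q_deriv]
  obtain Y where Y: "h_jet r Y" "\<forall>\<^sub>F h in at_right 0. \<forall>c\<in>{0..1}. q h c = q h 0 + (h * c) *\<^sub>R Y h c"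
    by blast
  have "\<forall>\<^sub>F h in at_right 0. \<forall>c\<in>{0..1}. q h c = q0 + (h * c) *\<^sub>R Y h c"
    using Y(2) initial by eventually_elim auto
  with Y(1) show ?thesis by (rule that)
qed

lemma h_jet_shift': "h_jet r f \<Longrightarrow> h_jet r (\<lambda>h c. (h * c) *\<^sub>R f h c)"
  by (rule h_jet_mono[OF h_jet_shift]) auto

lemma h_jet_grad_U:
  assumes "h_jet r Y" "\<forall>\<^sub>F h in at_right 0. \<forall>c\<in>{0..1}. q h c = q0 + (h * c) *\<^sub>R Y h c"
  shows "h_jet r (\<lambda>h c. grad U (q h c))"
proof -
  have "big_O_unif 1 (\<lambda>h c. h *\<^sub>R (c *\<^sub>R Y h c))"
    using big_O_unif_h_mult[OF big_O_unif_bilinear[OF bounded_bilinear_scaleR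
      big_O_unif_of_c[of "\<lambda>c. c", OF continuous_on_id] h_jet_bounded[OF assms(1)]]] by simp
  then have "h_jet r (\<lambda>h c. grad U (q0 + (h * c) *\<^sub>R Y h c))"
    by (intro h_jet_analytic_gradient[OF U q0] h_jet_shift' assms(1)) simp
  then show ?thesis by (rule h_jet_cong, intro eventually_mono[OF assms(2)]) auto
qed

lemma h_jet_force:
  assumes "h_jet r p" "r \<le> s"
  shows "h_jet r force"
proof -
  obtain Y where Y: "h_jet r Y" "\<forall>\<^sub>F h in at_right 0. \<forall>c\<in>{0..1}. q h c = q0 + (h * c) *\<^sub>R Y h c"
    by (rule h_jet_q[OF assms])
  from h_jet_legendre_discrete_projection[OF h_jet_grad_U[OF Y] assms(2) sk(2)]
  show ?thesis by (simp add: force[abs_def])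
qed

lemma h_jet_grad_matrix:
  assumes "h_jet r p" "r \<le> s"
  obtains E where "h_jet r E"
    "\<forall>\<^sub>F h in at_right 0. \<forall>c\<in>{0..1}. grad_matrix g (q h c) = grad_matrix g q0 + (h * c) *\<^sub>R E h c"
    "h_jet r (\<lambda>h c. grad_matrix g (q h c))"
proof -
  obtain Y where Y: "h_jet r Y" "\<forall>\<^sub>F h in at_right 0. \<forall>c\<in>{0..1}. q h c = q0 + (h * c) *\<^sub>R Y h c"
    by (rule h_jet_q[OF assms])
  obtain \<Gamma> where \<Gamma>: "bounded_linear \<Gamma>" "\<And>x y. grad_matrix g (x + y) = grad_matrix g x + \<Gamma> y"
    using grad_matrix_affine(1)[OF g] by blast
  define E where "E h c = \<Gamma> (Y h c)" for h c
  have E: "h_jet r E" unfolding E_def by (rule h_jet_bounded_linear[OF \<Gamma>(1) Y(1)])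
  have G_eq: "\<forall>\<^sub>F h in at_right 0. \<forall>c\<in>{0..1}. grad_matrix g (q h c) = grad_matrix g q0 + (h * c) *\<^sub>R E h c"
    by (rule eventually_mono[OF Y(2)])
       (auto simp: E_def \<Gamma>(2) linear_cmul bounded_linear.linear[OF \<Gamma>(1)])
  have "h_jet r (\<lambda>h c. grad_matrix g q0 + (h * c) *\<^sub>R E h c)"
    by (intro h_jet_add h_jet_const h_jet_shift' E)
  then have "h_jet r (\<lambda>h c. grad_matrix g (q h c))"
    by (rule h_jet_cong, intro eventually_mono[OF G_eq]) auto
  with E G_eq show ?thesis by (rule that)
qed

text \<open>
  The Jacobian is its initial value plus \<open>h c\<close> times an expansion of order \<open>r\<close>. So the hidden constraint
  consists of a linear image of \<open>p\<close>, a polynomial of degree at most \<open>s\<close>, and an expansion of order \<open>r + 1\<close>; it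
  vanishes at the start and at the Gauss nodes.
\<close>

lemma hidden_residual_order:
  assumes p: "h_jet r p" and r: "r \<le> s"
  shows "big_O_unif (Suc r) (\<lambda>h c. hidden_constraint M g (q h c) (p h c))"
proof -
  obtain E where E: "h_jet r E"
    "\<forall>\<^sub>F h in at_right 0. \<forall>c\<in>{0..1}. grad_matrix g (q h c) = grad_matrix g q0 + (h * c) *\<^sub>R E h c"
    by (rule h_jet_grad_matrix[OF assms])
  show ?thesis
  proof (rule big_O_unif_vanishing_at_nodes[OF sk(1) r])
    show "poly_fun s (\<lambda>c. hidden_form (grad_matrix g q0) (p h c))" for h
      by (intro poly_fun_bounded_linear[OF bounded_bilinear.bounded_linear_right[OF bilinear_hidden]] poly_fun_p)
    show "h_jet (Suc r) (\<lambda>h c. (h * c) *\<^sub>R hidden_form (E h c) (p h c))"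
      by (intro h_jet_shift h_jet_bilinear[OF bilinear_hidden] E(1) p)
    show "\<forall>\<^sub>F h in at_right 0. \<forall>c\<in>{0..1}. hidden_constraint M g (q h c) (p h c) =
        hidden_form (grad_matrix g q0) (p h c) + (h * c) *\<^sub>R hidden_form (E h c) (p h c)"
      by (rule eventually_mono[OF E(2)])
         (simp add: hidden_eq bounded_bilinear.add_left[OF bilinear_hidden] bounded_bilinear.scaleR_left[OF bilinear_hidden])
    show "\<forall>\<^sub>F h in at_right 0. hidden_constraint M g (q h 0) (p h 0) = 0"
      using initial by (rule eventually_mono) (use hidden0 in auto)
    show "\<forall>\<^sub>F h in at_right 0. \<forall>i\<in>{1..s}. hidden_constraint M g (q h (gauss_node s i)) (p h (gauss_node s i)) = 0"
      by (rule hidden_node)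
  qed
qed

definition "constraint_force h c = grad_matrix g (q h c) *v L h c"

text \<open>
  Differentiating the hidden constraint in \<open>c\<close> gives \<open>h\<close> times an expression in which every term but
  one is smooth of order \<open>r\<close>, the exception being the contribution of the constraint force. The
  derivative is \<open>O(h\<^bsup>r + 1\<^esup>)\<close>, since the hidden constraint is a polynomial of this size. After division
  by \<open>h\<close>, the remaining term is smooth of order \<open>r\<close> as well.
\<close>

lemma h_jet_hidden_constraint_force:
  assumes p: "h_jet r p" and r: "r \<le> s"
  shows "h_jet r (\<lambda>h c. hidden_form (grad_matrix g (q h c)) (gauss_interp s (constraint_force h) c))"
proof -
  obtain \<Gamma> where \<Gamma>: "bounded_linear \<Gamma>" "\<And>x y. grad_matrix g (x + y) = grad_matrix g x + \<Gamma> y"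
    using grad_matrix_affine(1)[OF g] by blast
  have \<Gamma>0: "grad_matrix g x = grad_matrix g 0 + \<Gamma> x" for x using \<Gamma>(2)[of 0 x] by simp
  define G where "G h c = grad_matrix g (q h c)" for h c
  have G0: "G h = (\<lambda>c. grad_matrix g 0 + \<Gamma> (q h c))" for h
    by (intro ext) (simp only: G_def \<Gamma>0[symmetric])
  have poly_fun_G: "poly_fun s (G h)" for h
    by (simp only: G0 poly_fun_add poly_fun_const poly_fun_bounded_linear[OF \<Gamma>(1) poly_fun_q])
  define N where "N h c = hidden_form (G h c) (p h c)" for h c
  have N: "big_O_unif (Suc r) N"
    using hidden_residual_order[OF assms] by (simp add: N_def[abs_def] G_def hidden_eq)
  define X where "X h c = hidden_form (G h c) (force h c - gauss_interp s (constraint_force h) c)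
      + hidden_form (\<Gamma> (K *v gauss_interp s (p h) c)) (p h c)" for h c
  have "\<forall>\<^sub>F h in at_right 0. \<forall>c\<in>{0..1}. (N h has_vector_derivative h *\<^sub>R X h c) (at c)"
    using q_deriv p_deriv
  proof eventually_elim
    case (elim h)
    show ?case
    proof
      fix c :: real assume c: "c \<in> {0..1}"
      have "((\<lambda>c. grad_matrix g 0 + \<Gamma> (q h c)) has_vector_derivative (0 + \<Gamma> (h *\<^sub>R (K *v gauss_interp s (p h) c)))) (at c)"
        by (intro has_vector_derivative_add has_vector_derivative_const
            bounded_linear.has_vector_derivative[OF \<Gamma>(1)] bspec[OF elim(1) c])
      then have dG: "(G h has_vector_derivative \<Gamma> (h *\<^sub>R (K *v gauss_interp s (p h) c))) (at c)"
        by (simp only: G0 add_0)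
      have dp: "(p h has_vector_derivative h *\<^sub>R (force h c - gauss_interp s (constraint_force h) c)) (at c)"
        using bspec[OF elim(2) c] by (simp add: constraint_force_def[abs_def])
      from bounded_bilinear.has_vector_derivative[OF bilinear_hidden dG dp]
      show "(N h has_vector_derivative h *\<^sub>R X h c) (at c)"
        by (simp add: N_def[abs_def] X_def scaleR_add_right linear_cmul bounded_linear.linear[OF \<Gamma>(1)]
            bounded_bilinear.scaleR_left[OF bilinear_hidden] bounded_bilinear.scaleR_right[OF bilinear_hidden])
    qed
  qed
  moreover have "poly_fun (s + s) (N h)" for h
    unfolding N_def by (intro poly_fun_bilinear[OF bilinear_hidden] poly_fun_G poly_fun_p)
  ultimately have "big_O_unif (1 + r) (\<lambda>h c. h *\<^sub>R X h c)"
    using big_O_unif_poly_derivative[of "s + s" N "Suc r" "\<lambda>h c. h *\<^sub>R X h c"] N by simp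
  then have "big_O_unif r (\<lambda>h c. (1 / h ^ 1) *\<^sub>R (h *\<^sub>R X h c))" by (rule big_O_unif_h_divide)
  then have X: "big_O_unif r X"
    by (rule big_O_unif_cong, intro eventually_mono[OF eventually_h_small]) auto
  have G: "h_jet r G" unfolding G_def by (rule h_jet_grad_matrix[OF assms])
  have "h_jet r (\<lambda>h c. hidden_form (G h c) (force h c) + hidden_form (\<Gamma> (K *v gauss_interp s (p h) c)) (p h c) - X h c)"
    by (intro h_jet_diff h_jet_add h_jet_big_O[OF X] h_jet_bilinear[OF bilinear_hidden] G p
        h_jet_force assms h_jet_bounded_linear[OF \<Gamma>(1)] h_jet_K_interp)
  then show ?thesis
    by (simp add: G_def X_def bounded_bilinear.diff_right[OF bilinear_hidden])
qed

text \<open>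
  With \<open>G = G0 + h c E\<close> the matrix of the system for the multipliers is
  \<open>G\<^sup>T K G = G0\<^sup>T K G0 + h c (E\<^sup>T K G0 + G\<^sup>T K E)\<close>, a perturbation of an invertible matrix.
\<close>

lemma h_jet_multiplier:
  assumes "h_jet r p" "r \<le> s"
  shows "h_jet r L"
proof -
  define G where "G h c = grad_matrix g (q h c)" for h c
  define G0 where "G0 = grad_matrix g q0"
  obtain E where E: "h_jet r E" "\<forall>\<^sub>F h in at_right 0. \<forall>c\<in>{0..1}. G h c = G0 + (h * c) *\<^sub>R E h c" "h_jet r G"
    unfolding G_def G0_def by (rule h_jet_grad_matrix[OF assms])
  note tr = bounded_linear_transpose and mult = bounded_bilinear_matrix_mult
  show ?thesis
  proof (rule h_jet_solve_perturbed_system[OF _ _ h_jet_hidden_constraint_force[OF assms] assms(2) L])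
    show "invertible (transpose G0 ** K ** G0)"
      using sym_pos_def_invertible[OF regular] by (simp add: G0_def)
    show "h_jet r (\<lambda>h c. transpose (E h c) ** K ** G0 + transpose (G h c) ** K ** E h c)"
      by (intro h_jet_add h_jet_bilinear[OF mult] h_jet_bounded_linear[OF tr] h_jet_const E)
    show "\<forall>\<^sub>F h in at_right 0. \<forall>i\<in>{1..s}.
      (transpose G0 ** K ** G0 + (h * gauss_node s i) *\<^sub>R
        (transpose (E h (gauss_node s i)) ** K ** G0 + transpose (G h (gauss_node s i)) ** K ** E h (gauss_node s i)))
        *v L h (gauss_node s i)
      = hidden_form (grad_matrix g (q h (gauss_node s i))) (gauss_interp s (constraint_force h) (gauss_node s i))"
      using E(2)
    proof eventually_elim
      case (elim h)
      show ?case
      proof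
        fix i assume i: "i \<in> {1..s}"
        let ?x = "gauss_node s i"
        have Gx: "G h ?x = G0 + (h * ?x) *\<^sub>R E h ?x" using elim gauss_node_in_closed[OF i] by blast
        have tGx: "transpose (G h ?x) = transpose G0 + (h * ?x) *\<^sub>R transpose (E h ?x)"
          by (simp add: Gx linear_add linear_cmul bounded_linear.linear[OF tr])
        have "transpose (G h ?x) ** K ** G h ?x
            = transpose (G h ?x) ** K ** G0 + (h * ?x) *\<^sub>R (transpose (G h ?x) ** K ** E h ?x)"
          by (subst (2) Gx) (simp add: bounded_bilinear.add_right[OF mult] bounded_bilinear.scaleR_right[OF mult])
        also have "transpose (G h ?x) ** K ** G0
            = transpose G0 ** K ** G0 + (h * ?x) *\<^sub>R (transpose (E h ?x) ** K ** G0)"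
          unfolding tGx by (simp add: bounded_bilinear.add_left[OF mult] bounded_bilinear.scaleR_left[OF mult])
        finally have "transpose (G h ?x) ** K ** G h ?x = transpose G0 ** K ** G0
            + (h * ?x) *\<^sub>R (transpose (E h ?x) ** K ** G0 + transpose (G h ?x) ** K ** E h ?x)"
          by (simp add: scaleR_add_right)
        moreover have "hidden_form (grad_matrix g (q h ?x)) (gauss_interp s (constraint_force h) ?x)
            = (transpose (G h ?x) ** K ** G h ?x) *v L h ?x"
          using i by (simp add: gauss_interp_node constraint_force_def G_def hidden_form_def
            matrix_vector_mul_assoc matrix_mul_assoc)
        ultimately show "(transpose G0 ** K ** G0 + (h * ?x) *\<^sub>R
            (transpose (E h ?x) ** K ** G0 + transpose (G h ?x) ** K ** E h ?x)) *v L h ?x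
          = hidden_form (grad_matrix g (q h ?x)) (gauss_interp s (constraint_force h) ?x)"
          by (simp only:)
      qed
    qed
  qed
qed

text \<open>
  The right-hand side of the momentum equation is \<open>h\<close> times an expansion of order \<open>r\<close>, since both the
  discretized potential force and the constraint force are smooth of this order.
\<close>

lemma h_jet_p_Suc:
  assumes p: "h_jet r p" and r: "r \<le> s"
  shows "h_jet (Suc r) p"
proof -
  have "h_jet r (\<lambda>h c. grad_matrix g (q h c))" by (rule h_jet_grad_matrix[OF assms])
  then have "h_jet r constraint_force"
    unfolding constraint_force_def by (intro h_jet_bilinear[OF mult_vec_bilinear] h_jet_multiplier assms)
  then have w: "h_jet r (\<lambda>h c. force h c - gauss_interp s (constraint_force h) c)"
    by (intro h_jet_diff h_jet_force h_jet_gauss_interp assms)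
  have wp: "poly_fun (s - 1) (\<lambda>c. force h c - gauss_interp s (constraint_force h) c)" for h
    unfolding force
    by (intro poly_fun_diff poly_fun_gauss_interp poly_fun_sum poly_fun_poly) auto
  have "\<forall>\<^sub>F h in at_right 0. \<forall>c\<in>{0..1}. (p h has_vector_derivative h *\<^sub>R (force h c - gauss_interp s (constraint_force h) c)) (at c)"
    using p_deriv by (simp add: constraint_force_def[abs_def])
  moreover have "r \<le> Suc (s - 1)" using r sk by simp
  ultimately obtain V where V: "h_jet r V" "\<forall>\<^sub>F h in at_right 0. \<forall>c\<in>{0..1}. p h c = p h 0 + (h * c) *\<^sub>R V h c"
    using h_jet_primitive[OF wp w] by blast
  have "h_jet (Suc r) (\<lambda>h c. p0 + (h * c) *\<^sub>R V h c)"
    by (intro h_jet_add h_jet_const h_jet_shift V)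
  moreover have "\<forall>\<^sub>F h in at_right 0. \<forall>c\<in>{0..1}. p0 + (h * c) *\<^sub>R V h c = p h c"
    using V(2) initial by eventually_elim auto
  ultimately show ?thesis by (rule h_jet_cong)
qed

lemma h_jet_p: "r \<le> s \<Longrightarrow> h_jet r p"
proof (induction r)
  case 0
  then show ?case using p_bounded by (simp add: h_jet_0_iff)
next
  case (Suc r)
  then show ?case using h_jet_p_Suc[of r] by simp
qed

text \<open>
  At order \<open>s\<close> the degrees of the position and velocity polynomials no longer exceed the order of
  smoothness, so their smoothness is of every order.
\<close>

lemma h_jet_work_rate:
  "h_jet R (\<lambda>h c. grad U (q h c) \<bullet> (K *v gauss_interp s (p h) c))"
proof -
  have p: "h_jet s p" by (rule h_jet_p) simp
  obtain Y where Y: "h_jet s Y" "\<forall>\<^sub>F h in at_right 0. \<forall>c\<in>{0..1}. q h c = q0 + (h * c) *\<^sub>R Y h c"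
    by (rule h_jet_q[OF p]) simp
  have "h_jet s (\<lambda>h c. q0 + (h * c) *\<^sub>R Y h c)"
    by (intro h_jet_add h_jet_const h_jet_shift' Y)
  then have qs: "h_jet s q" by (rule h_jet_cong, intro eventually_mono[OF Y(2)]) auto
  have q: "h_jet R q" by (rule h_jet_polynomial_all_orders[OF poly_fun_q qs]) auto
  have w: "h_jet R (\<lambda>h c. K *v gauss_interp s (p h) c)"
    by (rule h_jet_polynomial_all_orders[OF poly_fun_K_interp h_jet_K_interp[OF p]]) auto
  have "big_O_unif 1 (\<lambda>h c. h *\<^sub>R (c *\<^sub>R Y h c))"
    using big_O_unif_h_mult[OF big_O_unif_bilinear[OF bounded_bilinear_scaleR
      big_O_unif_of_c[of "\<lambda>c. c", OF continuous_on_id] h_jet_bounded[OF Y(1)]]] by simp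
  then have "big_O_unif 1 (\<lambda>h c. q h c - q0)"
    by (rule big_O_unif_cong, intro eventually_mono[OF Y(2)]) auto
  from h_jet_analytic_gradient[OF U q0 h_jet_diff[OF q h_jet_const] this]
  have "h_jet R (\<lambda>h c. grad U (q h c))" by simp
  from h_jet_bilinear[OF bounded_bilinear_inner this w] show ?thesis .
qed

end

section \<open>Energy error and hidden constraints\<close>

text \<open>
  The hidden constraint is the time derivative of the constraint, which is zero along the exact
  solution.
\<close>

lemma exact_solution_hidden_constraint:
  fixes g :: "real^'m::finite \<Rightarrow> real^'n::finite"
  assumes g: "\<forall>j. polynomial_degree_le_on UNIV 2 (\<lambda>x. g x $ j)"
    and "exact_solution M U D g T q0 p0 q p lam" "0 < T" "t \<in> {0..T}"
  shows "hidden_constraint M g (q t) (p t) = 0"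
proof -
  have q: "(q has_vector_derivative (matrix_inv M *v p t)) (at t within {0..T})"
    and g0: "\<And>t. t \<in> {0..T} \<Longrightarrow> g (q t) = 0"
    using assms(2,4) unfolding exact_solution_def by blast+
  have "(transpose (grad_matrix g (q t)) *v (matrix_inv M *v p t)) $ j = 0" for j
  proof (rule vector_derivative_unique_within_closed_interval[where a = 0 and b = T, unfolded cbox_interval, OF assms(3,4)])
    show "((\<lambda>t. g (q t) $ j) has_vector_derivative
        (transpose (grad_matrix g (q t)) *v (matrix_inv M *v p t)) $ j) (at t within {0..T})"
      by (rule constraint_derivative[OF g q])
    have "((\<lambda>t. 0::real) has_vector_derivative 0) (at t within {0..T})" by simp
    then show "((\<lambda>t. g (q t) $ j) has_vector_derivative 0) (at t within {0..T})"
      by (rule has_vector_derivative_transform[rotated 2]) (use g0 assms(4) in auto)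
  qed
  then show ?thesis by (simp add: hidden_constraint_def vec_eq_iff)
qed

text \<open>
  The hidden constraint is affine in the position and linear in the momentum. The bound on
  \<open>z' - z\<close> keeps the perturbed momenta in a bounded set, on which this bilinear expression is
  Lipschitz continuous.
\<close>

lemma hidden_constraint_lipschitz:
  fixes g :: "real^'m::finite \<Rightarrow> real^'n::finite" and M :: "real^'m^'m"
  assumes g: "\<forall>j. polynomial_degree_le_on UNIV 2 (\<lambda>x. g x $ j)"
  obtains C where "C > 0" "\<And>x z x' z'. hidden_constraint M g x z = 0 \<Longrightarrow> norm x \<le> B \<Longrightarrow> norm z \<le> B \<Longrightarrow>
    norm (z' - z) \<le> B' \<Longrightarrow> norm (hidden_constraint M g x' z') \<le> C * (norm (x' - x) + norm (z' - z))"
proof -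
  obtain \<Gamma> where \<Gamma>: "bounded_linear \<Gamma>" "\<And>x y. grad_matrix g (x + y) = grad_matrix g x + \<Gamma> y"
    using grad_matrix_affine(1)[OF g] by blast
  define b where "b A z = transpose A *v (matrix_inv M *v z)" for A :: "real^'n^'m" and z
  have b: "bounded_bilinear b"
    unfolding b_def[abs_def]
    by (rule bounded_bilinear.comp[OF bounded_bilinear_matrix_vector_mult bounded_linear_transpose
          bounded_bilinear.bounded_linear_right[OF bounded_bilinear_matrix_vector_mult]])
  obtain K1 where K1: "K1 > 0" "\<And>A z. norm (b A z) \<le> norm A * norm z * K1"
    using bounded_bilinear.pos_bounded[OF b] by blast
  obtain K2 where K2: "K2 > 0" "\<And>z. norm (\<Gamma> z) \<le> norm z * K2"
    using bounded_linear.pos_bounded[OF \<Gamma>(1)] by blast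
  define C where "C = K2 * (\<bar>B\<bar> + \<bar>B'\<bar>) * K1 + (norm (grad_matrix g 0) + \<bar>B\<bar> * K2) * K1 + 1"
  have pos: "0 \<le> K2 * (\<bar>B\<bar> + \<bar>B'\<bar>) * K1" "0 \<le> (norm (grad_matrix g 0) + \<bar>B\<bar> * K2) * K1"
    using K1(1) K2(1) by simp_all
  show ?thesis
  proof (rule that[of C])
    show "C > 0" using pos by (simp add: C_def)
    fix x z x' z'
    assume 0: "hidden_constraint M g x z = 0" and x: "norm x \<le> B" and z: "norm z \<le> B" and z': "norm (z' - z) \<le> B'"
    have "hidden_constraint M g x' z' = b (grad_matrix g (x + (x' - x))) z'"
      by (simp add: hidden_constraint_def b_def)
    also have "\<dots> = b (grad_matrix g x) z' + b (\<Gamma> (x' - x)) z'"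
      unfolding \<Gamma>(2) by (rule bounded_bilinear.add_left[OF b])
    also have "b (grad_matrix g x) z' = b (grad_matrix g x) (z' - z)"
    proof -
      have "b (grad_matrix g x) z = 0" using 0 by (simp only: hidden_constraint_def b_def)
      then show ?thesis by (simp only: bounded_bilinear.diff_right[OF b] diff_zero)
    qed
    finally have eq: "hidden_constraint M g x' z' = b (grad_matrix g x) (z' - z) + b (\<Gamma> (x' - x)) z'" .
    have nz': "norm z' \<le> \<bar>B\<bar> + \<bar>B'\<bar>" using norm_triangle_ineq[of z "z' - z"] z z' by simp
    have nx: "norm (grad_matrix g x) \<le> norm (grad_matrix g 0) + \<bar>B\<bar> * K2"
    proof -
      have "grad_matrix g x = grad_matrix g 0 + \<Gamma> x" using \<Gamma>(2)[of 0 x] by simp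
      then have "norm (grad_matrix g x) \<le> norm (grad_matrix g 0) + norm (\<Gamma> x)" by (metis norm_triangle_ineq)
      moreover have "norm (\<Gamma> x) \<le> \<bar>B\<bar> * K2"
        using K2 x by (intro order_trans[OF K2(2)] mult_right_mono) auto
      ultimately show ?thesis by simp
    qed
    have "norm (b (grad_matrix g x) (z' - z)) \<le> (norm (grad_matrix g 0) + \<bar>B\<bar> * K2) * norm (z' - z) * K1"
      using K1 nx by (intro order_trans[OF K1(2)] mult_right_mono) auto
    moreover have "norm (b (\<Gamma> (x' - x)) z') \<le> (norm (x' - x) * K2) * (\<bar>B\<bar> + \<bar>B'\<bar>) * K1"
      using K1 K2 nz' by (intro order_trans[OF K1(2)] mult_right_mono mult_mono) auto
    moreover have "(norm (grad_matrix g 0) + \<bar>B\<bar> * K2) * norm (z' - z) * K1 \<le> C * norm (z' - z)"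
    proof -
      have "((norm (grad_matrix g 0) + \<bar>B\<bar> * K2) * K1) * norm (z' - z) \<le> C * norm (z' - z)"
        using pos by (intro mult_right_mono) (auto simp: C_def)
      then show ?thesis by (simp add: mult_ac)
    qed
    moreover have "(norm (x' - x) * K2) * (\<bar>B\<bar> + \<bar>B'\<bar>) * K1 \<le> C * norm (x' - x)"
    proof -
      have "(K2 * (\<bar>B\<bar> + \<bar>B'\<bar>) * K1) * norm (x' - x) \<le> C * norm (x' - x)"
        using pos by (intro mult_right_mono) (auto simp: C_def)
      then show ?thesis by (simp add: mult_ac)
    qed
    ultimately show "norm (hidden_constraint M g x' z') \<le> C * (norm (x' - x) + norm (z' - z))"
      unfolding eq distrib_left
      using norm_triangle_ineq[of "b (grad_matrix g x) (z' - z)" "b (\<Gamma> (x' - x)) z'"] by linarith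
  qed
qed

lemma exact_solution_bounded:
  assumes "exact_solution M U D g T q0 p0 q p lam"
  shows "\<exists>B. \<forall>t\<in>{0..T}. norm (q t) \<le> B \<and> norm (p t) \<le> B"
proof -
  have "continuous_on {0..T} q" "continuous_on {0..T} p"
    using assms unfolding exact_solution_def continuous_on_eq_continuous_within
    by (meson has_vector_derivative_continuous)+
  then have "bounded (q ` {0..T} \<union> p ` {0..T})"
    by (simp add: compact_imp_bounded compact_continuous_image)
  then show ?thesis unfolding bounded_iff by blast
qed

text \<open>
  The filter \<open>F\<close> is arbitrary so as to cover the first step and, uniformly in the step number, all
  steps. For \<open>r = 0\<close> the momentum error need not be small, but it is bounded.
\<close>

lemma hidden_constraint_order:
  fixes g :: "real^'m::finite \<Rightarrow> real^'n::finite" and M :: "real^'m^'m"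
  assumes g: "\<forall>j. polynomial_degree_le_on UNIV 2 (\<lambda>x. g x $ j)"
    and ex: "exact_solution M U D g T q0 p0 q p lam" and T: "0 < T"
    and ev: "\<forall>\<^sub>F x in F. t x \<in> {0..T} \<and> 0 < h x \<and> h x < (1::real)"
    and u: "(\<lambda>x. norm (u x - q (t x))) \<in> O[F](\<lambda>x. h x ^ r)"
    and v: "(\<lambda>x. norm (v x - p (t x))) \<in> O[F](\<lambda>x. h x ^ r)"
  shows "(\<lambda>x. norm (hidden_constraint M g (u x) (v x))) \<in> O[F](\<lambda>x. h x ^ r)"
proof -
  obtain B where B: "\<forall>t\<in>{0..T}. norm (q t) \<le> B \<and> norm (p t) \<le> B"
    using exact_solution_bounded[OF ex] by blast
  obtain cu where cu: "cu > 0" "\<forall>\<^sub>F x in F. norm (norm (u x - q (t x))) \<le> cu * norm (h x ^ r)"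
    using u by (rule landau_o.bigE)
  obtain cv where cv: "cv > 0" "\<forall>\<^sub>F x in F. norm (norm (v x - p (t x))) \<le> cv * norm (h x ^ r)"
    using v by (rule landau_o.bigE)
  obtain C where C: "C > 0" "\<And>x z x' z'. hidden_constraint M g x z = 0 \<Longrightarrow> norm x \<le> B \<Longrightarrow> norm z \<le> B \<Longrightarrow>
    norm (z' - z) \<le> cv \<Longrightarrow> norm (hidden_constraint M g x' z') \<le> C * (norm (x' - x) + norm (z' - z))"
    by (rule hidden_constraint_lipschitz[OF g, where M = M and B = B and B' = cv]) blast
  show ?thesis
  proof (rule bigoI[of _ "C * (cu + cv)"])
    show "\<forall>\<^sub>F x in F. norm (norm (hidden_constraint M g (u x) (v x))) \<le> C * (cu + cv) * norm (h x ^ r)"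
      using ev cu(2) cv(2)
    proof eventually_elim
      case (elim x)
      have hr: "0 \<le> h x ^ r" "h x ^ r \<le> 1" using elim by (auto intro: power_le_one)
      have un: "norm (u x - q (t x)) \<le> cu * h x ^ r" and vn: "norm (v x - p (t x)) \<le> cv * h x ^ r"
        using elim hr by simp_all
      have "cv * h x ^ r \<le> cv * 1" using cv(1) hr by (intro mult_left_mono) auto
      with vn have "norm (v x - p (t x)) \<le> cv" by simp
      then have "norm (hidden_constraint M g (u x) (v x)) \<le> C * (norm (u x - q (t x)) + norm (v x - p (t x)))"
        using elim exact_solution_hidden_constraint[OF g ex T] B by (intro C(2)) auto
      also have "\<dots> \<le> C * (cu * h x ^ r + cv * h x ^ r)"
        using un vn C(1) by (intro mult_left_mono add_mono) auto
      finally show ?case using hr by (simp add: algebra_simps)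
    qed
  qed
qed

lemma eventually_steps_filter:
  "\<forall>\<^sub>F x in steps_filter T. 0 < fst x \<and> fst x < 1 \<and> real (snd x + 1) * fst x \<le> T"
proof -
  have "\<forall>\<^sub>F x in filtercomap fst (at_right 0). 0 < fst x \<and> fst x < (1::real)"
    using eventually_h_small by (rule eventually_filtercomapI)
  then show ?thesis
    unfolding steps_filter_def eventually_inf_principal
    by (rule eventually_mono) auto
qed

text \<open>
  The energy error is the quadrature error of the power, which is \<open>h\<close> times a function that is smooth of
  order \<open>2 k\<close>. The families are extended by zero to step sizes outside the given range.
\<close>

lemma energy_error_order:
  fixes M :: "real^'m::finite^'m" and g :: "real^'m \<Rightarrow> real^'n::finite"
  assumes M: "sym_pos_def M" and U: "real_analytic_on U D"
    and g: "\<forall>j. polynomial_degree_le_on UNIV 2 (\<lambda>x. g x $ j)"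
    and regular: "\<forall>x\<in>D. sym_pos_def (transpose (grad_matrix g x) ** matrix_inv M ** grad_matrix g x)"
    and hidden0: "hidden_constraint M g q0 p0 = 0"
    and T: "0 < T" and ex: "exact_solution M U D g T q0 p0 q p lam"
    and sk: "1 \<le> s" "s \<le> k" and h0: "0 < h0"
    and step: "\<forall>h\<in>{0<..h0}. procedure_step M U D g s k h q0 p0 (u h) (v h) (l h)"
    and app: "approximates (at_right 0) (\<lambda>h. h) (\<lambda>h. 0) s q p lam u v l"
  shows "(\<lambda>h. hamiltonian M U (u h h) (v h h) - hamiltonian M U q0 p0) \<in> O[at_right 0](\<lambda>h. h ^ (2 * k + 1))"
proof -
  have st: "gauss_step M U D g s k h q0 p0 (u h) (v h) (l h)" if "h \<in> {0<..h0}" for h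
    using M U g sk step that by unfold_locales auto
  have small: "\<forall>\<^sub>F h in at_right 0. h \<in> {0<..h0}"
    using eventually_at_right_real[OF h0] by (rule eventually_mono) auto
  define Q where "Q h = (if h \<in> {0<..h0} then (\<lambda>c. u h (c * h)) else (\<lambda>c. 0))" for h
  define P where "P h = (if h \<in> {0<..h0} then (\<lambda>c. v h (c * h)) else (\<lambda>c. 0))" for h
  define L where "L h = (if h \<in> {0<..h0} then gauss_step.multiplier s (l h) else (\<lambda>c. 0))" for h
  define W where "W h c = (\<Sum>j<s. poly (legendre01 j) c *\<^sub>R
      (\<Sum>i=1..k. (gauss_weight k i * poly (legendre01 j) (gauss_node k i)) *\<^sub>R grad U (Q h (gauss_node k i))))" for h c
  have Q: "Q h = gauss_step.q h (u h)" and P: "P h = gauss_step.p h (v h)" and L: "L h = gauss_step.multiplier s (l h)"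
    and W: "W h = gauss_step.force U s k h (u h)" if h: "h \<in> {0<..h0}" for h
    using h by (auto simp: Q_def P_def L_def W_def fun_eq_iff gauss_step.q_def[OF st] gauss_step.p_def[OF st]
        gauss_step.force_def[OF st] psi_hat_def)
  have p_bounded: "big_O_unif 0 P"
  proof -
    obtain B where B: "\<forall>t\<in>{0..T}. norm (q t) \<le> B \<and> norm (p t) \<le> B"
      using exact_solution_bounded[OF ex] by blast
    have "\<forall>\<^sub>F h in at_right 0. \<forall>c\<in>{0..1}. dist (v h (c * h) - p (0 + c * h)) 0 < 1"
      using app unfolding approximates_def by (intro uniform_limitD) auto
    moreover have "\<forall>\<^sub>F h in at_right 0. h < T"
      using eventually_at_right_real[OF T] by (rule eventually_mono) auto
    ultimately have "\<forall>\<^sub>F h in at_right 0. \<forall>c\<in>{0..1}. norm (P h c) \<le> (B + 1) * h ^ 0"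
      using small
    proof eventually_elim
      case (elim h)
      show ?case
      proof
        fix c :: real assume c: "c \<in> {0..1}"
        have h: "0 < h" "h < T" using elim by auto
        have "c * h \<le> 1 * h" using c h by (intro mult_right_mono) auto
        then have "c * h \<le> T" using h by linarith
        then have "c * h \<in> {0..T}" using c h by simp
        then have "norm (p (c * h)) \<le> B" using B by blast
        moreover have "norm (v h (c * h) - p (c * h)) < 1" using elim c by (auto simp: dist_norm)
        ultimately show "norm (P h c) \<le> (B + 1) * h ^ 0"
          using norm_triangle_ineq[of "p (c * h)" "v h (c * h) - p (c * h)"] elim by (simp add: P_def)
      qed
    qed
    then show ?thesis by (rule big_O_unifI)
  qed
  interpret gauss_step_family M U D g s k q0 p0 Q P L W
  proof
    show "real_analytic_on U D" "\<forall>j. polynomial_degree_le_on UNIV 2 (\<lambda>x. g x $ j)" "1 \<le> s" "s \<le> k"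
      "hidden_constraint M g q0 p0 = 0" "big_O_unif 0 P" by fact+
    show q0D: "q0 \<in> D" using ex T unfolding exact_solution_def by (metis atLeastAtMost_iff less_imp_le order_refl)
    then show "sym_pos_def (transpose (grad_matrix g q0) ** matrix_inv M ** grad_matrix g q0)" using regular by blast
    show "poly_fun s (Q h)" for h
      using gauss_step.poly_fun_q[OF st, of h] Q by (cases "h \<in> {0<..h0}") (simp_all add: Q_def poly_fun_const)
    show "poly_fun s (P h)" for h
      using gauss_step.poly_fun_p[OF st, of h] P by (cases "h \<in> {0<..h0}") (simp_all add: P_def poly_fun_const)
    show "gauss_interp s (L h) = L h" for h
    proof (cases "h \<in> {0<..h0}")
      case True
      show ?thesis unfolding L[OF True] gauss_step.multiplier_def[OF st[OF True]] by (rule gauss_interp_idem)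
    next
      case False
      then have "L h = (\<lambda>c. 0)" by (simp only: L_def if_False)
      then show ?thesis by (simp add: gauss_interp_def fun_eq_iff)
    qed
    show "W h c = (\<Sum>j<s. poly (legendre01 j) c *\<^sub>R
      (\<Sum>i=1..k. (gauss_weight k i * poly (legendre01 j) (gauss_node k i)) *\<^sub>R grad U (Q h (gauss_node k i))))" for h c
      by (rule W_def)
    show "\<forall>\<^sub>F h in at_right 0. Q h 0 = q0 \<and> P h 0 = p0"
      using small by (rule eventually_mono) (simp add: Q P gauss_step.initial[OF st])
    show "\<forall>\<^sub>F h in at_right 0. \<forall>c\<in>{0..1}.
      (Q h has_vector_derivative h *\<^sub>R (matrix_inv M *v gauss_interp s (P h) c)) (at c)"
      by (intro eventually_mono[OF small] ballI) (simp only: Q P gauss_step.q_deriv[OF st])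
    show "\<forall>\<^sub>F h in at_right 0. \<forall>c\<in>{0..1}. (P h has_vector_derivative
      h *\<^sub>R (W h c - gauss_interp s (\<lambda>c. grad_matrix g (Q h c) *v L h c) c)) (at c)"
      by (intro eventually_mono[OF small] ballI) (simp only: Q P L W gauss_step.p_deriv[OF st])
    show "\<forall>\<^sub>F h in at_right 0. \<forall>i\<in>{1..s}.
      hidden_constraint M g (Q h (gauss_node s i)) (P h (gauss_node s i)) = 0"
      by (intro eventually_mono[OF small] ballI) (simp only: Q P gauss_step.hidden_node[OF st])
  qed
  define f where "f h c = grad U (Q h c) \<bullet> (matrix_inv M *v gauss_interp s (P h) c)" for h c
  have rate: "gauss_step.work_rate M U s h (u h) (v h) c = h * f h c" if "h \<in> {0<..h0}" for h c
    unfolding gauss_step.work_rate_def[OF st[OF that]] f_def Q[OF that] P[OF that] by simp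
  define I where "I h = (U (Q h 1) - U q0) / h" for h
  have int: "(f h has_integral I h) {0..1}" if h: "h \<in> {0<..h0}" for h
  proof -
    have "((\<lambda>c. h * f h c) has_integral (U (Q h 1) - U q0)) {0..1}"
      using gauss_step.work_rate_has_integral[OF st[OF h]] by (simp only: rate[OF h, abs_def] Q[OF h])
    from has_integral_mult_right[OF this, of "1 / h"] h show ?thesis by (simp add: I_def)
  qed
  have "h_jet (2 * k) f" unfolding f_def by (rule h_jet_work_rate)
  then have "big_O_unif (2 * k) (\<lambda>h c. (\<Sum>i=1..k. gauss_weight k i * f h (gauss_node k i)) - I h)"
    by (rule h_jet_quadrature_error, intro eventually_mono[OF small]) (rule int)
  then obtain C where C: "C > 0" "\<forall>\<^sub>F h in at_right 0. 0 < h \<and> h < 1 \<and>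
    (\<forall>c\<in>{0..1::real}. norm ((\<Sum>i=1..k. gauss_weight k i * f h (gauss_node k i)) - I h) \<le> C * h ^ (2 * k))"
    by (rule big_O_unifE)
  show ?thesis
  proof (rule bigoI[of _ C])
    show "\<forall>\<^sub>F h in at_right 0. norm (hamiltonian M U (u h h) (v h h) - hamiltonian M U q0 p0) \<le> C * norm (h ^ (2 * k + 1))"
      using C(2) small
    proof eventually_elim
      case (elim h)
      then have h: "h \<in> {0<..h0}" by blast
      have "integral {0..1} (gauss_step.work_rate M U s h (u h) (v h)) = h * I h"
        using integral_unique[OF int[OF h]] by (simp add: rate[OF h, abs_def])
      then have "hamiltonian M U (u h h) (v h h) - hamiltonian M U q0 p0
          = h * ((\<Sum>i=1..k. gauss_weight k i * f h (gauss_node k i)) - I h)"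
        unfolding gauss_step.energy_change[OF st[OF h]] rate[OF h]
        by (simp add: right_diff_distrib sum_distrib_left mult_ac)
      moreover have "norm ((\<Sum>i=1..k. gauss_weight k i * f h (gauss_node k i)) - I h) \<le> C * h ^ (2 * k)"
        using elim by auto
      ultimately show ?case using elim by (simp add: abs_mult mult_left_mono mult.left_commute)
    qed
  qed
qed

theorem theorem8:
  fixes M :: "real^'m::finite^'m" and U :: "real^'m \<Rightarrow> real" and D :: "(real^'m) set"
    and g :: "real^'m \<Rightarrow> real^'n::finite" and T h0 :: real and s k :: nat
    and q0 p0 :: "real^'m" and q p :: "real \<Rightarrow> real^'m" and lam :: "real \<Rightarrow> real^'n"
    and u v :: "real \<Rightarrow> real \<Rightarrow> real^'m" and l :: "real \<Rightarrow> nat \<Rightarrow> real^'n"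
  assumes "CARD('n) \<le> CARD('m)"
    and "sym_pos_def M"
    and "open D" and "real_analytic_on U D"
    and "\<forall>j. polynomial_degree_le_on UNIV 2 (\<lambda>x. g x $ j)"
    and "\<forall>x\<in>D. sym_pos_def (transpose (grad_matrix g x) ** matrix_inv M ** grad_matrix g x)"
    and "\<exists>\<sigma>>0. \<forall>x\<in>D. \<forall>e\<in>eigenvals (transpose (grad_matrix g x) ** matrix_inv M ** grad_matrix g x).
           \<sigma> \<le> e"
    and "g q0 = 0" and "hidden_constraint M g q0 p0 = 0"
    and "0 < T" and "exact_solution M U D g T q0 p0 q p lam"
    and "1 \<le> s" and "s \<le> k"
    and "0 < h0"
    and "\<forall>h\<in>{0<..h0}. procedure_step M U D g s k h q0 p0 (u h) (v h) (l h)"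
    and "approximates (at_right 0) (\<lambda>h. h) (\<lambda>h. 0) s q p lam u v l"
  shows
    "(if \<exists>\<mu>. polynomial_degree_le_on D \<mu> U \<and> real \<mu> \<le> 2 * real k / real s
      then \<forall>h\<in>{0<..h0}. hamiltonian M U (u h h) (v h h) = hamiltonian M U q0 p0
      else (\<lambda>h. hamiltonian M U (u h h) (v h h) - hamiltonian M U q0 p0)
             \<in> O[at_right 0](\<lambda>h. h ^ (2 * k + 1))) \<and>
     (\<forall>h\<in>{0<..h0}. g (u h h) = 0) \<and>
     (\<forall>us vs ls r.
        (\<forall>h\<in>{0<..h0}. us h 0 = u h \<and> vs h 0 = v h \<and> ls h 0 = l h \<and>
           multi_step M U D g s k T h q0 p0 (us h) (vs h) (ls h)) \<longrightarrow>
        approximates (steps_filter T) fst (\<lambda>(h, n). real n * h) s q p lam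
          (\<lambda>(h, n). us h n) (\<lambda>(h, n). vs h n) (\<lambda>(h, n). ls h n) \<longrightarrow>
        convergence_order T q p us vs r \<longrightarrow>
        (\<lambda>h. norm (hidden_constraint M g (u h h) (v h h))) \<in> O[at_right 0](\<lambda>h. h ^ (r + 1)) \<and>
        (\<lambda>(h, n). norm (hidden_constraint M g (us h n h) (vs h n h)))
          \<in> O[steps_filter T](\<lambda>(h, n). h ^ r))"
proof -
  have step: "gauss_step M U D g s k h q0 p0 (u h) (v h) (l h)" if "h \<in> {0<..h0}" for h
    using assms that by unfold_locales auto
  have energy: "if \<exists>\<mu>. polynomial_degree_le_on D \<mu> U \<and> real \<mu> \<le> 2 * real k / real s
      then \<forall>h\<in>{0<..h0}. hamiltonian M U (u h h) (v h h) = hamiltonian M U q0 p0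
      else (\<lambda>h. hamiltonian M U (u h h) (v h h) - hamiltonian M U q0 p0)
             \<in> O[at_right 0](\<lambda>h. h ^ (2 * k + 1))"
  proof (cases "\<exists>\<mu>. polynomial_degree_le_on D \<mu> U \<and> real \<mu> \<le> 2 * real k / real s")
    case True
    then obtain \<mu> where \<mu>: "polynomial_degree_le_on D \<mu> U" "real \<mu> \<le> 2 * real k / real s" by blast
    have "real (s * \<mu>) \<le> real (2 * k)" using \<mu>(2) assms(12) by (simp add: field_simps)
    then have "s * \<mu> \<le> 2 * k" by linarith
    then show ?thesis using True gauss_step.energy_preserved[OF step \<mu>(1)] by simp
  next
    case False
    then show ?thesis unfolding if_not_P[OF False] by (intro energy_error_order[OF assms(2,4,5,6,9-16)])
  qed
  have constraint: "\<forall>h\<in>{0<..h0}. g (u h h) = 0"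
    using gauss_step.constraint_preserved[OF step] assms(8) by blast
  have "(\<lambda>h. norm (hidden_constraint M g (u h h) (v h h))) \<in> O[at_right 0](\<lambda>h. h ^ (r + 1)) \<and>
        (\<lambda>(h, n). norm (hidden_constraint M g (us h n h) (vs h n h))) \<in> O[steps_filter T](\<lambda>(h, n). h ^ r)"
    if first: "\<forall>h\<in>{0<..h0}. us h 0 = u h \<and> vs h 0 = v h"
      and conv: "convergence_order T q p us vs r" for us vs r
  proof
    have small: "\<forall>\<^sub>F h in at_right 0. h \<in> {0<..h0}"
      using eventually_at_right_real[OF assms(14)] by (rule eventually_mono) auto
    have "\<forall>\<^sub>F h in at_right 0. h < T"
      using eventually_at_right_real[OF assms(10)] by (rule eventually_mono) auto
    then have "\<forall>\<^sub>F h in at_right 0. h \<in> {0..T} \<and> 0 < h \<and> h < 1"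
      using eventually_h_small by eventually_elim auto
    moreover have "(\<lambda>h. norm (us h 0 h - q h)) \<in> O[at_right 0](\<lambda>h. h ^ (r + 1))"
      "(\<lambda>h. norm (vs h 0 h - p h)) \<in> O[at_right 0](\<lambda>h. h ^ (r + 1))"
      using conv unfolding convergence_order_def by blast+
    ultimately have "(\<lambda>h. norm (hidden_constraint M g (us h 0 h) (vs h 0 h))) \<in> O[at_right 0](\<lambda>h. h ^ (r + 1))"
      by (rule hidden_constraint_order[OF assms(5,11,10)])
    moreover have cong: "\<forall>\<^sub>F h in at_right 0. norm (hidden_constraint M g (us h 0 h) (vs h 0 h))
        = norm (hidden_constraint M g (u h h) (v h h))"
      using small by (rule eventually_mono) (use first in auto)
    ultimately show "(\<lambda>h. norm (hidden_constraint M g (u h h) (v h h))) \<in> O[at_right 0](\<lambda>h. h ^ (r + 1))"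
      by (simp only: landau_o.big.in_cong[OF cong])
  next
    have "\<forall>\<^sub>F x in steps_filter T. real (snd x + 1) * fst x \<in> {0..T} \<and> 0 < fst x \<and> fst x < 1"
      using eventually_steps_filter by (rule eventually_mono) auto
    moreover have "(\<lambda>x. norm (us (fst x) (snd x) (fst x) - q (real (snd x + 1) * fst x))) \<in> O[steps_filter T](\<lambda>x. fst x ^ r)"
      "(\<lambda>x. norm (vs (fst x) (snd x) (fst x) - p (real (snd x + 1) * fst x))) \<in> O[steps_filter T](\<lambda>x. fst x ^ r)"
      using conv unfolding convergence_order_def by (simp_all only: case_prod_beta')
    ultimately have "(\<lambda>x. norm (hidden_constraint M g (us (fst x) (snd x) (fst x)) (vs (fst x) (snd x) (fst x))))
        \<in> O[steps_filter T](\<lambda>x. fst x ^ r)"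
      by (rule hidden_constraint_order[OF assms(5,11,10)])
    then show "(\<lambda>(h, n). norm (hidden_constraint M g (us h n h) (vs h n h))) \<in> O[steps_filter T](\<lambda>(h, n). h ^ r)"
      by (simp only: case_prod_beta')
  qed
  with energy constraint show ?thesis by blast
qed

end
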